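(* Let $f_\infty\in\mathfrak H^{\odot 2}$ be such that, writing $\lambda_{\infty,k}$, $k\geq 1$, for the eigenvalues (repeated according to multiplicity) of the Hilbert–Schmidt operator $A_{f_\infty}:\mathfrak H\to\mathfrak H$, $g\mapsto\langle f_\infty,g\rangle_{\mathfrak H}$, the set $\{k:\lambda_{\infty,k}\neq 0\}$ has cardinality at least $5$ (in particular, $f_\infty$ is not identically zero). Let $(f_n)$ be a sequence of elements of $\mathfrak H^{\odot 2}$ that converges to $f_\infty$ in $\mathfrak H^{\otimes 2}$. Then there exists $c>0$, depending only on $f_\infty$, such that for all $n$, $$\sup_{C\in\mathcal B(\mathbb R)}\big|P(I_2(f_n)\in C)-P(I_2(f_\infty)\in C)\big|\leq c\,\|f_n-f_\infty\|_{\mathfrak H^{\otimes 2}}.$$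
   Context: $\mathfrak H$ is a real separable infinite-dimensional Hilbert space; $\mathfrak H^{\otimes 2}$ is its second (Hilbert) tensor product and $\mathfrak H^{\odot 2}\subset\mathfrak H^{\otimes 2}$ the subspace of symmetric tensors. $X=\{X(h):h\in\mathfrak H\}$ is an isonormal Gaussian process on $\mathfrak H$, i.e. a centered Gaussian family, defined on a probability space $(\Omega,\mathcal F,P)$, with $E[X(h)X(h')]=\langle h,h'\rangle_{\mathfrak H}$; $\mathcal F$ is generated by $X$. $I_2$ denotes the double Wiener–Itô integral with respect to $X$: it is the continuous linear map from $\mathfrak H^{\odot 2}$ to $L^2(\Omega)$ with $I_2(h\otimes h)=X(h)^2-1$ for $\|h\|_{\mathfrak H}=1$, and it satisfies $E[I_2(f)^2]=2\|f\|^2_{\mathfrak H^{\otimes 2}}$. For $f\in\mathfrak H^{\odot 2}$ and $g\in\mathfrak H$, $\langle f,g\rangle_{\mathfrak H}\in\mathfrak H$ denotes the contraction of $f$ with $g$ in one variable, i.e. the continuous bilinear extension of $\langle u\otimes v,g\rangle_{\mathfrak H}=\langle v,g\rangle_{\mathfrak H}\,u$. $\mathcal B(\mathbb R)$ is the set of Borel subsets of $\mathbb R$. *)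

theory Defs
  imports "HOL-Probability.Probability" "HOL-Library.Equipollence"
begin

definition infinite_dimensional :: "'h::real_vector itself \<Rightarrow> bool" where
  "infinite_dimensional _ \<longleftrightarrow> \<not> (\<exists>B::'h set. finite B \<and> span B = UNIV)"

(* The Hilbert space 'k, together with the map (u, v) \<mapsto> u \<otimes> v, is the Hilbert tensor square
   of 'h.  These properties determine ('k, tensor) up to a unique isometric isomorphism. *)
definition hilbert_tensor_square ::
    "('h::real_inner \<Rightarrow> 'h \<Rightarrow> 'k::{real_inner, complete_space}) \<Rightarrow> bool" where
  "hilbert_tensor_square tensor \<longleftrightarrow>
     bounded_bilinear tensor \<and>
     (\<forall>u v u' v'. inner (tensor u v) (tensor u' v') = inner u u' * inner v v') \<and>
     closure (span {tensor u v | u v. True}) = UNIV"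

(* Symmetric tensors are those fixed by the flip, i.e. by the (unique) continuous linear
   operator that maps each u \<otimes> v to v \<otimes> u. *)
definition tensor_flip ::
    "('h::real_inner \<Rightarrow> 'h \<Rightarrow> 'k::real_inner) \<Rightarrow> ('k \<Rightarrow> 'k) \<Rightarrow> bool" where
  "tensor_flip tensor S \<longleftrightarrow> bounded_linear S \<and> (\<forall>u v. S (tensor u v) = tensor v u)"

definition symmetric_tensors ::
    "('h::real_inner \<Rightarrow> 'h \<Rightarrow> 'k::real_inner) \<Rightarrow> 'k set" where
  "symmetric_tensors tensor = {f. \<exists>S. tensor_flip tensor S \<and> S f = f}"

(* For a Hilbert tensor square there is exactly one such contr. *)
definition tensor_contraction ::
    "('h::real_inner \<Rightarrow> 'h \<Rightarrow> 'k::real_inner) \<Rightarrow> ('k \<Rightarrow> 'h \<Rightarrow> 'h) \<Rightarrow> bool" where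
  "tensor_contraction tensor contr \<longleftrightarrow>
     bounded_bilinear contr \<and>
     (\<forall>u v g. contr (tensor u v) g = inner v g *\<^sub>R u)"

definition orthonormal_set :: "'h::real_inner set \<Rightarrow> bool" where
  "orthonormal_set B \<longleftrightarrow> pairwise orthogonal B \<and> (\<forall>b\<in>B. norm b = 1)"

(* Every real number \<mu> occurs in the sequence as often as its multiplicity, the Hilbert dimension
   of the eigenspace for \<mu>; the kernel may contribute infinitely many zeros.  If \<mu> is not an
   eigenvalue, the eigenspace is {0}, so B is empty and \<mu> does not occur. *)
definition eigenvalue_sequence ::
    "('h::real_inner \<Rightarrow> 'h) \<Rightarrow> (nat \<Rightarrow> real) \<Rightarrow> bool" where
  "eigenvalue_sequence A lam \<longleftrightarrow>
     (\<forall>\<mu>. \<exists>B. orthonormal_set B \<and> closure (span B) = {g. A g = \<mu> *\<^sub>R g} \<and>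
              {k. lam k = \<mu>} \<approx> B)"

(* The first disjunct is the degenerate Gaussian law of variance 0. *)
definition centered_gaussian_rv :: "'w measure \<Rightarrow> ('w \<Rightarrow> real) \<Rightarrow> bool" where
  "centered_gaussian_rv M Y \<longleftrightarrow>
     Y \<in> borel_measurable M \<and>
     ((AE \<omega> in M. Y \<omega> = 0) \<or>
      (\<exists>\<sigma>>0. distributed M lborel Y (\<lambda>x. ennreal (normal_density 0 \<sigma> x))))"

definition centered_gaussian_family :: "'w measure \<Rightarrow> ('i \<Rightarrow> 'w \<Rightarrow> real) \<Rightarrow> bool" where
  "centered_gaussian_family M X \<longleftrightarrow>
     (\<forall>J a. finite J \<longrightarrow> centered_gaussian_rv M (\<lambda>\<omega>. \<Sum>i\<in>J. a i * X i \<omega>))"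

definition isonormal_gaussian_process ::
    "'w measure \<Rightarrow> ('h::real_inner \<Rightarrow> 'w \<Rightarrow> real) \<Rightarrow> bool" where
  "isonormal_gaussian_process M X \<longleftrightarrow>
     prob_space M \<and>
     centered_gaussian_family M X \<and>
     (\<forall>h h'. prob_space.expectation M (\<lambda>\<omega>. X h \<omega> * X h' \<omega>) = inner h h') \<and>
     sets M = sigma_sets (space M) {X h -` B \<inter> space M | h B. B \<in> sets borel}"

(* I2 f is a square-integrable representative of an element of L^2(M), so linearity and the
   values on h \<otimes> h hold almost everywhere; continuity is with respect to the L^2(M) distance.
   Only the restriction of I2 to the symmetric tensors matters. *)
definition double_wiener_ito_integral ::
    "'w measure \<Rightarrow> ('h::real_inner \<Rightarrow> 'w \<Rightarrow> real) \<Rightarrow>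
     ('h \<Rightarrow> 'h \<Rightarrow> 'k::real_inner) \<Rightarrow> ('k \<Rightarrow> 'w \<Rightarrow> real) \<Rightarrow> bool" where
  "double_wiener_ito_integral M X tensor I2 \<longleftrightarrow>
     (\<forall>f\<in>symmetric_tensors tensor.
        I2 f \<in> borel_measurable M \<and> integrable M (\<lambda>\<omega>. (I2 f \<omega>)\<^sup>2)) \<and>
     (\<forall>f\<in>symmetric_tensors tensor. \<forall>g\<in>symmetric_tensors tensor. \<forall>a b.
        AE \<omega> in M. I2 (a *\<^sub>R f + b *\<^sub>R g) \<omega> = a * I2 f \<omega> + b * I2 g \<omega>) \<and>
     (\<forall>f\<in>symmetric_tensors tensor. \<forall>g. range g \<subseteq> symmetric_tensors tensor \<longrightarrow> g \<longlonglongrightarrow> f \<longrightarrow>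
        (\<lambda>n. prob_space.expectation M (\<lambda>\<omega>. (I2 (g n) \<omega> - I2 f \<omega>)\<^sup>2)) \<longlonglongrightarrow> 0) \<and>
     (\<forall>h. norm h = 1 \<longrightarrow> (AE \<omega> in M. I2 (tensor h h) \<omega> = (X h \<omega>)\<^sup>2 - 1))"

end

theory Submission
  imports Defs
begin

text \<open>
  Among five nonzero eigenvalues of the Hilbert--Schmidt operator two have the same sign; let
  \<open>e1\<close>, \<open>e2\<close> be orthonormal eigenvectors for two such eigenvalues \<open>l1\<close>, \<open>l2\<close>.  Then
  \<open>I2 f\<close> is a quadratic polynomial in \<open>x = X e1\<close> and \<open>y = X e2\<close> whose quadratic part is
  deterministic and whose other coefficients are measurable with respect to the process on the
  orthogonal complement of \<open>e1\<close> and \<open>e2\<close>, hence independent of \<open>(x, y)\<close>.  For the limit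
  the polynomial is \<open>l1 x^2 + l2 y^2\<close> plus a constant, and the coefficients of \<open>I2 f\<close> differ
  from it in \<open>L^1\<close> by a multiple of the distance of the tensors.

  It remains to compare the laws of two quadratic polynomials in two independent standard normal
  variables.  Completing the square in each variable is an affine change of variables, which moves
  a standard normal law in total variation by a multiple of the size of the change.  What is left
  is a translation of \<open>l1 x^2 + l2 y^2\<close>.  On each ray \<open>y = t x\<close> this form is exponentially
  distributed, and the exponential law depends on its translation in a Lipschitz way.
\<close>

section \<open>Quadratic polynomials in two independent normal variables\<close>

text \<open>Why two eigenvalues, and of equal sign: a single square \<open>l * x^2\<close> has a
  density that blows up at 0, so a translation by r moves its law by the order of sqrt r, and
  eigenvalues of opposite signs leave a logarithmic singularity. With equal signs the form is, up to
  the sign, a mixture of exponential laws whose density is decreasing on the half line and finite at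
  0, which gives a bound linear in r. The linear and constant coefficients of the polynomial are
  random and unbounded. The comparison of two polynomials must therefore hold for all their values,
  with an error whose mean can be estimated; only the quadratic part is deterministic and may be
  assumed to be close to its limit. As \<open>e1\<close> and \<open>e2\<close> are eigenvectors of
  the limit, the limit polynomial has no mixed and no linear terms, so these coefficients of
  \<open>I2 f\<close> depend linearly on the difference of the tensors.\<close>

lemma nn_integral_square_substitution:
  fixes h :: "real \<Rightarrow> ennreal"
  assumes [measurable]: "h \<in> borel_measurable borel"
  shows "(\<integral>\<^sup>+x. ennreal \<bar>x\<bar> * h (x\<^sup>2) \<partial>lborel) = (\<integral>\<^sup>+u. h u * indicator {0..} u \<partial>lborel)"
proof -
  have SUP_ind: "(SUP n::nat. (indicator {0..real n} x :: ennreal)) = indicator {0..} x" for x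
  proof (rule antisym)
    obtain n :: nat where "x \<le> real n" using real_arch_simple by blast
    then have "(indicator {0..} x :: ennreal) \<le> indicator {0..real n} x" by (simp split: split_indicator)
    also have "\<dots> \<le> (SUP n::nat. indicator {0..real n} x)" by (rule SUP_upper) simp
    finally show "(indicator {0..} x :: ennreal) \<le> (SUP n::nat. indicator {0..real n} x)" .
  qed (auto intro!: SUP_least split: split_indicator)
  have SUP_ind2: "(SUP n::nat. (indicator {0..(real n)\<^sup>2} x :: ennreal)) = indicator {0..} x" for x
  proof (rule antisym)
    obtain n :: nat where n: "x \<le> real n" using real_arch_simple by blast
    have "real n \<le> (real n)\<^sup>2" by (cases n) (auto simp: power2_eq_square)
    with n have "x \<le> (real n)\<^sup>2" by linarith
    then have "(indicator {0..} x :: ennreal) \<le> indicator {0..(real n)\<^sup>2} x" by (simp split: split_indicator)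
    also have "\<dots> \<le> (SUP n::nat. indicator {0..(real n)\<^sup>2} x)" by (rule SUP_upper) simp
    finally show "(indicator {0..} x :: ennreal) \<le> (SUP n::nat. indicator {0..(real n)\<^sup>2} x)" .
  qed (auto intro!: SUP_least split: split_indicator)
  \<comment> \<open>The substitution u = x^2 is made on compact intervals, which then exhaust the
    half line by monotone convergence. The case n = 0 is separate because the substitution rule
    takes a nondegenerate interval.\<close>
  have eq: "(\<integral>\<^sup>+u. h u * indicator {0..(real n)\<^sup>2} u \<partial>lborel)
      = (\<integral>\<^sup>+x. h (x\<^sup>2) * ennreal (2 * x) * indicator {0..real n} x \<partial>lborel)" for n :: nat
  proof (cases "n = 0")
    case True
    have "(\<integral>\<^sup>+u. h u * indicator {0::real} u \<partial>lborel) = 0"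
      by (intro nn_integral_0_iff_AE[THEN iffD2] AE_I[where N="{0}"]) (auto split: split_indicator)
    moreover have "(\<integral>\<^sup>+x. h (x\<^sup>2) * ennreal (2 * x) * indicator {0::real} x \<partial>lborel) = 0"
      by (intro nn_integral_0_iff_AE[THEN iffD2] AE_I[where N="{0}"]) (auto split: split_indicator)
    ultimately show ?thesis using True by simp
  next
    case False
    show ?thesis
    proof -
      have "(\<integral>\<^sup>+u. h u * indicator {0\<^sup>2..(real n)\<^sup>2} u \<partial>lborel)
        = (\<integral>\<^sup>+x. h (x\<^sup>2) * ennreal (2 * x) * indicator {0..real n} x \<partial>lborel)"
        by (rule nn_integral_substitution_aux) (use False in \<open>auto intro!: derivative_eq_intros continuous_intros\<close>)
      then show ?thesis by simp
    qed
  qed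
  \<comment> \<open>Both half lines contribute equally, which turns the derivative 2 x on the right
    half line into |x| on the whole line.\<close>
  have reflect: "(\<integral>\<^sup>+x. h (x\<^sup>2) * ennreal \<bar>x\<bar> * indicator {0..} x \<partial>lborel)
      = (\<integral>\<^sup>+x. h (x\<^sup>2) * ennreal \<bar>x\<bar> * indicator {0..} (-x) \<partial>lborel)"
    using nn_integral_real_affine[where t=0 and c="-1" and f="\<lambda>x. h (x\<^sup>2) * ennreal \<bar>x\<bar> * indicator {0..} x"] by simp
  have "(\<integral>\<^sup>+u. h u * indicator {0..} u \<partial>lborel) = (\<integral>\<^sup>+u. (SUP n::nat. h u * indicator {0..(real n)\<^sup>2} u) \<partial>lborel)"
    by (simp add: SUP_mult_left_ennreal[symmetric] SUP_ind2)
  also have "\<dots> = (SUP n::nat. \<integral>\<^sup>+u. h u * indicator {0..(real n)\<^sup>2} u \<partial>lborel)"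
  proof (rule nn_integral_monotone_convergence_SUP)
    show "incseq (\<lambda>n u. h u * indicator {0..(real n)\<^sup>2} u)"
    proof (intro incseq_SucI le_funI mult_left_mono)
      fix n :: nat and u :: real
      have "(real n)\<^sup>2 \<le> (real (Suc n))\<^sup>2" by (intro power_mono) auto
      then have "u \<le> (real (Suc n))\<^sup>2" if "u \<le> (real n)\<^sup>2" using that by linarith
      then show "(indicator {0..(real n)\<^sup>2} u :: ennreal) \<le> indicator {0..(real (Suc n))\<^sup>2} u"
        by (auto split: split_indicator simp del: of_nat_Suc)
    qed auto
  qed simp
  also have "\<dots> = (SUP n::nat. \<integral>\<^sup>+x. h (x\<^sup>2) * ennreal (2 * x) * indicator {0..real n} x \<partial>lborel)"
    by (simp add: eq)
  also have "\<dots> = (\<integral>\<^sup>+x. (SUP n::nat. h (x\<^sup>2) * ennreal (2 * x) * indicator {0..real n} x) \<partial>lborel)"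
  proof (rule nn_integral_monotone_convergence_SUP[symmetric])
    show "incseq (\<lambda>n x. h (x\<^sup>2) * ennreal (2 * x) * indicator {0..real n} x)"
      by (intro incseq_SucI le_funI mult_left_mono) (auto split: split_indicator)
  qed simp
  also have "\<dots> = (\<integral>\<^sup>+x. h (x\<^sup>2) * ennreal (2 * x) * indicator {0..} x \<partial>lborel)"
    by (simp add: SUP_mult_left_ennreal[symmetric] SUP_ind)
  also have "\<dots> = (\<integral>\<^sup>+x. h (x\<^sup>2) * ennreal \<bar>x\<bar> * indicator {0..} x + h (x\<^sup>2) * ennreal \<bar>x\<bar> * indicator {0..} x \<partial>lborel)"
  proof (intro nn_integral_cong)
    fix x :: real
    have "ennreal (2 * x) = ennreal x + ennreal x" if "0 \<le> x"
      using that by (simp add: ennreal_plus[symmetric] del: ennreal_plus)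
    then show "h (x\<^sup>2) * ennreal (2 * x) * indicator {0..} x
      = h (x\<^sup>2) * ennreal \<bar>x\<bar> * indicator {0..} x + h (x\<^sup>2) * ennreal \<bar>x\<bar> * indicator {0..} x"
      by (auto split: split_indicator simp: distrib_left)
  qed
  also have "\<dots> = (\<integral>\<^sup>+x. h (x\<^sup>2) * ennreal \<bar>x\<bar> * indicator {0..} x \<partial>lborel) +
      (\<integral>\<^sup>+x. h (x\<^sup>2) * ennreal \<bar>x\<bar> * indicator {0..} x \<partial>lborel)"
    by (rule nn_integral_add) auto
  also have "\<dots> = (\<integral>\<^sup>+x. h (x\<^sup>2) * ennreal \<bar>x\<bar> * indicator {0..} x \<partial>lborel) +
      (\<integral>\<^sup>+x. h (x\<^sup>2) * ennreal \<bar>x\<bar> * indicator {0..} (- x) \<partial>lborel)"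
    by (rule arg_cong2[where f="(+)", OF refl]) (rule reflect)
  also have "\<dots> = (\<integral>\<^sup>+x. h (x\<^sup>2) * ennreal \<bar>x\<bar> * indicator {0..} x + h (x\<^sup>2) * ennreal \<bar>x\<bar> * indicator {0..} (- x) \<partial>lborel)"
    by (rule nn_integral_add[symmetric]) auto
  also have "\<dots> = (\<integral>\<^sup>+x. ennreal \<bar>x\<bar> * h (x\<^sup>2) \<partial>lborel)"
    by (intro nn_integral_cong) (auto split: split_indicator simp: mult.commute)
  finally show ?thesis ..
qed

text \<open>Substituting u - r / \<kappa> for u moves the shift into the exponential weight, which
  yields the constant. The domain shrinks to [r / \<kappa>, \<infinity>), and enlarging it again
  only increases the integral of a nonnegative function.\<close>

lemma nn_integral_exponential_shift:
  fixes f :: "real \<Rightarrow> ennreal" and \<kappa> w r :: real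
  assumes [measurable]: "f \<in> borel_measurable borel" and "0 < \<kappa>" "0 \<le> r"
  shows "(\<integral>\<^sup>+u. f (\<kappa> * u + r) * ennreal (exp (- w * u)) * indicator {0..} u \<partial>lborel)
    \<le> ennreal (exp (w * r / \<kappa>)) * (\<integral>\<^sup>+u. f (\<kappa> * u) * ennreal (exp (- w * u)) * indicator {0..} u \<partial>lborel)"
proof -
  have "(\<integral>\<^sup>+u. f (\<kappa> * u + r) * ennreal (exp (- w * u)) * indicator {0..} u \<partial>lborel)
    = (\<integral>\<^sup>+u. f (\<kappa> * u) * ennreal (exp (w * r / \<kappa> - w * u)) * indicator {r / \<kappa>..} u \<partial>lborel)"
    using assms(2)
    by (subst nn_integral_real_affine[where t="- (r / \<kappa>)" and c=1])
       (auto intro!: nn_integral_cong simp: algebra_simps split: split_indicator)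
  also have "\<dots> \<le> (\<integral>\<^sup>+u. ennreal (exp (w * r / \<kappa>)) * (f (\<kappa> * u) * ennreal (exp (- w * u)) * indicator {0..} u) \<partial>lborel)"
  proof (intro nn_integral_mono)
    fix u
    have "r / \<kappa> \<ge> 0" using assms by simp
    moreover have "ennreal (exp (w * r / \<kappa> - w * u)) = ennreal (exp (w * r / \<kappa>)) * ennreal (exp (- w * u))"
      by (simp add: ennreal_mult[symmetric] mult_exp_exp)
    ultimately show "f (\<kappa> * u) * ennreal (exp (w * r / \<kappa> - w * u)) * indicator {r / \<kappa>..} u
      \<le> ennreal (exp (w * r / \<kappa>)) * (f (\<kappa> * u) * ennreal (exp (- w * u)) * indicator {0..} u)"
      by (auto split: split_indicator simp: mult_ac)
  qed
  also have "\<dots> = ennreal (exp (w * r / \<kappa>)) * (\<integral>\<^sup>+u. f (\<kappa> * u) * ennreal (exp (- w * u)) * indicator {0..} u \<partial>lborel)"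
    by (rule nn_integral_cmult) simp
  finally show ?thesis .
qed

text \<open>For fixed \<open>t\<close> the quadratic form along the ray \<open>y = t x\<close> is exponentially distributed, and
  an exponential law dominates a multiple of its own translates to the right.\<close>

lemma nn_integral_gaussian_quadratic_shift:
  fixes f :: "real \<Rightarrow> ennreal" and l1 l2 m r :: real
  assumes [measurable]: "f \<in> borel_measurable borel" and "0 < m" "m \<le> l1" "m \<le> l2" "0 \<le> r"
  shows "(\<integral>\<^sup>+y. \<integral>\<^sup>+x. f (l1 * x\<^sup>2 + l2 * y\<^sup>2 + r) \<partial>std_normal_distribution \<partial>std_normal_distribution)
    \<le> ennreal (exp (r / (2 * m))) *
      (\<integral>\<^sup>+y. \<integral>\<^sup>+x. f (l1 * x\<^sup>2 + l2 * y\<^sup>2) \<partial>std_normal_distribution \<partial>std_normal_distribution)"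
proof -
  \<comment> \<open>First x = t y for fixed y, with Jacobian |y|, then u = y^2 for fixed t. The
    second substitution absorbs |y| exactly, so no power of u remains next to the exponential
    weight: this is the gain from the second variable.\<close>
  have polar: "(\<integral>\<^sup>+y. \<integral>\<^sup>+x. f (l1 * x\<^sup>2 + l2 * y\<^sup>2 + r) \<partial>std_normal_distribution \<partial>std_normal_distribution)
      = ennreal (1 / (2 * pi)) * (\<integral>\<^sup>+t. \<integral>\<^sup>+u. f ((l2 + l1 * t\<^sup>2) * u + r) * ennreal (exp (- ((1 + t\<^sup>2) / 2) * u)) * indicator {0..} u \<partial>lborel \<partial>lborel)"
      (is "?L r = ?c * ?R r") for r
  proof -
    let ?h = "\<lambda>t u. f ((l2 + l1 * t\<^sup>2) * u + r) * ennreal (exp (- ((1 + t\<^sup>2) / 2) * u))"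
    have "?L r = (\<integral>\<^sup>+y. \<integral>\<^sup>+x. ?c * (f (l1 * x\<^sup>2 + l2 * y\<^sup>2 + r) * ennreal (exp (- (x\<^sup>2 + y\<^sup>2) / 2))) \<partial>lborel \<partial>lborel)"
    proof -
      have dens: "ennreal (std_normal_density y) * (ennreal (std_normal_density x) * g) = ?c * (g * ennreal (exp (- (x\<^sup>2 + y\<^sup>2) / 2)))"
        for x y :: real and g :: ennreal
      proof -
        have "ennreal (std_normal_density y) * ennreal (std_normal_density x) = ?c * ennreal (exp (- (x\<^sup>2 + y\<^sup>2) / 2))"
          by (subst ennreal_mult[symmetric], simp, simp, subst ennreal_mult[symmetric], simp, simp)
             (simp add: std_normal_density_def mult_exp_exp add_divide_distrib add.commute)
        then show ?thesis by (metis mult.assoc mult.commute)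
      qed
      show ?thesis
        by (simp add: nn_integral_density nn_integral_cmult[symmetric] dens)
    qed
    also have "\<dots> = ?c * (\<integral>\<^sup>+y. \<integral>\<^sup>+x. f (l1 * x\<^sup>2 + l2 * y\<^sup>2 + r) * ennreal (exp (- (x\<^sup>2 + y\<^sup>2) / 2)) \<partial>lborel \<partial>lborel)"
      by (simp add: nn_integral_cmult)
    also have "(\<integral>\<^sup>+y. \<integral>\<^sup>+x. f (l1 * x\<^sup>2 + l2 * y\<^sup>2 + r) * ennreal (exp (- (x\<^sup>2 + y\<^sup>2) / 2)) \<partial>lborel \<partial>lborel)
      = (\<integral>\<^sup>+y. \<integral>\<^sup>+t. ennreal \<bar>y\<bar> * ?h t (y\<^sup>2) \<partial>lborel \<partial>lborel)"
    proof (intro nn_integral_cong_AE AE_I[where N="{0}"] subsetI CollectI, goal_cases)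
      case (1 y)
      have "y = 0"
      proof (rule ccontr)
        assume y: "y \<noteq> 0"
        have "(\<integral>\<^sup>+x. f (l1 * x\<^sup>2 + l2 * y\<^sup>2 + r) * ennreal (exp (- (x\<^sup>2 + y\<^sup>2) / 2)) \<partial>lborel)
          = ennreal \<bar>y\<bar> * (\<integral>\<^sup>+t. f (l1 * (0 + y * t)\<^sup>2 + l2 * y\<^sup>2 + r) * ennreal (exp (- ((0 + y * t)\<^sup>2 + y\<^sup>2) / 2)) \<partial>lborel)"
          using y by (intro nn_integral_real_affine) auto
        also have "\<dots> = (\<integral>\<^sup>+t. ennreal \<bar>y\<bar> * ?h t (y\<^sup>2) \<partial>lborel)"
        proof -
          have "f (l1 * (0 + y * t)\<^sup>2 + l2 * y\<^sup>2 + r) * ennreal (exp (- ((0 + y * t)\<^sup>2 + y\<^sup>2) / 2)) = ?h t (y\<^sup>2)" for t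
            by (intro arg_cong2[where f="(*)"] arg_cong[where f=f] arg_cong[where f="\<lambda>x. ennreal (exp x)"])
               (simp_all add: power_mult_distrib field_simps)
          then show ?thesis by (simp add: nn_integral_cmult[symmetric])
        qed
        finally show False using 1 by simp
      qed
      then show ?case by simp
    qed auto
    also have "\<dots> = (\<integral>\<^sup>+t. \<integral>\<^sup>+y. ennreal \<bar>y\<bar> * ?h t (y\<^sup>2) \<partial>lborel \<partial>lborel)"
      by (rule lborel_pair.Fubini') simp
    also have "\<dots> = ?R r"
      by (intro nn_integral_cong nn_integral_square_substitution) simp
    finally show ?thesis .
  qed
  have "?R r \<le> (\<integral>\<^sup>+t. ennreal (exp (r / (2 * m))) *
      (\<integral>\<^sup>+u. f ((l2 + l1 * t\<^sup>2) * u + 0) * ennreal (exp (- ((1 + t\<^sup>2) / 2) * u)) * indicator {0..} u \<partial>lborel) \<partial>lborel)"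
  proof (intro nn_integral_mono)
    fix t :: real
    \<comment> \<open>Along each ray the ratio of the rate (1 + t^2) / 2 to the slope l2 + l1 t^2 is
      at most 1 / (2 m). With eigenvalues of opposite signs the slope would vanish on some
      ray.\<close>
    have k: "m * (1 + t\<^sup>2) \<le> l2 + l1 * t\<^sup>2"
      using assms mult_right_mono[of m l1 "t\<^sup>2"] by (simp add: distrib_left)
    have "0 < m * (1 + t\<^sup>2)" using assms by (simp add: add_pos_nonneg)
    with k have k0: "0 < l2 + l1 * t\<^sup>2" by linarith
    have "(1 + t\<^sup>2) / 2 * r / (l2 + l1 * t\<^sup>2) \<le> (1 + t\<^sup>2) / 2 * r / (m * (1 + t\<^sup>2))"
      using k \<open>0 < m * (1 + t\<^sup>2)\<close> assms by (intro divide_left_mono) auto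
    also have "\<dots> = r / (2 * m)"
    proof -
      have "c / 2 * r / (m * c) = r / (2 * m)" if "c > 0" for c :: real
        using that assms(2) by (simp add: field_simps)
      moreover have "0 < 1 + t\<^sup>2" by (simp add: add_pos_nonneg)
      ultimately show ?thesis by blast
    qed
    finally have e: "exp ((1 + t\<^sup>2) / 2 * r / (l2 + l1 * t\<^sup>2)) \<le> exp (r / (2 * m))" by simp
    have "(\<integral>\<^sup>+u. f ((l2 + l1 * t\<^sup>2) * u + r) * ennreal (exp (- ((1 + t\<^sup>2) / 2) * u)) * indicator {0..} u \<partial>lborel)
      \<le> ennreal (exp ((1 + t\<^sup>2) / 2 * r / (l2 + l1 * t\<^sup>2))) *
      (\<integral>\<^sup>+u. f ((l2 + l1 * t\<^sup>2) * u) * ennreal (exp (- ((1 + t\<^sup>2) / 2) * u)) * indicator {0..} u \<partial>lborel)"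
      by (rule nn_integral_exponential_shift) (use k0 assms in auto)
    also have "\<dots> \<le> ennreal (exp (r / (2 * m))) *
      (\<integral>\<^sup>+u. f ((l2 + l1 * t\<^sup>2) * u) * ennreal (exp (- ((1 + t\<^sup>2) / 2) * u)) * indicator {0..} u \<partial>lborel)"
      by (intro mult_right_mono ennreal_leI e) simp
    finally show "(\<integral>\<^sup>+u. f ((l2 + l1 * t\<^sup>2) * u + r) * ennreal (exp (- ((1 + t\<^sup>2) / 2) * u)) * indicator {0..} u \<partial>lborel)
      \<le> ennreal (exp (r / (2 * m))) *
      (\<integral>\<^sup>+u. f ((l2 + l1 * t\<^sup>2) * u + 0) * ennreal (exp (- ((1 + t\<^sup>2) / 2) * u)) * indicator {0..} u \<partial>lborel)"
      unfolding add_0_right .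
  qed
  also have "\<dots> = ennreal (exp (r / (2 * m))) * ?R 0"
    by (rule nn_integral_cmult) simp
  finally have "?c * ?R r \<le> ?c * (ennreal (exp (r / (2 * m))) * ?R 0)"
    by (rule mult_left_mono) simp
  also have "\<dots> = ennreal (exp (r / (2 * m))) * (?c * ?R 0)"
    by (rule mult.left_commute)
  finally have "?L r \<le> ennreal (exp (r / (2 * m))) * ?L 0"
    unfolding polar[of r, symmetric] polar[of 0, symmetric] .
  then show ?thesis unfolding add_0_right .
qed

section \<open>Perturbation of quadratic polynomials under the standard normal law\<close>

interpretation std_normal: real_distribution std_normal_distribution
  by (rule real_dist_normal_dist)

text \<open>Laws are compared through measurable functions into [0, 1] instead of sets. This class
  is stable under integrating out a variable, under translation, and under passing to
  \<open>1 - \<phi>\<close>, which makes one-sided estimates two-sided.\<close>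

lemma integrable_unit_interval_std_normal:
  fixes \<phi> :: "real \<Rightarrow> real"
  assumes "\<phi> \<in> borel_measurable borel" "\<And>x. 0 \<le> \<phi> x" "\<And>x. \<phi> x \<le> 1"
  shows "integrable std_normal_distribution \<phi>"
  by (rule std_normal.integrable_const_bound[where B=1]) (use assms in auto)

lemma std_normal_integral_bounds:
  fixes \<phi> :: "real \<Rightarrow> real"
  assumes [measurable]: "\<phi> \<in> borel_measurable borel"
    and \<phi>: "\<And>x. 0 \<le> \<phi> x" "\<And>x. \<phi> x \<le> 1"
  shows "0 \<le> (\<integral>x. \<phi> x \<partial>std_normal_distribution)" "(\<integral>x. \<phi> x \<partial>std_normal_distribution) \<le> 1"
  using \<phi> integrable_unit_interval_std_normal[OF assms]
  by (auto intro!: std_normal.integral_le_const)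

lemma std_normal_integral_compl:
  fixes \<phi> :: "real \<Rightarrow> real"
  assumes "\<phi> \<in> borel_measurable borel" "\<And>x. 0 \<le> \<phi> x" "\<And>x. \<phi> x \<le> 1"
  shows "(\<integral>x. 1 - \<phi> x \<partial>std_normal_distribution) = 1 - (\<integral>x. \<phi> x \<partial>std_normal_distribution)"
  using integrable_unit_interval_std_normal[OF assms] std_normal.prob_space
  by (subst Bochner_Integration.integral_diff) (auto simp del: std_normal.space_eq_univ)

lemma has_bochner_integral_std_normal_square:
  "has_bochner_integral lborel (\<lambda>x. std_normal_density x * (\<alpha> * x\<^sup>2 + \<beta>)) (\<alpha> + \<beta>)"
proof -
  have "has_bochner_integral lborel (\<lambda>x. \<alpha> * (std_normal_density x * x\<^sup>2)) (\<alpha> * 1)"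
    using std_normal_moment_even[of 1] by (intro has_bochner_integral_mult_right) (auto simp: fact_2)
  moreover have "has_bochner_integral lborel (\<lambda>x. \<beta> * std_normal_density x) (\<beta> * 1)"
    using std_normal_moment_even[of 0] by (intro has_bochner_integral_mult_right) auto
  ultimately show ?thesis
    using has_bochner_integral_add by (fastforce simp: algebra_simps)
qed

text \<open>The error term bounds the mean of \<open>|ln (dQ/dP)|\<close>, where \<open>P\<close> and \<open>Q\<close> are the two normal laws;
  it comes from \<open>dQ/dP \<ge> 1 + ln (dQ/dP)\<close>.\<close>

lemma std_normal_affine_lower:
  fixes \<phi> :: "real \<Rightarrow> real" and m s :: real
  assumes [measurable]: "\<phi> \<in> borel_measurable borel"
    and \<phi>: "\<And>x. 0 \<le> \<phi> x" "\<And>x. \<phi> x \<le> 1" and s: "0 < s"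
  shows "(\<integral>x. \<phi> x \<partial>std_normal_distribution) - (\<bar>1 - 1 / s\<^sup>2\<bar> / 2 + \<bar>m\<bar> / s\<^sup>2 + m\<^sup>2 / (2 * s\<^sup>2) + \<bar>ln s\<bar>)
    \<le> (\<integral>x. \<phi> (m + s * x) \<partial>std_normal_distribution)"
proof -
  \<comment> \<open>\<open>\<alpha> * y^2 + \<beta>\<close> will bound minus the logarithm of the
    density ratio. The term with |m| is split in halves by |y| <= (1 + y^2) / 2. Since the second
    moment is 1, the mean of the bound is \<open>\<alpha> + \<beta>\<close>, the error in the
    claim.\<close>
  define \<alpha> where "\<alpha> = \<bar>1 - 1 / s\<^sup>2\<bar> / 2 + \<bar>m\<bar> / (2 * s\<^sup>2)"
  define \<beta> where "\<beta> = \<bar>m\<bar> / (2 * s\<^sup>2) + m\<^sup>2 / (2 * s\<^sup>2) + \<bar>ln s\<bar>"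
  let ?N = std_normal_density
  have int: "integrable lborel (\<lambda>x. ?N x * \<phi> x)" if [measurable]: "\<phi> \<in> borel_measurable borel"
      and "\<And>x. 0 \<le> \<phi> x" "\<And>x. \<phi> x \<le> 1" for \<phi> :: "real \<Rightarrow> real"
    using integrable_unit_interval_std_normal[of \<phi>] that by (subst (asm) integrable_density) auto
  have integral_N: "(\<integral>x. \<psi> x \<partial>std_normal_distribution) = (\<integral>x. ?N x * \<psi> x \<partial>lborel)"
    if "\<psi> \<in> borel_measurable borel" for \<psi> :: "real \<Rightarrow> real"
    using that by (subst integral_density) auto
  have "(\<integral>x. \<phi> x \<partial>std_normal_distribution) - (\<alpha> + \<beta>)
      = (\<integral>y. ?N y * \<phi> y \<partial>lborel) - (\<integral>y. ?N y * (\<alpha> * y\<^sup>2 + \<beta>) \<partial>lborel)"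
    using has_bochner_integral_std_normal_square[of \<alpha> \<beta>] by (simp add: integral_N has_bochner_integral_integral_eq)
  also have "\<dots> = (\<integral>y. ?N y * \<phi> y - ?N y * (\<alpha> * y\<^sup>2 + \<beta>) \<partial>lborel)"
    using int[of \<phi>] \<phi> has_bochner_integral_std_normal_square[of \<alpha> \<beta>]
    by (intro Bochner_Integration.integral_diff[symmetric]) (auto simp: has_bochner_integral_iff)
  also have "\<dots> \<le> (\<integral>y. ?N ((y - m) / s) / s * \<phi> y \<partial>lborel)"
  proof (rule integral_mono)
    show "integrable lborel (\<lambda>y. ?N y * \<phi> y - ?N y * (\<alpha> * y\<^sup>2 + \<beta>))"
      using int[of \<phi>] \<phi> has_bochner_integral_std_normal_square[of \<alpha> \<beta>]
      by (intro Bochner_Integration.integrable_diff) (auto simp: has_bochner_integral_iff)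
    have "integrable lborel (\<lambda>y. ?N ((- m / s) + (1 / s) * y) * \<phi> (m + s * ((- m / s) + (1 / s) * y)))"
      using s by (intro lborel_integrable_real_affine[where f="\<lambda>x. ?N x * \<phi> (m + s * x)"] int) (auto simp: \<phi>)
    moreover have "(- m / s) + (1 / s) * y = (y - m) / s" "m + s * ((y - m) / s) = y" for y
      using s by (auto simp: field_simps)
    ultimately have "integrable lborel (\<lambda>y. (1 / s) * (?N ((y - m) / s) * \<phi> y))"
      by simp
    then show "integrable lborel (\<lambda>y. ?N ((y - m) / s) / s * \<phi> y)" by simp
  next
    fix y :: real
    \<comment> \<open>\<open>u\<close> is the logarithm of the density of the law of m + s x
      relative to the standard normal law.\<close>
    define u where "u = y\<^sup>2 / 2 - (y - m)\<^sup>2 / (2 * s\<^sup>2) - ln s"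
    have "?N y * exp u = 1 / sqrt (2 * pi) * exp (- y\<^sup>2 / 2 + (y\<^sup>2 / 2 - (y - m)\<^sup>2 / (2 * s\<^sup>2) - ln s))"
      unfolding std_normal_density_def u_def exp_add by simp
    also have "- y\<^sup>2 / 2 + (y\<^sup>2 / 2 - (y - m)\<^sup>2 / (2 * s\<^sup>2) - ln s) = - ((y - m) / s)\<^sup>2 / 2 - ln s"
      by (simp add: power_divide)
    also have "exp \<dots> = exp (- ((y - m) / s)\<^sup>2 / 2) / s"
      using s by (simp add: exp_diff)
    finally have Nu: "?N ((y - m) / s) / s = ?N y * exp u"
      by (simp add: std_normal_density_def)
    have "u = (1 - 1 / s\<^sup>2) * y\<^sup>2 / 2 + y * m / s\<^sup>2 - m\<^sup>2 / (2 * s\<^sup>2) - ln s"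
      using s unfolding u_def by (simp add: field_simps power2_eq_square)
    moreover have "u = A + B - C - D \<Longrightarrow> - u \<le> \<bar>A\<bar> + \<bar>B\<bar> + C + \<bar>D\<bar>" for A B C D :: real
      by linarith
    ultimately have "- u \<le> \<bar>(1 - 1 / s\<^sup>2) * y\<^sup>2 / 2\<bar> + \<bar>y * m / s\<^sup>2\<bar> + m\<^sup>2 / (2 * s\<^sup>2) + \<bar>ln s\<bar>"
      by blast
    also have "\<bar>(1 - 1 / s\<^sup>2) * y\<^sup>2 / 2\<bar> = \<bar>1 - 1 / s\<^sup>2\<bar> / 2 * y\<^sup>2" by (simp add: abs_mult)
    also have "\<bar>y * m / s\<^sup>2\<bar> \<le> (1 + y\<^sup>2) / 2 * (\<bar>m\<bar> / s\<^sup>2)"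
    proof -
      have "0 \<le> (1 - \<bar>y\<bar>)\<^sup>2" by simp
      then have "\<bar>y\<bar> \<le> (1 + y\<^sup>2) / 2" by (simp add: power2_diff)
      then have "\<bar>y\<bar> * (\<bar>m\<bar> / s\<^sup>2) \<le> (1 + y\<^sup>2) / 2 * (\<bar>m\<bar> / s\<^sup>2)" by (intro mult_right_mono) auto
      then show ?thesis by (simp add: abs_mult)
    qed
    finally have u: "- u \<le> \<alpha> * y\<^sup>2 + \<beta>"
      by (simp add: \<alpha>_def \<beta>_def algebra_simps add_divide_distrib)
    have "?N y * \<phi> y - ?N y * (\<alpha> * y\<^sup>2 + \<beta>) = ?N y * (\<phi> y - (\<alpha> * y\<^sup>2 + \<beta>))"
      by (simp add: algebra_simps)
    also have "\<dots> \<le> ?N y * (exp u * \<phi> y)"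
    proof (intro mult_left_mono)
      have B: "0 \<le> \<alpha> * y\<^sup>2 + \<beta>" by (simp add: \<alpha>_def \<beta>_def)
      have "1 + u \<le> exp u" by (rule exp_ge_add_one_self)
      have "(1 - (\<alpha> * y\<^sup>2 + \<beta>)) * \<phi> y \<le> exp u * \<phi> y"
      proof (rule mult_right_mono)
        show "1 - (\<alpha> * y\<^sup>2 + \<beta>) \<le> exp u" using u \<open>1 + u \<le> exp u\<close> by linarith
      qed (rule \<phi>(1))
      moreover have "(\<alpha> * y\<^sup>2 + \<beta>) * \<phi> y \<le> \<alpha> * y\<^sup>2 + \<beta>"
        using B \<phi>(2) by (intro mult_left_le) auto
      ultimately show "\<phi> y - (\<alpha> * y\<^sup>2 + \<beta>) \<le> exp u * \<phi> y" by (simp add: algebra_simps)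
    qed simp
    finally show "?N y * \<phi> y - ?N y * (\<alpha> * y\<^sup>2 + \<beta>) \<le> ?N ((y - m) / s) / s * \<phi> y"
      unfolding Nu by simp
  qed
  also have "\<dots> = (\<integral>x. ?N x * \<phi> (m + s * x) \<partial>lborel)"
    using s lborel_integral_real_affine[of s "\<lambda>y. ?N ((y - m) / s) / s * \<phi> y" m] by simp
  also have "\<dots> = (\<integral>x. \<phi> (m + s * x) \<partial>std_normal_distribution)"
    by (simp add: integral_N)
  finally show ?thesis by (simp add: \<alpha>_def \<beta>_def add_divide_distrib algebra_simps)
qed

text \<open>The lower bound for \<open>1 - \<phi>\<close> is the upper bound for
  \<open>\<phi>\<close>.\<close>

lemma std_normal_affine:
  fixes \<phi> :: "real \<Rightarrow> real" and m s :: real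
  assumes [measurable]: "\<phi> \<in> borel_measurable borel"
    and \<phi>: "\<And>x. 0 \<le> \<phi> x" "\<And>x. \<phi> x \<le> 1" and s: "0 < s"
  shows "\<bar>(\<integral>x. \<phi> (m + s * x) \<partial>std_normal_distribution) - (\<integral>x. \<phi> x \<partial>std_normal_distribution)\<bar>
    \<le> \<bar>1 - 1 / s\<^sup>2\<bar> / 2 + \<bar>m\<bar> / s\<^sup>2 + m\<^sup>2 / (2 * s\<^sup>2) + \<bar>ln s\<bar>"
  using std_normal_affine_lower[of \<phi> s m] std_normal_affine_lower[of "\<lambda>x. 1 - \<phi> x" s m]
    std_normal_integral_compl[of \<phi>] std_normal_integral_compl[of "\<lambda>x. \<phi> (m + s * x)"] \<phi> s
  by (auto simp: abs_le_iff)

text \<open>Completing the square and rescaling by sqrt (a / l) turns the leading coefficient into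
  \<open>l\<close>; the closeness of \<open>a\<close> to \<open>l\<close> keeps a / l between 1/2
  and 3/2. The resulting translation by - \<beta>^2 / a is kept exactly, because in one variable
  translations are not controlled linearly; it is estimated only when both variables are
  present.\<close>

lemma std_normal_square_perturbation:
  fixes \<phi> :: "real \<Rightarrow> real" and a l \<beta> \<rho> :: real
  assumes [measurable]: "\<phi> \<in> borel_measurable borel"
    and \<phi>: "\<And>x. 0 \<le> \<phi> x" "\<And>x. \<phi> x \<le> 1" and l: "l \<noteq> 0" and a: "\<bar>a - l\<bar> \<le> \<bar>l\<bar> / 2"
  shows "\<bar>(\<integral>x. \<phi> (a * x\<^sup>2 + 2 * \<beta> * x + \<rho>) \<partial>std_normal_distribution)
      - (\<integral>x. \<phi> (l * x\<^sup>2 + (\<rho> - \<beta>\<^sup>2 / a)) \<partial>std_normal_distribution)\<bar>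
    \<le> (4 / \<bar>l\<bar> + 4 / l\<^sup>2) * (\<bar>a - l\<bar> + \<bar>\<beta>\<bar> + \<beta>\<^sup>2)"
proof -
  define z where "z = a / l - 1"
  have "z = (a - l) / l" and al: "a / l = 1 + z"
    using l by (auto simp: z_def field_simps)
  then have z': "\<bar>z\<bar> = \<bar>a - l\<bar> / \<bar>l\<bar>" by (simp add: abs_divide)
  moreover have "\<bar>a - l\<bar> / \<bar>l\<bar> \<le> 1 / 2"
    using l a by (simp add: field_simps)
  ultimately have z: "\<bar>z\<bar> \<le> 1 / 2" by simp
  define s where "s = sqrt (1 + z)"
  have s2: "s\<^sup>2 = 1 + z" and s0: "0 < s" using z by (auto simp: s_def)
  have s_ge: "1 / 2 \<le> s"
    using z unfolding s_def by (intro real_le_rsqrt) (simp add: power2_eq_square)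
  have a0: "a \<noteq> 0" "\<bar>l\<bar> / 2 \<le> \<bar>a\<bar>"
    using l a by linarith+
  have a_eq: "a = l * s\<^sup>2" using l by (simp add: s2 al[symmetric])
  \<comment> \<open>Since \<open>l * s\<^sup>2 = a\<close>, this choice gives
    \<open>l * (m + s * x)\<^sup>2\<close> the linear coefficient 2 \<beta>.\<close>
  define m where "m = s * \<beta> / a"
  have sq: "a * x\<^sup>2 + 2 * \<beta> * x + \<rho> = l * (m + s * x)\<^sup>2 + (\<rho> - \<beta>\<^sup>2 / a)" for x
  proof -
    have "l * (m + s * x)\<^sup>2 = (l * s\<^sup>2) * (\<beta> / a + x)\<^sup>2"
      by (simp add: m_def power2_eq_square algebra_simps)
    also have "\<dots> = a * x\<^sup>2 + 2 * \<beta> * x + \<beta>\<^sup>2 / a"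
      unfolding a_eq[symmetric] using a0(1) by (simp add: power2_eq_square field_simps)
    finally show ?thesis by simp
  qed
  have "\<bar>(\<integral>x. \<phi> (a * x\<^sup>2 + 2 * \<beta> * x + \<rho>) \<partial>std_normal_distribution)
      - (\<integral>x. \<phi> (l * x\<^sup>2 + (\<rho> - \<beta>\<^sup>2 / a)) \<partial>std_normal_distribution)\<bar>
    \<le> \<bar>1 - 1 / s\<^sup>2\<bar> / 2 + \<bar>m\<bar> / s\<^sup>2 + m\<^sup>2 / (2 * s\<^sup>2) + \<bar>ln s\<bar>"
    unfolding sq using \<phi> s0 by (intro std_normal_affine[where \<phi>="\<lambda>x. \<phi> (l * x\<^sup>2 + (\<rho> - \<beta>\<^sup>2 / a))"]) auto
  also have "\<bar>1 - 1 / s\<^sup>2\<bar> / 2 \<le> \<bar>z\<bar>"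
  proof -
    have "1 - 1 / s\<^sup>2 = z / (1 + z)" using z by (simp add: s2 field_simps)
    then have "\<bar>1 - 1 / s\<^sup>2\<bar> = \<bar>z\<bar> / (1 + z)" using z by (simp add: abs_divide)
    also have "\<dots> \<le> \<bar>z\<bar> / (1 / 2)" using z by (intro divide_left_mono) auto
    finally show ?thesis by simp
  qed
  also have "\<bar>ln s\<bar> \<le> \<bar>z\<bar>"
  proof -
    have "\<bar>ln (1 + z) - z\<bar> \<le> 2 * z\<^sup>2" using z by (rule abs_ln_one_plus_x_minus_x_bound)
    moreover have "z\<^sup>2 \<le> 1 / 2 * \<bar>z\<bar>"
      using mult_right_mono[OF z abs_ge_zero[of z]] by (simp add: power2_eq_square abs_mult_self_eq)
    ultimately have "\<bar>ln (1 + z)\<bar> \<le> 2 * \<bar>z\<bar>" by linarith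
    moreover have "ln s = ln (1 + z) / 2" using z unfolding s_def by (intro ln_sqrt) auto
    ultimately show ?thesis by simp
  qed
  also have "\<bar>m\<bar> / s\<^sup>2 \<le> 4 / \<bar>l\<bar> * \<bar>\<beta>\<bar>"
  proof -
    have "\<bar>m\<bar> / s\<^sup>2 = \<bar>\<beta>\<bar> / (s * \<bar>a\<bar>)"
      using s0 by (simp add: m_def abs_mult abs_divide power2_eq_square)
    also have "\<dots> \<le> \<bar>\<beta>\<bar> / (1 / 2 * (\<bar>l\<bar> / 2))"
      using a0 s_ge l by (intro divide_left_mono mult_mono mult_pos_pos) auto
    finally show ?thesis by (simp add: mult.commute)
  qed
  also have "m\<^sup>2 / (2 * s\<^sup>2) \<le> 2 / l\<^sup>2 * \<beta>\<^sup>2"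
  proof -
    have "(\<bar>l\<bar> / 2)\<^sup>2 \<le> \<bar>a\<bar>\<^sup>2" using a0 by (intro power_mono) auto
    then have "l\<^sup>2 / 4 \<le> a\<^sup>2" by (simp add: power_divide)
    moreover have "m\<^sup>2 / (2 * s\<^sup>2) = \<beta>\<^sup>2 / (2 * a\<^sup>2)"
      using s0 by (simp add: m_def power_divide power_mult_distrib)
    moreover have "\<beta>\<^sup>2 / (2 * a\<^sup>2) \<le> \<beta>\<^sup>2 / (2 * (l\<^sup>2 / 4))"
      using \<open>l\<^sup>2 / 4 \<le> a\<^sup>2\<close> l a0 by (intro divide_left_mono mult_pos_pos) auto
    ultimately show ?thesis by simp
  qed
  finally have "\<bar>(\<integral>x. \<phi> (a * x\<^sup>2 + 2 * \<beta> * x + \<rho>) \<partial>std_normal_distribution)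
      - (\<integral>x. \<phi> (l * x\<^sup>2 + (\<rho> - \<beta>\<^sup>2 / a)) \<partial>std_normal_distribution)\<bar>
    \<le> \<bar>z\<bar> + 4 / \<bar>l\<bar> * \<bar>\<beta>\<bar> + 2 / l\<^sup>2 * \<beta>\<^sup>2 + \<bar>z\<bar>" by simp
  also have "\<dots> \<le> 4 / \<bar>l\<bar> * \<bar>a - l\<bar> + 4 / \<bar>l\<bar> * \<bar>\<beta>\<bar> + 4 / l\<^sup>2 * \<beta>\<^sup>2"
  proof -
    have "2 / l\<^sup>2 * \<beta>\<^sup>2 \<le> 4 / l\<^sup>2 * \<beta>\<^sup>2" by (intro mult_right_mono divide_right_mono) auto
    moreover have "2 * \<bar>z\<bar> \<le> 4 / \<bar>l\<bar> * \<bar>a - l\<bar>" by (simp add: z' divide_right_mono)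
    ultimately show ?thesis by linarith
  qed
  also have "\<dots> \<le> (4 / \<bar>l\<bar> + 4 / l\<^sup>2) * (\<bar>a - l\<bar> + \<bar>\<beta>\<bar> + \<beta>\<^sup>2)"
  proof -
    have "0 \<le> 4 / l\<^sup>2 * \<bar>a - l\<bar>" "0 \<le> 4 / l\<^sup>2 * \<bar>\<beta>\<bar>" "0 \<le> 4 / \<bar>l\<bar> * \<beta>\<^sup>2" by auto
    then show ?thesis by (simp only: distrib_left distrib_right)
  qed
  finally show ?thesis .
qed

text \<open>The multiplicative bound by exp (r / (2 m)) becomes additive through exp (- x) >= 1 - x
  and the fact that the expectation is at most 1.\<close>

lemma std_normal_quadratic_shift_lower:
  fixes \<phi> :: "real \<Rightarrow> real" and l1 l2 m r :: real
  assumes [measurable]: "\<phi> \<in> borel_measurable borel"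
    and \<phi>: "\<And>x. 0 \<le> \<phi> x" "\<And>x. \<phi> x \<le> 1"
    and m: "0 < m" "m \<le> l1" "m \<le> l2" "0 \<le> r"
  shows "(\<integral>y. \<integral>x. \<phi> (l1 * x\<^sup>2 + (l2 * y\<^sup>2 + r)) \<partial>std_normal_distribution \<partial>std_normal_distribution) - r / (2 * m)
    \<le> (\<integral>y. \<integral>x. \<phi> (l1 * x\<^sup>2 + l2 * y\<^sup>2) \<partial>std_normal_distribution \<partial>std_normal_distribution)"
proof -
  define \<Phi> where "\<Phi> r = (\<integral>y. \<integral>x. \<phi> (l1 * x\<^sup>2 + (l2 * y\<^sup>2 + r)) \<partial>std_normal_distribution \<partial>std_normal_distribution)" for r
  have inner: "0 \<le> (\<integral>x. \<phi> (l1 * x\<^sup>2 + z) \<partial>std_normal_distribution)"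
      "(\<integral>x. \<phi> (l1 * x\<^sup>2 + z) \<partial>std_normal_distribution) \<le> 1" for z
    using \<phi> by (intro std_normal_integral_bounds; simp)+
  have \<Phi>01: "0 \<le> \<Phi> r" "\<Phi> r \<le> 1" for r
    unfolding \<Phi>_def by (rule std_normal_integral_bounds(1); simp add: inner) (rule std_normal_integral_bounds(2); simp add: inner)
  have nn: "(\<integral>\<^sup>+y. \<integral>\<^sup>+x. ennreal (\<phi> (l1 * x\<^sup>2 + l2 * y\<^sup>2 + r)) \<partial>std_normal_distribution \<partial>std_normal_distribution)
    = ennreal (\<Phi> r)" for r
  proof -
    have "(\<integral>\<^sup>+y. \<integral>\<^sup>+x. ennreal (\<phi> (l1 * x\<^sup>2 + l2 * y\<^sup>2 + r)) \<partial>std_normal_distribution \<partial>std_normal_distribution)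
      = (\<integral>\<^sup>+y. ennreal (\<integral>x. \<phi> (l1 * x\<^sup>2 + (l2 * y\<^sup>2 + r)) \<partial>std_normal_distribution) \<partial>std_normal_distribution)"
      unfolding add.assoc using \<phi>
      by (intro nn_integral_cong nn_integral_eq_integral integrable_unit_interval_std_normal) auto
    also have "\<dots> = ennreal (\<Phi> r)"
      unfolding \<Phi>_def using inner
      by (intro nn_integral_eq_integral integrable_unit_interval_std_normal) auto
    finally show ?thesis .
  qed
  have "ennreal (\<Phi> r) \<le> ennreal (exp (r / (2 * m))) * ennreal (\<Phi> 0)"
    using nn_integral_gaussian_quadratic_shift[of "\<lambda>x. ennreal (\<phi> x)" m l1 l2 r] m nn[of r] nn[of 0] by simp
  then have le: "\<Phi> r \<le> exp (r / (2 * m)) * \<Phi> 0"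
    using \<Phi>01 by (simp add: ennreal_mult[symmetric])
  have "\<Phi> r - r / (2 * m) \<le> \<Phi> r * (1 - r / (2 * m))"
    using mult_right_mono[OF \<Phi>01(2)[of r], of "r / (2 * m)"] m by (simp add: algebra_simps)
  also have "\<dots> \<le> \<Phi> r * exp (- (r / (2 * m)))"
    using \<Phi>01 exp_ge_add_one_self[of "- (r / (2 * m))"] by (intro mult_left_mono) auto
  also have "\<dots> \<le> \<Phi> 0"
    using le by (simp add: exp_minus field_simps)
  finally show ?thesis by (simp add: \<Phi>_def)
qed

text \<open>Translating the test function by \<open>r'\<close> leaves a shift by
  \<open>r - r'\<close>, which may be taken nonnegative by symmetry.\<close>

lemma std_normal_quadratic_shift_pos:
  fixes \<phi> :: "real \<Rightarrow> real" and l1 l2 m r r' :: real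
  assumes [measurable]: "\<phi> \<in> borel_measurable borel"
    and \<phi>: "\<And>x. 0 \<le> \<phi> x" "\<And>x. \<phi> x \<le> 1"
    and m: "0 < m" "m \<le> l1" "m \<le> l2"
  shows "\<bar>(\<integral>y. \<integral>x. \<phi> (l1 * x\<^sup>2 + (l2 * y\<^sup>2 + r)) \<partial>std_normal_distribution \<partial>std_normal_distribution) -
    (\<integral>y. \<integral>x. \<phi> (l1 * x\<^sup>2 + (l2 * y\<^sup>2 + r')) \<partial>std_normal_distribution \<partial>std_normal_distribution)\<bar> \<le> \<bar>r - r'\<bar> / (2 * m)"
    (is "\<bar>?I \<phi> r - ?I \<phi> r'\<bar> \<le> _")
proof -
  have inner: "0 \<le> (\<integral>x. \<phi> (l1 * x\<^sup>2 + z) \<partial>std_normal_distribution)"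
      "(\<integral>x. \<phi> (l1 * x\<^sup>2 + z) \<partial>std_normal_distribution) \<le> 1" for z
    using \<phi> by (intro std_normal_integral_bounds; simp)+
  have compl: "?I (\<lambda>x. 1 - \<phi> x) r = 1 - ?I \<phi> r" for r
    using \<phi> inner by (simp add: std_normal_integral_compl)
  have "\<bar>?I \<phi> r - ?I \<phi> r'\<bar> \<le> (r - r') / (2 * m)" if "r' \<le> r" for r r'
  proof -
    have lower: "?I \<psi> r - (r - r') / (2 * m) \<le> ?I \<psi> r'"
      if [measurable]: "\<psi> \<in> borel_measurable borel" and "\<And>x. 0 \<le> \<psi> x" "\<And>x. \<psi> x \<le> 1" for \<psi> :: "real \<Rightarrow> real"
      using std_normal_quadratic_shift_lower[of "\<lambda>z. \<psi> (z + r')" m l1 l2 "r - r'"] m that \<open>r' \<le> r\<close>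
      by (simp add: add.assoc)
    show ?thesis
      using lower[of \<phi>] lower[of "\<lambda>x. 1 - \<phi> x"] \<phi> by (auto simp: compl abs_le_iff)
  qed
  from this[of r r'] this[of r' r] show ?thesis by (cases "r \<le> r'") (auto simp: abs_minus_commute)
qed

text \<open>A negative definite form is reduced to a positive definite one by reflecting the test
  function.\<close>

lemma std_normal_quadratic_shift:
  fixes \<phi> :: "real \<Rightarrow> real" and l1 l2 r r' :: real
  assumes [measurable]: "\<phi> \<in> borel_measurable borel"
    and \<phi>: "\<And>x. 0 \<le> \<phi> x" "\<And>x. \<phi> x \<le> 1" and l: "0 < l1 * l2"
  shows "\<bar>(\<integral>y. \<integral>x. \<phi> (l1 * x\<^sup>2 + (l2 * y\<^sup>2 + r)) \<partial>std_normal_distribution \<partial>std_normal_distribution) -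
    (\<integral>y. \<integral>x. \<phi> (l1 * x\<^sup>2 + (l2 * y\<^sup>2 + r')) \<partial>std_normal_distribution \<partial>std_normal_distribution)\<bar>
    \<le> \<bar>r - r'\<bar> / (2 * min \<bar>l1\<bar> \<bar>l2\<bar>)"
proof (cases "0 < l1")
  case True
  then have "0 < l2" using l by (simp add: zero_less_mult_iff)
  then show ?thesis
    using std_normal_quadratic_shift_pos[of \<phi> "min \<bar>l1\<bar> \<bar>l2\<bar>" l1 l2 r r'] \<phi> True by simp
next
  case False
  then have "l1 < 0" "l2 < 0" using l by (auto simp: zero_less_mult_iff)
  then show ?thesis
    using std_normal_quadratic_shift_pos[of "\<lambda>z. \<phi> (- z)" "min \<bar>l1\<bar> \<bar>l2\<bar>" "- l1" "- l2" "- r" "- r'"] \<phi>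
    by (simp add: abs_minus_commute algebra_simps)
qed

text \<open>For integrating an estimate in the first variable over the second one: the linear
  coefficient in x is affine in y, so the error of the first comparison grows quadratically in
  y.\<close>

lemma std_normal_abs_diff_le:
  fixes f g :: "real \<Rightarrow> real"
  assumes [measurable]: "f \<in> borel_measurable borel" "g \<in> borel_measurable borel"
    and f: "\<And>x. 0 \<le> f x" "\<And>x. f x \<le> 1" and g: "\<And>x. 0 \<le> g x" "\<And>x. g x \<le> 1"
    and le: "\<And>x. \<bar>f x - g x\<bar> \<le> \<alpha> * x\<^sup>2 + \<beta>"
  shows "\<bar>(\<integral>x. f x \<partial>std_normal_distribution) - (\<integral>x. g x \<partial>std_normal_distribution)\<bar> \<le> \<alpha> + \<beta>"
proof -
  have int: "integrable std_normal_distribution f" "integrable std_normal_distribution g"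
    using f g by (auto intro!: integrable_unit_interval_std_normal)
  have sq: "has_bochner_integral std_normal_distribution (\<lambda>x. \<alpha> * x\<^sup>2 + \<beta>) (\<alpha> + \<beta>)"
    using has_bochner_integral_std_normal_square[of \<alpha> \<beta>] by (intro has_bochner_integral_density) auto
  have "\<bar>(\<integral>x. f x \<partial>std_normal_distribution) - (\<integral>x. g x \<partial>std_normal_distribution)\<bar>
      = \<bar>\<integral>x. f x - g x \<partial>std_normal_distribution\<bar>"
    using int by simp
  also have "\<dots> \<le> (\<integral>x. \<bar>f x - g x\<bar> \<partial>std_normal_distribution)"
    by (rule integral_abs_bound)
  also have "\<dots> \<le> (\<integral>x. \<alpha> * x\<^sup>2 + \<beta> \<partial>std_normal_distribution)"
    using int sq le by (intro integral_mono) (auto simp: has_bochner_integral_iff)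
  also have "\<dots> = \<alpha> + \<beta>"
    using sq by (rule has_bochner_integral_integral_eq)
  finally show ?thesis .
qed

text \<open>Smallness is required only of the differences of the quadratic coefficients. The values
  of \<open>p\<close>, \<open>q\<close>, \<open>r\<close> and \<open>r'\<close> are arbitrary
  because random variables will be inserted for them pointwise; this is why \<open>p^2\<close> and
  \<open>q^2\<close> appear beside |p| and |q|, and all these terms have finite means then.\<close>

definition quadratic_perturbation_bound :: "real \<Rightarrow> real \<Rightarrow> real \<Rightarrow> real \<Rightarrow> bool" where
  "quadratic_perturbation_bound l1 l2 \<delta> c \<longleftrightarrow>
    (\<forall>(\<phi> :: real \<Rightarrow> real) a b d p q r r'. \<phi> \<in> borel_measurable borel \<longrightarrow> (\<forall>x. 0 \<le> \<phi> x) \<longrightarrow> (\<forall>x. \<phi> x \<le> 1) \<longrightarrow>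
      \<bar>a - l1\<bar> \<le> \<delta> \<longrightarrow> \<bar>b\<bar> \<le> \<delta> \<longrightarrow> \<bar>d - l2\<bar> \<le> \<delta> \<longrightarrow>
      \<bar>(\<integral>y. \<integral>x. \<phi> (a * x\<^sup>2 + 2 * (b * y + p) * x + (d * y\<^sup>2 + 2 * q * y + r)) \<partial>std_normal_distribution \<partial>std_normal_distribution)
        - (\<integral>y. \<integral>x. \<phi> (l1 * x\<^sup>2 + (l2 * y\<^sup>2 + r')) \<partial>std_normal_distribution \<partial>std_normal_distribution)\<bar>
      \<le> c * (\<bar>a - l1\<bar> + \<bar>b\<bar> + \<bar>d - l2\<bar> + \<bar>p\<bar> + \<bar>q\<bar> + p\<^sup>2 + q\<^sup>2 + \<bar>r - r'\<bar>))"

text \<open>Three comparisons are added: in x for fixed y, in y after x has been integrated out, and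
  the remaining translation of the limit form.\<close>

lemma std_normal_quadratic_perturbation:
  fixes l1 l2 :: real
  assumes l: "0 < l1 * l2"
  obtains \<delta> c where "0 < \<delta>" "0 \<le> c" "quadratic_perturbation_bound l1 l2 \<delta> c"
proof
  \<comment> \<open>The bound 1 gives b^2 <= |b|, and |l1| / 2 keeps \<open>a\<close> away from 0.
    The last two bounds add up to |d' - l2| <= |l2| / 2 for the coefficient \<open>d'\<close> that
    arises after completing the square in x.\<close>
  define \<delta> where "\<delta> = min (min 1 (\<bar>l1\<bar> / 2)) (min (\<bar>l2\<bar> / 4) (\<bar>l1\<bar> * \<bar>l2\<bar> / 8))"
  have l0: "l1 \<noteq> 0" "l2 \<noteq> 0" using l by auto
  then show "0 < \<delta>" by (auto simp: \<delta>_def)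
  define K where "K l = 4 / \<bar>l\<bar> + 4 / l\<^sup>2" for l :: real
  have K0: "0 \<le> K l" for l by (simp add: K_def)
  \<comment> \<open>With \<open>S\<close> the total size of the perturbation, A S bounds |d' - l2|
    and |q'|, B S bounds q'^2, and C S bounds the final translation. The three summands of
    \<open>c\<close> belong to the three comparisons.\<close>
  define A where "A = 1 + 2 / \<bar>l1\<bar>"
  define B where "B = 2 + 8 / l1\<^sup>2"
  define C where "C = 1 + 2 / \<bar>l1\<bar> + 2 / \<bar>l2\<bar> * B"
  define c where "c = K l1 * 3 + K l2 * (A + A + B) + C / (2 * min \<bar>l1\<bar> \<bar>l2\<bar>)"
  have ABC: "0 \<le> A" "0 \<le> B" "0 \<le> C" by (auto simp: A_def B_def C_def)
  then show "0 \<le> c" using K0 by (auto simp: c_def)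
  show "quadratic_perturbation_bound l1 l2 \<delta> c"
    unfolding quadratic_perturbation_bound_def
  proof (intro allI impI)
    fix \<phi> :: "real \<Rightarrow> real" and a b d p q r r' :: real
    assume [measurable]: "\<phi> \<in> borel_measurable borel" and \<phi>': "\<forall>x. 0 \<le> \<phi> x" "\<forall>x. \<phi> x \<le> 1"
      and \<delta>: "\<bar>a - l1\<bar> \<le> \<delta>" "\<bar>b\<bar> \<le> \<delta>" "\<bar>d - l2\<bar> \<le> \<delta>"
    have \<phi>: "0 \<le> \<phi> x" "\<phi> x \<le> 1" for x using \<phi>' by auto
    define S where "S = \<bar>a - l1\<bar> + \<bar>b\<bar> + \<bar>d - l2\<bar> + \<bar>p\<bar> + \<bar>q\<bar> + p\<^sup>2 + q\<^sup>2 + \<bar>r - r'\<bar>"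
    have S: "\<bar>a - l1\<bar> + \<bar>b\<bar> + \<bar>p\<bar> + p\<^sup>2 \<le> S" "q\<^sup>2 \<le> S" "p\<^sup>2 \<le> S"
      and S1: "\<bar>b\<bar> \<le> S" "\<bar>d - l2\<bar> \<le> S" "\<bar>p\<bar> \<le> S" "\<bar>q\<bar> \<le> S" "\<bar>r - r'\<bar> \<le> S"
      by (auto simp: S_def)
    have a: "\<bar>a - l1\<bar> \<le> \<bar>l1\<bar> / 2" and b1: "\<bar>b\<bar> \<le> 1" using \<delta> by (auto simp: \<delta>_def)
    have a0: "\<bar>l1\<bar> / 2 \<le> \<bar>a\<bar>" using a by linarith
    then have an0: "a \<noteq> 0" using l0 by auto
    have div_a: "x / \<bar>a\<bar> \<le> 2 / \<bar>l1\<bar> * x" if "0 \<le> x" for x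
      using divide_left_mono[OF a0 that] l0 an0 by (simp add: mult.commute)
    have b2: "b\<^sup>2 \<le> \<bar>b\<bar>" using mult_right_mono[OF b1 abs_ge_zero[of b]] by (simp add: power2_eq_square abs_mult_self_eq)
    \<comment> \<open>Completing the square in x subtracts (b y + p)^2 / a. The coefficients of y^2
      and 2 y change to \<open>d'\<close> and \<open>q'\<close>; \<open>d'\<close> is the Schur
      complement of \<open>a\<close>.\<close>
    define d' where "d' = d - b\<^sup>2 / a"
    define q' where "q' = q - b * p / a"
    have "\<bar>d' - l2\<bar> \<le> \<bar>d - l2\<bar> + \<bar>b\<^sup>2 / a\<bar>" unfolding d'_def by linarith
    also have "\<bar>b\<^sup>2 / a\<bar> \<le> 2 / \<bar>l1\<bar> * b\<^sup>2" using div_a[of "b\<^sup>2"] by (simp add: abs_divide)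
    also have "2 / \<bar>l1\<bar> * b\<^sup>2 \<le> 2 / \<bar>l1\<bar> * \<bar>b\<bar>" using b2 by (intro mult_left_mono) auto
    finally have d'_le: "\<bar>d' - l2\<bar> \<le> \<bar>d - l2\<bar> + 2 / \<bar>l1\<bar> * \<bar>b\<bar>" by simp
    also have "\<dots> \<le> \<bar>l2\<bar> / 4 + 2 / \<bar>l1\<bar> * (\<bar>l1\<bar> * \<bar>l2\<bar> / 8)"
      using \<delta> by (intro add_mono mult_left_mono) (auto simp: \<delta>_def)
    also have "\<dots> = \<bar>l2\<bar> / 2" using l0 by (simp add: field_simps)
    finally have d'2: "\<bar>d' - l2\<bar> \<le> \<bar>l2\<bar> / 2" .
    have d'0: "\<bar>l2\<bar> / 2 \<le> \<bar>d'\<bar>" using d'2 by linarith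
    then have d'n0: "d' \<noteq> 0" using l0 by auto
    have div_d: "x / \<bar>d'\<bar> \<le> 2 / \<bar>l2\<bar> * x" if "0 \<le> x" for x
      using divide_left_mono[OF d'0 that] l0 d'n0 by (simp add: mult.commute)
    have t_le: "x \<le> S \<Longrightarrow> 2 / \<bar>l1\<bar> * x \<le> 2 / \<bar>l1\<bar> * S" for x by (intro mult_left_mono) auto
    have d'A: "\<bar>d' - l2\<bar> \<le> A * S"
      using d'_le t_le[OF S1(1)] S1(2) unfolding A_def distrib_right mult_1 by linarith
    have bpa: "\<bar>b * p / a\<bar> \<le> 2 / \<bar>l1\<bar> * \<bar>p\<bar>"
    proof -
      have "\<bar>b * p\<bar> \<le> \<bar>p\<bar>" using mult_right_mono[OF b1 abs_ge_zero[of p]] by (simp add: abs_mult)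
      then have "2 / \<bar>l1\<bar> * \<bar>b * p\<bar> \<le> 2 / \<bar>l1\<bar> * \<bar>p\<bar>" by (intro mult_left_mono) auto
      then show ?thesis using div_a[of "\<bar>b * p\<bar>"] by (simp add: abs_divide)
    qed
    have q'A: "\<bar>q'\<bar> \<le> A * S"
    proof -
      have "\<bar>q'\<bar> \<le> \<bar>q\<bar> + \<bar>b * p / a\<bar>" unfolding q'_def by linarith
      then show ?thesis using bpa t_le[OF S1(3)] S1(4) unfolding A_def distrib_right mult_1 by linarith
    qed
    have q'B: "q'\<^sup>2 \<le> B * S"
    proof -
      have "q'\<^sup>2 \<le> 2 * q\<^sup>2 + 2 * (b * p / a)\<^sup>2"
        using zero_le_power2[of "q + b * p / a"] by (simp add: q'_def power2_diff power2_sum)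
      also have "(b * p / a)\<^sup>2 \<le> (2 / \<bar>l1\<bar> * \<bar>p\<bar>)\<^sup>2"
        using bpa by (subst abs_le_square_iff[symmetric]) simp
      also have "(2 / \<bar>l1\<bar> * \<bar>p\<bar>)\<^sup>2 = 4 / l1\<^sup>2 * p\<^sup>2" by (simp add: power_mult_distrib power_divide)
      finally have "q'\<^sup>2 \<le> 2 * q\<^sup>2 + 8 / l1\<^sup>2 * p\<^sup>2" by simp
      moreover have "8 / l1\<^sup>2 * p\<^sup>2 \<le> 8 / l1\<^sup>2 * S" using S(3) by (intro mult_left_mono) auto
      moreover have "q\<^sup>2 \<le> S" by (rule S(2))
      ultimately show ?thesis unfolding B_def distrib_right by linarith
    qed
    define \<rho> where "\<rho> = r - p\<^sup>2 / a"
    have \<rho>C: "\<bar>\<rho> - q'\<^sup>2 / d' - r'\<bar> \<le> C * S"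
    proof -
      have "\<bar>\<rho> - q'\<^sup>2 / d' - r'\<bar> \<le> \<bar>r - r'\<bar> + \<bar>p\<^sup>2 / a\<bar> + \<bar>q'\<^sup>2 / d'\<bar>" unfolding \<rho>_def by linarith
      also have "\<bar>p\<^sup>2 / a\<bar> \<le> 2 / \<bar>l1\<bar> * S" using div_a[of "p\<^sup>2"] t_le[OF S(3)] by (simp add: abs_divide)
      also have "\<bar>q'\<^sup>2 / d'\<bar> \<le> 2 / \<bar>l2\<bar> * (B * S)"
        using div_d[of "q'\<^sup>2"] mult_left_mono[OF q'B, of "2 / \<bar>l2\<bar>"] by (simp add: abs_divide)
      also note S1(5)
      finally show ?thesis by (simp add: C_def algebra_simps)
    qed

    \<comment> \<open>Integrating out x leaves a function into [0, 1] again, so the one-variable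
      comparison applies a second time, in y.\<close>
    define \<psi> where "\<psi> z = (\<integral>x. \<phi> (l1 * x\<^sup>2 + z) \<partial>std_normal_distribution)" for z
    have [measurable]: "\<psi> \<in> borel_measurable borel" unfolding \<psi>_def by measurable
    have \<psi>: "0 \<le> \<psi> z" "\<psi> z \<le> 1" for z
      unfolding \<psi>_def using \<phi> by (intro std_normal_integral_bounds; simp)+

    have "\<bar>(\<integral>y. \<integral>x. \<phi> (a * x\<^sup>2 + 2 * (b * y + p) * x + (d * y\<^sup>2 + 2 * q * y + r)) \<partial>std_normal_distribution \<partial>std_normal_distribution)
        - (\<integral>y. \<psi> (d' * y\<^sup>2 + 2 * q' * y + \<rho>) \<partial>std_normal_distribution)\<bar>
      \<le> K l1 * (\<bar>b\<bar> / 2 + 2 * b\<^sup>2) + K l1 * (\<bar>a - l1\<bar> + \<bar>b\<bar> / 2 + \<bar>p\<bar> + 2 * p\<^sup>2)"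
    proof (rule std_normal_abs_diff_le)
      fix y :: real
      let ?\<beta> = "b * y + p"
      have eq: "d' * y\<^sup>2 + 2 * q' * y + \<rho> = d * y\<^sup>2 + 2 * q * y + r - ?\<beta>\<^sup>2 / a"
        using an0 by (simp add: d'_def q'_def \<rho>_def field_simps power2_eq_square)
      have "\<bar>(\<integral>x. \<phi> (a * x\<^sup>2 + 2 * ?\<beta> * x + (d * y\<^sup>2 + 2 * q * y + r)) \<partial>std_normal_distribution)
          - \<psi> (d' * y\<^sup>2 + 2 * q' * y + \<rho>)\<bar> \<le> K l1 * (\<bar>a - l1\<bar> + \<bar>?\<beta>\<bar> + ?\<beta>\<^sup>2)"
        unfolding \<psi>_def eq K_def using \<phi> l0 a by (intro std_normal_square_perturbation) auto
      also have "\<dots> \<le> K l1 * (\<bar>a - l1\<bar> + (\<bar>b\<bar> * (1 + y\<^sup>2) / 2 + \<bar>p\<bar>) + (2 * b\<^sup>2 * y\<^sup>2 + 2 * p\<^sup>2))"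
      proof (intro mult_left_mono add_mono order_refl K0)
        have "0 \<le> (1 - \<bar>y\<bar>)\<^sup>2" by simp
        then have "\<bar>y\<bar> \<le> (1 + y\<^sup>2) / 2" by (simp add: power2_diff)
        then have "\<bar>b\<bar> * \<bar>y\<bar> \<le> \<bar>b\<bar> * ((1 + y\<^sup>2) / 2)" by (intro mult_left_mono) auto
        moreover have "\<bar>?\<beta>\<bar> \<le> \<bar>b\<bar> * \<bar>y\<bar> + \<bar>p\<bar>" using abs_triangle_ineq[of "b * y" p] by (simp add: abs_mult)
        ultimately show "\<bar>?\<beta>\<bar> \<le> \<bar>b\<bar> * (1 + y\<^sup>2) / 2 + \<bar>p\<bar>" by simp
        show "?\<beta>\<^sup>2 \<le> 2 * b\<^sup>2 * y\<^sup>2 + 2 * p\<^sup>2"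
          using zero_le_power2[of "b * y - p"] by (simp add: power2_diff power2_sum power_mult_distrib)
      qed
      also have "\<dots> = K l1 * (\<bar>b\<bar> / 2 + 2 * b\<^sup>2) * y\<^sup>2 + K l1 * (\<bar>a - l1\<bar> + \<bar>b\<bar> / 2 + \<bar>p\<bar> + 2 * p\<^sup>2)"
        by (simp add: algebra_simps add_divide_distrib)
      finally show "\<bar>(\<integral>x. \<phi> (a * x\<^sup>2 + 2 * ?\<beta> * x + (d * y\<^sup>2 + 2 * q * y + r)) \<partial>std_normal_distribution)
          - \<psi> (d' * y\<^sup>2 + 2 * q' * y + \<rho>)\<bar>
        \<le> K l1 * (\<bar>b\<bar> / 2 + 2 * b\<^sup>2) * y\<^sup>2 + K l1 * (\<bar>a - l1\<bar> + \<bar>b\<bar> / 2 + \<bar>p\<bar> + 2 * p\<^sup>2)" .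
      show "0 \<le> (\<integral>x. \<phi> (a * x\<^sup>2 + 2 * ?\<beta> * x + (d * y\<^sup>2 + 2 * q * y + r)) \<partial>std_normal_distribution)"
        using \<phi> by (intro std_normal_integral_bounds) auto
      show "(\<integral>x. \<phi> (a * x\<^sup>2 + 2 * ?\<beta> * x + (d * y\<^sup>2 + 2 * q * y + r)) \<partial>std_normal_distribution) \<le> 1"
        using \<phi> by (intro std_normal_integral_bounds) auto
    qed (use \<psi> in \<open>auto\<close>)
    also have "K l1 * (\<bar>b\<bar> / 2 + 2 * b\<^sup>2) + K l1 * (\<bar>a - l1\<bar> + \<bar>b\<bar> / 2 + \<bar>p\<bar> + 2 * p\<^sup>2)
        = K l1 * (\<bar>a - l1\<bar> + \<bar>b\<bar> + 2 * b\<^sup>2 + \<bar>p\<bar> + 2 * p\<^sup>2)"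
      by (simp add: algebra_simps add_divide_distrib)
    also have "\<dots> \<le> K l1 * (3 * S)"
      using b2 S(1) zero_le_power2[of p] by (intro mult_left_mono K0) linarith
    finally have step1: "\<bar>(\<integral>y. \<integral>x. \<phi> (a * x\<^sup>2 + 2 * (b * y + p) * x + (d * y\<^sup>2 + 2 * q * y + r)) \<partial>std_normal_distribution \<partial>std_normal_distribution)
        - (\<integral>y. \<psi> (d' * y\<^sup>2 + 2 * q' * y + \<rho>) \<partial>std_normal_distribution)\<bar> \<le> K l1 * (3 * S)" .

    have "\<bar>(\<integral>y. \<psi> (d' * y\<^sup>2 + 2 * q' * y + \<rho>) \<partial>std_normal_distribution)
        - (\<integral>y. \<psi> (l2 * y\<^sup>2 + (\<rho> - q'\<^sup>2 / d')) \<partial>std_normal_distribution)\<bar> \<le> K l2 * (\<bar>d' - l2\<bar> + \<bar>q'\<bar> + q'\<^sup>2)"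
      unfolding K_def using \<psi> l0 d'2 by (intro std_normal_square_perturbation) auto
    also have "\<dots> \<le> K l2 * (A * S + A * S + B * S)"
      using d'A q'A q'B by (intro mult_left_mono K0 add_mono)
    finally have step2: "\<bar>(\<integral>y. \<psi> (d' * y\<^sup>2 + 2 * q' * y + \<rho>) \<partial>std_normal_distribution)
        - (\<integral>y. \<psi> (l2 * y\<^sup>2 + (\<rho> - q'\<^sup>2 / d')) \<partial>std_normal_distribution)\<bar> \<le> K l2 * (A * S + A * S + B * S)" .

    have "\<bar>(\<integral>y. \<psi> (l2 * y\<^sup>2 + (\<rho> - q'\<^sup>2 / d')) \<partial>std_normal_distribution)
        - (\<integral>y. \<psi> (l2 * y\<^sup>2 + r') \<partial>std_normal_distribution)\<bar> \<le> \<bar>\<rho> - q'\<^sup>2 / d' - r'\<bar> / (2 * min \<bar>l1\<bar> \<bar>l2\<bar>)"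
      unfolding \<psi>_def using \<phi> l by (intro std_normal_quadratic_shift) auto
    also have "\<dots> \<le> C * S / (2 * min \<bar>l1\<bar> \<bar>l2\<bar>)"
      using \<rho>C by (intro divide_right_mono) auto
    finally have step3: "\<bar>(\<integral>y. \<psi> (l2 * y\<^sup>2 + (\<rho> - q'\<^sup>2 / d')) \<partial>std_normal_distribution)
        - (\<integral>y. \<psi> (l2 * y\<^sup>2 + r') \<partial>std_normal_distribution)\<bar> \<le> C * S / (2 * min \<bar>l1\<bar> \<bar>l2\<bar>)" .

    have "K l1 * (3 * S) + K l2 * (A * S + A * S + B * S) + C * S / (2 * min \<bar>l1\<bar> \<bar>l2\<bar>) = c * S"
      by (simp add: c_def algebra_simps add_divide_distrib)
    then show "\<bar>(\<integral>y. \<integral>x. \<phi> (a * x\<^sup>2 + 2 * (b * y + p) * x + (d * y\<^sup>2 + 2 * q * y + r)) \<partial>std_normal_distribution \<partial>std_normal_distribution)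
          - (\<integral>y. \<integral>x. \<phi> (l1 * x\<^sup>2 + (l2 * y\<^sup>2 + r')) \<partial>std_normal_distribution \<partial>std_normal_distribution)\<bar>
        \<le> c * (\<bar>a - l1\<bar> + \<bar>b\<bar> + \<bar>d - l2\<bar> + \<bar>p\<bar> + \<bar>q\<bar> + p\<^sup>2 + q\<^sup>2 + \<bar>r - r'\<bar>)"
      using step1 step2 step3 unfolding \<psi>_def S_def[symmetric] by linarith
  qed
qed

section \<open>Independence in an isonormal Gaussian process\<close>

text \<open>\<open>1 + W / K\<close> is a probability density that does not change the characteristic function of \<open>V\<close>,
  so by Levy's uniqueness theorem it does not change the law of \<open>V\<close>.\<close>

lemma (in prob_space) real_weight_char_zero:
  fixes W V :: "'a \<Rightarrow> real"
  assumes [measurable]: "W \<in> borel_measurable M" "V \<in> borel_measurable M"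
    and bound: "\<And>\<omega>. \<bar>W \<omega>\<bar> \<le> K" and K: "0 < K"
    and zero: "\<And>u. (CLINT \<omega>|M. W \<omega> *\<^sub>R iexp (u * V \<omega>)) = 0"
    and B: "B \<in> sets borel"
  shows "(\<integral>\<omega>. W \<omega> * indicator B (V \<omega>) \<partial>M) = 0"
proof -
  define D where "D = density M (\<lambda>\<omega>. ennreal (1 + W \<omega> / K))"
  have nonneg: "0 \<le> 1 + W \<omega> / K" for \<omega>
    using bound[of \<omega>] K by (simp add: field_simps abs_le_iff)
  have intW: "integrable M W"
    by (rule integrable_const_bound[where B=K]) (use bound in auto)
  \<comment> \<open>The hypothesis at frequency 0 says that \<open>W\<close> has mean 0, so that
    \<open>1 + W / K\<close> has total mass 1.\<close>
  have W0: "(\<integral>\<omega>. W \<omega> \<partial>M) = 0"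
    using zero[of 0] intW by (simp add: scaleR_conv_of_real)
  have emD: "emeasure D (space M) = 1"
  proof -
    have "emeasure D (space M) = (\<integral>\<^sup>+\<omega>. ennreal (1 + W \<omega> / K) \<partial>M)"
      unfolding D_def by (subst emeasure_density) (auto intro!: nn_integral_cong)
    also have "\<dots> = ennreal (\<integral>\<omega>. 1 + W \<omega> / K \<partial>M)"
      using intW nonneg by (intro nn_integral_eq_integral) auto
    also have "(\<integral>\<omega>. 1 + W \<omega> / K \<partial>M) = 1" using intW W0 prob_space by simp
    finally show ?thesis by simp
  qed
  then have "prob_space D" by (intro prob_spaceI) (simp add: D_def)
  then interpret D: prob_space D .
  have [measurable]: "V \<in> borel_measurable D" by (simp add: D_def)
  have rdD: "real_distribution (distr D borel V)"
    using D.real_distribution_distr by simp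
  have rdM: "real_distribution (distr M borel V)"
    using real_distribution_distr by simp
  have "char (distr D borel V) = char (distr M borel V)"
  proof
    fix u
    have "char (distr D borel V) u = (CLINT \<omega>|D. iexp (u * V \<omega>))"
      unfolding char_def by (subst integral_distr) auto
    also have "\<dots> = (CLINT \<omega>|M. (1 + W \<omega> / K) *\<^sub>R iexp (u * V \<omega>))"
      unfolding D_def using nonneg by (subst integral_density) auto
    also have "\<dots> = (CLINT \<omega>|M. iexp (u * V \<omega>) + (1 / K) *\<^sub>R (W \<omega> *\<^sub>R iexp (u * V \<omega>)))"
      by (simp add: scaleR_left_distrib)
    also have "\<dots> = (CLINT \<omega>|M. iexp (u * V \<omega>)) + (1 / K) *\<^sub>R (CLINT \<omega>|M. W \<omega> *\<^sub>R iexp (u * V \<omega>))"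
    proof (subst Bochner_Integration.integral_add)
      show "integrable M (\<lambda>\<omega>. iexp (u * V \<omega>))"
        by (rule integrable_const_bound[where B=1]) auto
      have "integrable M (\<lambda>\<omega>. W \<omega> *\<^sub>R iexp (u * V \<omega>))"
        by (rule integrable_const_bound[where B=K]) (use bound in auto)
      then show "integrable M (\<lambda>\<omega>. (1 / K) *\<^sub>R (W \<omega> *\<^sub>R iexp (u * V \<omega>)))"
        by (rule integrable_scaleR_right)
    qed (simp only: integral_scaleR_right)
    also have "\<dots> = char (distr M borel V) u"
      unfolding zero char_def by (subst integral_distr) auto
    finally show "char (distr D borel V) u = char (distr M borel V) u" .
  qed
  with rdD rdM have eq: "distr D borel V = distr M borel V"
    by (rule Levy_uniqueness)
  note [measurable] = B
  have "(\<integral>\<omega>. indicator B (V \<omega>) \<partial>D) = (\<integral>x. indicator B x \<partial>distr D borel V :: real)"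
    by (subst integral_distr) auto
  also have "\<dots> = (\<integral>\<omega>. indicator B (V \<omega>) \<partial>M)"
    unfolding eq by (subst integral_distr) auto
  finally have "(\<integral>\<omega>. (1 + W \<omega> / K) *\<^sub>R indicator B (V \<omega>) \<partial>M) = (\<integral>\<omega>. indicator B (V \<omega>) \<partial>M :: real)"
    unfolding D_def using nonneg by (subst (asm) integral_density) auto
  moreover have "(\<integral>\<omega>. (1 + W \<omega> / K) *\<^sub>R indicator B (V \<omega>) \<partial>M)
      = (\<integral>\<omega>. indicator B (V \<omega>) + (1 / K) * (W \<omega> * indicator B (V \<omega>)) \<partial>M)"
    by (intro Bochner_Integration.integral_cong) (auto simp: algebra_simps)
  moreover have "\<dots> = (\<integral>\<omega>. indicator B (V \<omega>) \<partial>M) + (1 / K) * (\<integral>\<omega>. W \<omega> * indicator B (V \<omega>) \<partial>M)"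
  proof (subst Bochner_Integration.integral_add)
    show "integrable M (\<lambda>\<omega>. indicator B (V \<omega>) :: real)"
      by (rule integrable_const_bound[where B=1]) auto
    have "integrable M (\<lambda>\<omega>. W \<omega> * indicator B (V \<omega>))"
      by (rule integrable_const_bound[where B=K])
         (use bound K in \<open>auto split: split_indicator\<close>)
    then show "integrable M (\<lambda>\<omega>. (1 / K) * (W \<omega> * indicator B (V \<omega>)))" by simp
  qed simp
  ultimately show ?thesis using K by simp
qed

text \<open>Conjugating the hypothesis at frequency - u gives it for the conjugate weight. Hence it
  holds for the real and the imaginary part of \<open>W\<close>, to which the real case
  applies.\<close>

lemma (in prob_space) weight_char_zero:
  fixes W :: "'a \<Rightarrow> complex" and V :: "'a \<Rightarrow> real"
  assumes [measurable]: "W \<in> borel_measurable M" "V \<in> borel_measurable M"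
    and bound: "\<And>\<omega>. norm (W \<omega>) \<le> K" and K: "0 < K"
    and zero: "\<And>u. (CLINT \<omega>|M. W \<omega> * iexp (u * V \<omega>)) = 0"
    and B: "B \<in> sets borel"
  shows "(CLINT \<omega>|M. W \<omega> * indicator B (V \<omega>)) = 0"
proof -
  note [measurable] = B
  have int: "integrable M (\<lambda>\<omega>. W \<omega> * iexp (u * V \<omega>))" for u
    by (rule integrable_const_bound[where B=K]) (use bound in \<open>auto simp: norm_mult\<close>)
  have int': "integrable M (\<lambda>\<omega>. W \<omega> * indicator B (V \<omega>))"
    by (rule integrable_const_bound[where B=K])
       (use bound order_trans[OF norm_ge_zero bound] in \<open>auto simp: norm_mult split: split_indicator\<close>)
  have cnj_eq: "cnj (W \<omega>) * iexp (u * V \<omega>) = cnj (W \<omega> * iexp ((- u) * V \<omega>))" for u \<omega>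
    by (simp add: exp_cnj)
  have cnj0: "(CLINT \<omega>|M. cnj (W \<omega>) * iexp (u * V \<omega>)) = 0" for u
    unfolding cnj_eq Bochner_Integration.integral_cnj zero by simp
  have intc: "integrable M (\<lambda>\<omega>. cnj (W \<omega>) * iexp (u * V \<omega>))" for u
    unfolding cnj_eq by (intro integrable_cnj int)
  have Re0: "(CLINT \<omega>|M. Re (W \<omega>) *\<^sub>R iexp (u * V \<omega>)) = 0" for u
  proof -
    have "(CLINT \<omega>|M. Re (W \<omega>) *\<^sub>R iexp (u * V \<omega>))
      = (CLINT \<omega>|M. (W \<omega> * iexp (u * V \<omega>) + cnj (W \<omega>) * iexp (u * V \<omega>)) / 2)"
      by (intro Bochner_Integration.integral_cong)
         (simp_all add: scaleR_conv_of_real distrib_right[symmetric] complex_add_cnj)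
    also have "\<dots> = 0" using int intc zero cnj0 by simp
    finally show ?thesis .
  qed
  have Im0: "(CLINT \<omega>|M. Im (W \<omega>) *\<^sub>R iexp (u * V \<omega>)) = 0" for u
  proof -
    have "(CLINT \<omega>|M. Im (W \<omega>) *\<^sub>R iexp (u * V \<omega>))
      = (CLINT \<omega>|M. (W \<omega> * iexp (u * V \<omega>) - cnj (W \<omega>) * iexp (u * V \<omega>)) / (2 * \<i>))"
    proof (intro Bochner_Integration.integral_cong refl)
      have diff_eq: "w * E - cnj w * E = (2 * \<i>) * (Im w *\<^sub>R E)" for w E
        unfolding left_diff_distrib[symmetric] complex_diff_cnj by (simp add: scaleR_conv_of_real)
      show "Im (W \<omega>) *\<^sub>R iexp (u * V \<omega>) = (W \<omega> * iexp (u * V \<omega>) - cnj (W \<omega>) * iexp (u * V \<omega>)) / (2 * \<i>)" for \<omega>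
        by (subst diff_eq, subst nonzero_mult_div_cancel_left) auto
    qed
    also have "\<dots> = 0" using int intc zero cnj0 by simp
    finally show ?thesis .
  qed
  have "(\<integral>\<omega>. Re (W \<omega>) * indicator B (V \<omega>) \<partial>M) = 0"
    by (rule real_weight_char_zero[where K=K]) (use Re0 K B bound abs_Re_le_cmod order_trans in \<open>auto, blast\<close>)
  moreover have "(\<integral>\<omega>. Im (W \<omega>) * indicator B (V \<omega>) \<partial>M) = 0"
    by (rule real_weight_char_zero[where K=K]) (use Im0 K B bound abs_Im_le_cmod order_trans in \<open>auto, blast\<close>)
  moreover have "Re (W \<omega> * indicator B (V \<omega>)) = Re (W \<omega>) * indicator B (V \<omega>)"
     "Im (W \<omega> * indicator B (V \<omega>)) = Im (W \<omega>) * indicator B (V \<omega>)" for \<omega>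
    by (auto split: split_indicator)
  ultimately show ?thesis
    by (intro complex_eqI) (simp_all only: integral_Re[OF int', symmetric] integral_Im[OF int', symmetric] zero_complex.sel)
qed

lemma integrable_mult_of_squares:
  fixes Y Z :: "'a \<Rightarrow> real"
  assumes [measurable]: "Y \<in> borel_measurable M" "Z \<in> borel_measurable M"
    and "integrable M (\<lambda>\<omega>. (Y \<omega>)\<^sup>2)" "integrable M (\<lambda>\<omega>. (Z \<omega>)\<^sup>2)"
  shows "integrable M (\<lambda>\<omega>. Y \<omega> * Z \<omega>)"
proof (rule Bochner_Integration.integrable_bound)
  show "integrable M (\<lambda>\<omega>. (Y \<omega>)\<^sup>2 + (Z \<omega>)\<^sup>2)"
    using assms by (intro Bochner_Integration.integrable_add)
  have "\<bar>x * y\<bar> \<le> x\<^sup>2 + y\<^sup>2" for x y :: real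
  proof -
    have "0 \<le> (\<bar>x\<bar> - \<bar>y\<bar>)\<^sup>2" "0 \<le> x\<^sup>2" "0 \<le> y\<^sup>2" by auto
    then have "2 * (\<bar>x\<bar> * \<bar>y\<bar>) \<le> x\<^sup>2 + y\<^sup>2" by (auto simp: power2_diff)
    moreover have "0 \<le> \<bar>x\<bar> * \<bar>y\<bar>" by simp
    ultimately show ?thesis unfolding abs_mult by linarith
  qed
  then show "AE \<omega> in M. norm (Y \<omega> * Z \<omega>) \<le> norm ((Y \<omega>)\<^sup>2 + (Z \<omega>)\<^sup>2)" by simp
qed simp

section \<open>Law and linearity of an isonormal process\<close>

locale isonormal_process = prob_space M
  for M :: "'w measure" and X :: "'h::real_inner \<Rightarrow> 'w \<Rightarrow> real" +
  assumes isonormal: "isonormal_gaussian_process M X"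
begin

lemma covariance: "expectation (\<lambda>\<omega>. X h \<omega> * X h' \<omega>) = inner h h'"
  using isonormal by (simp add: isonormal_gaussian_process_def)

lemma centered_gaussian: "centered_gaussian_rv M (X h)"
proof -
  have "centered_gaussian_family M X"
    using isonormal by (simp add: isonormal_gaussian_process_def)
  then have "finite {h} \<longrightarrow> centered_gaussian_rv M (\<lambda>\<omega>. \<Sum>i\<in>{h}. (\<lambda>_. 1) i * X i \<omega>)"
    unfolding centered_gaussian_family_def by (elim allE)
  then show ?thesis by simp
qed

lemma measurable_X [measurable]: "X h \<in> borel_measurable M"
  using centered_gaussian[of h] by (simp add: centered_gaussian_rv_def)

text \<open>The covariance identifies the scale in both cases of the definition of a Gaussian
  variable. The image of the standard normal law covers variance 0 as well, so later moment formulas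
  need no case distinction.\<close>

lemma distr_X: "distr M borel (X h) = distr std_normal_distribution borel (\<lambda>x. norm h * x)"
proof -
  consider "AE \<omega> in M. X h \<omega> = 0" | \<sigma> where "\<sigma> > 0" "distributed M lborel (X h) (\<lambda>x. ennreal (normal_density 0 \<sigma> x))"
    using centered_gaussian[of h] unfolding centered_gaussian_rv_def by blast
  then show ?thesis
  proof cases
    case 1
    then have "expectation (\<lambda>\<omega>. X h \<omega> * X h \<omega>) = expectation (\<lambda>\<omega>. 0)"
      by (intro integral_cong_AE) auto
    then have "norm h = 0" by (simp add: covariance)
    then have "distr std_normal_distribution borel (\<lambda>x. norm h * x) = distr std_normal_distribution borel (\<lambda>x. 0)" by simp
    also have "\<dots> = return borel 0" by (rule std_normal.distr_const) simp
    also have "\<dots> = distr M borel (\<lambda>\<omega>. 0)" by (rule distr_const[symmetric]) simp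
    also have "\<dots> = distr M borel (X h)" using 1 by (intro distr_cong_AE) auto
    finally show ?thesis ..
  next
    case (2 \<sigma>)
    have "(\<integral>\<omega>. X h \<omega> * X h \<omega> \<partial>M) = (\<integral>x. normal_density 0 \<sigma> x * (x * x) \<partial>lborel)"
      using distributed_integral[OF 2(2), of "\<lambda>x. x * x"] by simp
    also have "\<dots> = \<sigma>\<^sup>2"
      using integral_normal_moment_even[of \<sigma> 0 1] 2(1) by (simp add: power2_eq_square fact_2)
    finally have "(norm h)\<^sup>2 = \<sigma>\<^sup>2" by (simp add: covariance power2_norm_eq_inner)
    then have \<sigma>: "norm h = \<sigma>" using 2(1) by simp
    have "distributed std_normal_distribution lborel (\<lambda>x. x) std_normal_density"
      unfolding distributed_def by (auto simp: distr_id2)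
    then have "distributed std_normal_distribution lborel (\<lambda>x. 0 + \<sigma> * x) (normal_density (0 + \<sigma> * 0) (\<bar>\<sigma>\<bar> * 1))"
      using 2(1) by (intro std_normal.normal_density_affine) auto
    then have "distr std_normal_distribution lborel (\<lambda>x. \<sigma> * x) = density lborel (normal_density 0 \<sigma>)"
      using 2(1) by (auto dest: distributed_distr_eq_density)
    also have "\<dots> = distr M lborel (X h)"
      using 2(2) by (auto dest: distributed_distr_eq_density)
    finally show ?thesis unfolding \<sigma> by (metis distr_cong sets_lborel)
  qed
qed

lemma integral_X:
  fixes f :: "real \<Rightarrow> 'b::{banach, second_countable_topology}"
  assumes "f \<in> borel_measurable borel"
  shows "(\<integral>\<omega>. f (X h \<omega>) \<partial>M) = (\<integral>x. f (norm h * x) \<partial>std_normal_distribution)"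
  using integral_distr[of "X h" M borel f] integral_distr[of "\<lambda>x. norm h * x" std_normal_distribution borel f] assms
  by (simp add: distr_X)

lemma integrable_X_iff:
  fixes f :: "real \<Rightarrow> 'b::{banach, second_countable_topology}"
  assumes "f \<in> borel_measurable borel"
  shows "integrable M (\<lambda>\<omega>. f (X h \<omega>)) \<longleftrightarrow> integrable std_normal_distribution (\<lambda>x. f (norm h * x))"
  using integrable_distr_eq[of "X h" M borel f] integrable_distr_eq[of "\<lambda>x. norm h * x" std_normal_distribution borel f] assms
  by (simp add: distr_X)

lemma integrable_X_power: "integrable M (\<lambda>\<omega>. X h \<omega> ^ k)"
  by (subst integrable_X_iff[where f="\<lambda>x. x ^ k"])
     (auto simp: power_mult_distrib intro!: integrable_mult_right integrable_std_normal_distribution_moment)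

lemma expectation_X_power4: "expectation (\<lambda>\<omega>. X h \<omega> ^ 4) = 3 * norm h ^ 4"
  using std_normal_distribution_even_moments(1)[of 2]
  by (subst integral_X[where f="\<lambda>x. x ^ 4"]) (auto simp: power_mult_distrib fact_numeral)

lemma expectation_iexp_X: "(CLINT \<omega>|M. iexp (X h \<omega>)) = exp (- (norm h)\<^sup>2 / 2)"
proof -
  have "(CLINT \<omega>|M. iexp (X h \<omega>)) = char std_normal_distribution (norm h)"
    unfolding char_def by (rule integral_X[where f=iexp]) simp
  then show ?thesis by (simp add: char_std_normal_distribution)
qed

lemma integrable_X_mult: "integrable M (\<lambda>\<omega>. X h \<omega> * X h' \<omega>)"
  by (intro integrable_mult_of_squares integrable_X_power measurable_X)

text \<open>By the covariance the mean square of the difference of the two sides is the squared norm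
  of the zero vector. \<open>?D\<close> is this square expanded into products, whose expectations
  are known.\<close>

lemma X_linear: "AE \<omega> in M. X (a *\<^sub>R u + b *\<^sub>R v) \<omega> = a * X u \<omega> + b * X v \<omega>"
proof -
  let ?w = "a *\<^sub>R u + b *\<^sub>R v"
  let ?D = "\<lambda>\<omega>. X ?w \<omega> * X ?w \<omega> + a\<^sup>2 * (X u \<omega> * X u \<omega>) + b\<^sup>2 * (X v \<omega> * X v \<omega>)
     - 2 * a * (X ?w \<omega> * X u \<omega>) - 2 * b * (X ?w \<omega> * X v \<omega>) + 2 * a * b * (X u \<omega> * X v \<omega>)"
  have D: "?D \<omega> = (X ?w \<omega> - (a * X u \<omega> + b * X v \<omega>))\<^sup>2" for \<omega>
    by (simp add: power2_eq_square algebra_simps)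
  have int: "integrable M ?D" by (intro Bochner_Integration.integrable_add Bochner_Integration.integrable_diff integrable_mult_right integrable_X_mult)
  have "expectation ?D = 0"
    using integrable_X_mult
    by (simp add: covariance inner_add_left inner_add_right inner_commute power2_eq_square algebra_simps)
  then have "AE \<omega> in M. ?D \<omega> = 0"
    using int by (subst (asm) integral_nonneg_eq_0_iff_AE) (auto simp: D)
  then show ?thesis by (simp add: D)
qed

end

text \<open>Events are added one at a time so that factorization can be proved by induction: each
  step removes one condition \<open>X h \<in> B\<close> and replaces it by a factor
  \<open>iexp (u * X h)\<close>.\<close>

inductive_set cylinders :: "'w measure \<Rightarrow> ('h \<Rightarrow> 'w \<Rightarrow> real) \<Rightarrow> 'h set \<Rightarrow> 'w set set"
  for M :: "'w measure" and X :: "'h \<Rightarrow> 'w \<Rightarrow> real" and K :: "'h set" where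
  space: "space M \<in> cylinders M X K"
| Int: "A \<in> cylinders M X K \<Longrightarrow> h \<in> K \<Longrightarrow> B \<in> sets borel \<Longrightarrow> A \<inter> (X h -` B \<inter> space M) \<in> cylinders M X K"

lemma cylinders_subset_space: "A \<in> cylinders M X K \<Longrightarrow> A \<subseteq> space M"
  by (induction rule: cylinders.induct) auto

lemma Int_stable_cylinders: "Int_stable (cylinders M X K)"
proof (rule Int_stableI)
  fix A A' assume A: "A \<in> cylinders M X K" and "A' \<in> cylinders M X K"
  from this(2) show "A \<inter> A' \<in> cylinders M X K"
  proof induction
    case space
    then show ?case using A cylinders_subset_space[OF A] by (simp add: Int_absorb2)
  next
    case (Int A' h B)
    then show ?case using cylinders.Int[of "A \<inter> A'"] by (simp add: Int_assoc)
  qed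
qed

definition process_sigma :: "'w measure \<Rightarrow> ('h \<Rightarrow> 'w \<Rightarrow> real) \<Rightarrow> 'h set \<Rightarrow> 'w measure" where
  "process_sigma M X K = sigma (space M) {X h -` B \<inter> space M | h B. h \<in> K \<and> B \<in> sets borel}"

lemma space_process_sigma [simp]: "space (process_sigma M X K) = space M"
  unfolding process_sigma_def by (rule space_measure_of) auto

lemma sets_process_sigma:
  "sets (process_sigma M X K) = sigma_sets (space M) {X h -` B \<inter> space M | h B. h \<in> K \<and> B \<in> sets borel}"
  unfolding process_sigma_def by (rule sets_measure_of) auto

lemma measurable_process_sigma:
  assumes "h \<in> K"
  shows "X h \<in> borel_measurable (process_sigma M X K)"
  by (rule measurableI) (use assms in \<open>auto simp: sets_process_sigma\<close>)

lemma process_sigma_mono: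
  assumes "K \<subseteq> L"
  shows "sets (process_sigma M X K) \<subseteq> sets (process_sigma M X L)"
  unfolding sets_process_sigma using assms by (intro sigma_sets_mono') blast

context isonormal_process
begin

lemma sets_process_sigma_subset: "sets (process_sigma M X K) \<subseteq> sets M"
  unfolding sets_process_sigma by (rule sets.sigma_sets_subset) auto

lemma measurable_process_sigma_id: "(\<lambda>\<omega>. \<omega>) \<in> measurable M (process_sigma M X K)"
  using sets_process_sigma_subset by (intro measurableI) auto

lemma cylinders_sets: "A \<in> cylinders M X K \<Longrightarrow> A \<in> sets M"
  by (induction rule: cylinders.induct) auto

text \<open>On the whole space the characteristic function of \<open>X h + s X e\<close> factors
  because squared norms of orthogonal vectors add. A further event \<open>X h' \<in> B\<close> is
  tested against exponentials: a factor \<open>iexp (u * X h')\<close> only replaces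
  \<open>h\<close> by \<open>h + u h'\<close>, still orthogonal to \<open>e\<close>. This is why
  \<open>iexp (X h)\<close> is carried along and \<open>h\<close> is arbitrary in the
  induction.\<close>

lemma cylinder_char:
  assumes e: "norm e = 1" and "A \<in> cylinders M X {h. inner h e = 0}" and "inner h e = 0"
  shows "(CLINT \<omega>|M. indicator A \<omega> * iexp (X h \<omega>) * (iexp (s * X e \<omega>) - exp (- s\<^sup>2 / 2))) = 0"
  using assms(2,3)
proof (induction arbitrary: h)
  case space
  have "(CLINT \<omega>|M. indicator (space M) \<omega> * iexp (X h \<omega>) * (iexp (s * X e \<omega>) - exp (- s\<^sup>2 / 2)))
    = (CLINT \<omega>|M. iexp (X (1 *\<^sub>R h + s *\<^sub>R e) \<omega>) - exp (- s\<^sup>2 / 2) * iexp (X h \<omega>))"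
  proof (rule integral_cong_AE)
    show "AE \<omega> in M. indicator (space M) \<omega> * iexp (X h \<omega>) * (iexp (s * X e \<omega>) - exp (- s\<^sup>2 / 2))
        = iexp (X (1 *\<^sub>R h + s *\<^sub>R e) \<omega>) - exp (- s\<^sup>2 / 2) * iexp (X h \<omega>)"
      using X_linear[of 1 h s e] AE_space
      by eventually_elim (simp add: algebra_simps mult_exp_exp)
  qed auto
  also have "\<dots> = (CLINT \<omega>|M. iexp (X (1 *\<^sub>R h + s *\<^sub>R e) \<omega>)) - exp (- s\<^sup>2 / 2) * (CLINT \<omega>|M. iexp (X h \<omega>))"
  proof -
    have "integrable M (\<lambda>\<omega>. iexp (X h \<omega>))" for h
      by (rule integrable_const_bound[where B=1]) auto
    then show ?thesis by simp
  qed
  also have "(norm (1 *\<^sub>R h + s *\<^sub>R e))\<^sup>2 = (norm h)\<^sup>2 + s\<^sup>2"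
    using e space unfolding power2_norm_eq_inner norm_eq_1
    by (simp add: inner_add_left inner_add_right inner_commute power2_eq_square)
  then have "(CLINT \<omega>|M. iexp (X (1 *\<^sub>R h + s *\<^sub>R e) \<omega>)) - exp (- s\<^sup>2 / 2) * (CLINT \<omega>|M. iexp (X h \<omega>)) = 0"
    unfolding expectation_iexp_X by (simp add: mult_exp_exp add_divide_distrib flip: of_real_mult of_real_diff)
  finally show ?case .
next
  case (Int A h' B)
  note [measurable] = cylinders_sets[OF Int(1)]
  let ?W = "\<lambda>\<omega>. indicator A \<omega> * iexp (X h \<omega>) * (iexp (s * X e \<omega>) - exp (- s\<^sup>2 / 2))"
  have "(CLINT \<omega>|M. ?W \<omega> * indicator B (X h' \<omega>)) = 0"
  proof (rule weight_char_zero)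
    show "norm (?W \<omega>) \<le> 2" for \<omega>
    proof -
      have "norm (iexp (s * X e \<omega>) - exp (- s\<^sup>2 / 2)) \<le> norm (iexp (s * X e \<omega>)) + norm (complex_of_real (exp (- s\<^sup>2 / 2)))"
        by (rule norm_triangle_ineq4)
      also have "\<dots> \<le> 1 + 1" by (intro add_mono) auto
      finally show ?thesis by (auto simp: norm_mult split: split_indicator)
    qed
    fix u
    have "(CLINT \<omega>|M. ?W \<omega> * iexp (u * X h' \<omega>))
      = (CLINT \<omega>|M. indicator A \<omega> * iexp (X (1 *\<^sub>R h + u *\<^sub>R h') \<omega>) * (iexp (s * X e \<omega>) - exp (- s\<^sup>2 / 2)))"
    proof (rule integral_cong_AE)
      show "AE \<omega> in M. ?W \<omega> * iexp (u * X h' \<omega>) = indicator A \<omega> * iexp (X (1 *\<^sub>R h + u *\<^sub>R h') \<omega>) * (iexp (s * X e \<omega>) - exp (- s\<^sup>2 / 2))"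
        using X_linear[of 1 h u h']
        by eventually_elim (simp add: distrib_left exp_add)
    qed auto
    also have "\<dots> = 0"
      using Int.prems Int.hyps by (intro Int.IH) (simp add: inner_add_left)
    finally show "(CLINT \<omega>|M. ?W \<omega> * iexp (u * X h' \<omega>)) = 0" .
  qed (use Int in auto)
  moreover have "(CLINT \<omega>|M. ?W \<omega> * indicator B (X h' \<omega>)) = (CLINT \<omega>|M. indicator (A \<inter> (X h' -` B \<inter> space M)) \<omega> * iexp (X h \<omega>) * (iexp (s * X e \<omega>) - exp (- s\<^sup>2 / 2)))"
    by (intro Bochner_Integration.integral_cong) (auto split: split_indicator)
  ultimately show ?case by simp
qed

text \<open>By the case h = 0 of \<open>cylinder_char\<close>, the weight
  \<open>indicator A - prob A\<close> has zero integral against every \<open>iexp (s * X e)\<close>,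
  hence also against the indicator of every event about \<open>X e\<close>.\<close>

lemma prob_cylinder_Int:
  assumes e: "norm e = 1" and A: "A \<in> cylinders M X {h. inner h e = 0}" and B: "B \<in> sets borel"
  shows "prob (A \<inter> (X e -` B \<inter> space M)) = prob A * prob (X e -` B \<inter> space M)"
proof -
  note [measurable] = cylinders_sets[OF A] B
  have X0: "AE \<omega> in M. X 0 \<omega> = 0" using X_linear[of 0 0 0 0] by simp
  have "(\<integral>\<omega>. (indicator A \<omega> - prob A) * indicator B (X e \<omega>) \<partial>M) = 0"
  proof (rule real_weight_char_zero[where W="\<lambda>\<omega>. indicator A \<omega> - prob A" and V="X e" and K=1])
    show "\<bar>indicator A \<omega> - prob A\<bar> \<le> 1" for \<omega>
      by (auto split: split_indicator)
    fix s :: real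
    have int: "integrable M (\<lambda>\<omega>. indicator A \<omega> * iexp (s * X e \<omega>))" "integrable M (\<lambda>\<omega>. indicator A \<omega> :: complex)"
      "integrable M (\<lambda>\<omega>. iexp (s * X e \<omega>))"
      by (rule integrable_const_bound[where B=1]; force simp: norm_mult split: split_indicator)+
    have "0 = (CLINT \<omega>|M. indicator A \<omega> * iexp (X 0 \<omega>) * (iexp (s * X e \<omega>) - exp (- s\<^sup>2 / 2)))"
      using cylinder_char[OF e A, of 0 s] by simp
    also have "\<dots> = (CLINT \<omega>|M. indicator A \<omega> * iexp (s * X e \<omega>) - complex_of_real (exp (- s\<^sup>2 / 2)) * indicator A \<omega>)"
    proof (rule integral_cong_AE)
      show "AE \<omega> in M. indicator A \<omega> * iexp (X 0 \<omega>) * (iexp (s * X e \<omega>) - exp (- s\<^sup>2 / 2)) =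
         indicator A \<omega> * iexp (s * X e \<omega>) - complex_of_real (exp (- s\<^sup>2 / 2)) * indicator A \<omega>"
        using X0 by eventually_elim (simp add: algebra_simps)
    qed auto
    also have "\<dots> = (CLINT \<omega>|M. indicator A \<omega> * iexp (s * X e \<omega>)) - exp (- s\<^sup>2 / 2) * (CLINT \<omega>|M. indicator A \<omega>)"
      using int by simp
    also have "(CLINT \<omega>|M. indicator A \<omega>) = complex_of_real (prob A)"
    proof -
      have "(CLINT \<omega>|M. indicator A \<omega>) = (CLINT \<omega>|M. complex_of_real (indicator A \<omega>))"
        by (intro Bochner_Integration.integral_cong) (auto split: split_indicator)
      also have "\<dots> = complex_of_real (\<integral>\<omega>. indicator A \<omega> \<partial>M)" by (rule integral_complex_of_real)
      finally show ?thesis by (simp add: cylinders_sets[OF A])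
    qed
    finally have 1: "(CLINT \<omega>|M. indicator A \<omega> * iexp (s * X e \<omega>)) = prob A * exp (- s\<^sup>2 / 2)"
      by simp
    have "(CLINT \<omega>|M. iexp (s * X e \<omega>)) = (CLINT \<omega>|M. iexp (X (0 *\<^sub>R 0 + s *\<^sub>R e) \<omega>))"
    proof (rule integral_cong_AE)
      show "AE \<omega> in M. iexp (s * X e \<omega>) = iexp (X (0 *\<^sub>R 0 + s *\<^sub>R e) \<omega>)"
        using X_linear[of 0 0 s e] by eventually_elim simp
    qed auto
    also have "\<dots> = exp (- s\<^sup>2 / 2)"
      unfolding expectation_iexp_X using e by simp
    finally have 2: "(CLINT \<omega>|M. iexp (s * X e \<omega>)) = exp (- s\<^sup>2 / 2)" .
    have "(CLINT \<omega>|M. (indicator A \<omega> - prob A) *\<^sub>R iexp (s * X e \<omega>))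
      = (CLINT \<omega>|M. indicator A \<omega> * iexp (s * X e \<omega>) - prob A * iexp (s * X e \<omega>))"
      by (intro Bochner_Integration.integral_cong)
         (auto simp: scaleR_conv_of_real algebra_simps split: split_indicator)
    also have "\<dots> = 0" using int 1 2 by simp
    finally show "(CLINT \<omega>|M. (indicator A \<omega> - prob A) *\<^sub>R iexp (s * X e \<omega>)) = 0" .
  qed auto
  also have "(\<integral>\<omega>. (indicator A \<omega> - prob A) * indicator B (X e \<omega>) \<partial>M)
    = (\<integral>\<omega>. indicator (A \<inter> (X e -` B \<inter> space M)) \<omega> - prob A * indicator (X e -` B \<inter> space M) \<omega> \<partial>M)"
    by (intro Bochner_Integration.integral_cong) (auto split: split_indicator)
  also have "\<dots> = prob (A \<inter> (X e -` B \<inter> space M)) - prob A * prob (X e -` B \<inter> space M)"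
    by (subst Bochner_Integration.integral_diff)
       (auto simp: Int_absorb2 intro!: integrable_real_indicator integrable_mult_right emeasure_finite less_top[THEN iffD1])
  finally show ?thesis by simp
qed

text \<open>Cylinders are an intersection-stable generator, so the product formula extends from them
  to the whole sigma-algebra.\<close>

lemma indep_set_orthogonal:
  assumes e: "norm e = 1"
  shows "indep_set (sigma_sets (space M) {X e -` B \<inter> space M | B. B \<in> sets borel})
    (sets (process_sigma M X {h. inner h e = 0}))"
proof -
  let ?K = "{h. inner h e = 0}"
  let ?E = "{X e -` B \<inter> space M | B. B \<in> sets borel}"
  have stable: "Int_stable ?E"
  proof (rule Int_stableI, safe)
    fix B B' :: "real set" assume "B \<in> sets borel" "B' \<in> sets borel"
    then show "\<exists>C. X e -` B \<inter> space M \<inter> (X e -` B' \<inter> space M) = X e -` C \<inter> space M \<and> C \<in> sets borel"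
      by (intro exI[of _ "B \<inter> B'"]) auto
  qed
  have "indep_set ?E (cylinders M X ?K)"
    using cylinders_sets prob_cylinder_Int[OF e]
    by (intro indep_setI) (auto simp: Int_commute mult.commute)
  then have indep: "indep_set (sigma_sets (space M) ?E) (sigma_sets (space M) (cylinders M X ?K))"
    using stable Int_stable_cylinders by (rule indep_set_sigma_sets)
  have "sets (process_sigma M X ?K) \<subseteq> sigma_sets (space M) (cylinders M X ?K)"
    unfolding sets_process_sigma
  proof (rule sigma_sets_mono, safe)
    fix h and B :: "real set" assume "inner h e = 0" "B \<in> sets borel"
    then have "space M \<inter> (X h -` B \<inter> space M) \<in> cylinders M X ?K"
      by (intro cylinders.intros) auto
    then show "X h -` B \<inter> space M \<in> sigma_sets (space M) (cylinders M X ?K)"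
      by (intro sigma_sets.Basic) (simp add: Int_absorb1)
  qed
  with indep show ?thesis
    unfolding indep_set_def by (elim indep_sets_mono_sets) (auto split: bool.split)
qed

text \<open>By independence the map \<omega> -> (X e \<omega>, \<omega>) has a product law, and
  Fubini applies. Using \<omega> itself as second coordinate, with the smaller sigma-algebra, avoids
  naming the variables on which the coefficients depend; these may be infinitely many.\<close>

lemma expectation_freeze:
  fixes \<Phi> :: "real \<times> 'w \<Rightarrow> real"
  assumes e: "norm e = 1"
    and meas [measurable]: "\<Phi> \<in> borel_measurable (borel \<Otimes>\<^sub>M process_sigma M X {h. inner h e = 0})"
    and bound: "\<And>z. 0 \<le> \<Phi> z" "\<And>z. \<Phi> z \<le> 1"
  shows "expectation (\<lambda>\<omega>. \<Phi> (X e \<omega>, \<omega>)) = expectation (\<lambda>\<omega>. \<integral>x. \<Phi> (x, \<omega>) \<partial>std_normal_distribution)"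
proof -
  let ?F = "process_sigma M X {h. inner h e = 0}"
  let ?MF = "distr M ?F (\<lambda>\<omega>. \<omega>)"
  note [measurable] = measurable_process_sigma_id
  have N: "distr M borel (X e) = std_normal_distribution"
  proof -
    have "(\<lambda>x. norm e * x) = (\<lambda>x::real. x)" using e by simp
    then show ?thesis unfolding distr_X by (simp add: distr_id2)
  qed
  interpret MF: prob_space ?MF by (rule prob_space_distr) simp
  interpret P: pair_prob_space std_normal_distribution ?MF ..
  have eq: "std_normal_distribution \<Otimes>\<^sub>M ?MF = distr M (borel \<Otimes>\<^sub>M ?F) (\<lambda>\<omega>. (X e \<omega>, \<omega>))"
  proof (rule pair_measure_eqI)
    fix B A assume B: "B \<in> sets std_normal_distribution" and A: "A \<in> sets ?MF"
    have XB: "X e -` B \<inter> space M \<in> sigma_sets (space M) {X e -` B \<inter> space M | B. B \<in> sets borel}"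
      using B by (intro sigma_sets.Basic) auto
    have AM: "A \<in> sets M" "A \<subseteq> space M"
      using A sets_process_sigma_subset sets.sets_into_space[of A M] by auto
    have "emeasure std_normal_distribution B * emeasure ?MF A = emeasure M (X e -` B \<inter> space M) * emeasure M A"
      unfolding N[symmetric] using A B AM by (subst (1 2) emeasure_distr) (auto simp: Int_absorb2)
    also have "\<dots> = emeasure M ((X e -` B \<inter> space M) \<inter> A)"
      using indep_setD[OF indep_set_orthogonal[OF e] XB, of A] A
      by (simp add: emeasure_eq_measure ennreal_mult[symmetric])
    also have "(X e -` B \<inter> space M) \<inter> A = (\<lambda>\<omega>. (X e \<omega>, \<omega>)) -` (B \<times> A) \<inter> space M"
      using AM by auto
    also have "emeasure M \<dots> = emeasure (distr M (borel \<Otimes>\<^sub>M ?F) (\<lambda>\<omega>. (X e \<omega>, \<omega>))) (B \<times> A)"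
      using A B by (subst emeasure_distr) auto
    finally show "emeasure std_normal_distribution B * emeasure ?MF A
      = emeasure (distr M (borel \<Otimes>\<^sub>M ?F) (\<lambda>\<omega>. (X e \<omega>, \<omega>))) (B \<times> A)" .
  qed (auto intro: std_normal.sigma_finite_measure_axioms MF.sigma_finite_measure_axioms cong: sets_pair_measure_cong)
  have sets_eq: "sets (std_normal_distribution \<Otimes>\<^sub>M ?MF) = sets (borel \<Otimes>\<^sub>M ?F)"
    unfolding eq by simp
  have meas' [measurable]: "\<Phi> \<in> borel_measurable (std_normal_distribution \<Otimes>\<^sub>M ?MF)"
    using meas by (simp cong: measurable_cong_sets add: sets_eq)
  have int: "integrable (std_normal_distribution \<Otimes>\<^sub>M ?MF) \<Phi>"
    by (rule P.integrable_const_bound[where B=1]) (use bound in auto)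
  have "expectation (\<lambda>\<omega>. \<Phi> (X e \<omega>, \<omega>)) = (\<integral>z. \<Phi> z \<partial>distr M (borel \<Otimes>\<^sub>M ?F) (\<lambda>\<omega>. (X e \<omega>, \<omega>)))"
    by (subst integral_distr) auto
  also have "\<dots> = (\<integral>z. \<Phi> z \<partial>(std_normal_distribution \<Otimes>\<^sub>M ?MF))"
    unfolding eq ..
  also have "\<dots> = (\<integral>\<omega>. \<integral>x. \<Phi> (x, \<omega>) \<partial>std_normal_distribution \<partial>?MF)"
    using P.integral_snd[of "\<lambda>x \<omega>. \<Phi> (x, \<omega>)"] int by simp
  also have "\<dots> = expectation (\<lambda>\<omega>. \<integral>x. \<Phi> (x, \<omega>) \<partial>std_normal_distribution)"
    by (subst integral_distr) auto
  finally show ?thesis .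
qed

end

section \<open>Symmetric tensors and the double integral\<close>

locale tensor_square =
  fixes tensor :: "'h::real_inner \<Rightarrow> 'h \<Rightarrow> 'k::{real_inner, complete_space}"
    and contr :: "'k \<Rightarrow> 'h \<Rightarrow> 'h" and flip :: "'k \<Rightarrow> 'k"
  assumes tensor: "hilbert_tensor_square tensor"
    and contr: "tensor_contraction tensor contr"
    and flip: "tensor_flip tensor flip"
begin

sublocale tensor: bounded_bilinear tensor
  using tensor by (simp add: hilbert_tensor_square_def)

sublocale contr: bounded_bilinear contr
  using contr by (simp add: tensor_contraction_def)

sublocale flip: bounded_linear flip
  using flip by (simp add: tensor_flip_def)

lemma inner_tensor: "inner (tensor u v) (tensor u' v') = inner u u' * inner v v'"
  using tensor by (simp add: hilbert_tensor_square_def)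

lemma closure_span_tensor: "closure (span {tensor u v | u v. True}) = UNIV"
  using tensor by (simp add: hilbert_tensor_square_def)

lemma contr_tensor: "contr (tensor u v) g = inner v g *\<^sub>R u"
  using contr by (simp add: tensor_contraction_def)

lemma flip_tensor: "flip (tensor u v) = tensor v u"
  using flip by (simp add: tensor_flip_def)

lemma bounded_linear_tensor_ext:
  fixes F G :: "'k \<Rightarrow> 'b::real_normed_vector"
  assumes F: "bounded_linear F" and G: "bounded_linear G" and eq: "\<And>u v. F (tensor u v) = G (tensor u v)"
  shows "F x = G x"
proof -
  interpret F: bounded_linear F by fact
  interpret G: bounded_linear G by fact
  let ?E = "{x. F x = G x}"
  have "closed ?E"
    by (intro closed_Collect_eq F.continuous_on G.continuous_on continuous_on_id)
  moreover have "span {tensor u v | u v. True} \<subseteq> ?E"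
    by (rule span_minimal) (auto simp: eq subspace_def F.add G.add F.scaleR G.scaleR F.zero G.zero)
  ultimately have "closure (span {tensor u v | u v. True}) \<subseteq> ?E"
    by (intro closure_minimal)
  then show ?thesis unfolding closure_span_tensor by auto
qed

text \<open>A continuous flip is unique because elementary tensors span a dense subspace, so the
  existentially quantified operator in the definition can be replaced by the fixed
  \<open>flip\<close>.\<close>

lemma symmetric_tensors_iff: "f \<in> symmetric_tensors tensor \<longleftrightarrow> flip f = f"
proof
  assume "f \<in> symmetric_tensors tensor"
  then obtain S where S: "bounded_linear S" "\<And>u v. S (tensor u v) = tensor v u" "S f = f"
    by (auto simp: symmetric_tensors_def tensor_flip_def)
  then show "flip f = f"
    using bounded_linear_tensor_ext[OF flip.bounded_linear_axioms S(1), of f] by (simp add: flip_tensor)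
next
  assume "flip f = f"
  then show "f \<in> symmetric_tensors tensor" using flip by (auto simp: symmetric_tensors_def)
qed

lemma inner_contr: "inner (contr f u) v = inner f (tensor v u)"
proof (rule bounded_linear_tensor_ext[where x=f])
  show "bounded_linear (\<lambda>f. inner (contr f u) v)"
    by (intro bounded_linear_inner_left_comp contr.bounded_linear_left)
  show "bounded_linear (\<lambda>f. inner f (tensor v u))"
    by (rule bounded_linear_inner_left)
qed (simp add: contr_tensor inner_tensor inner_commute mult.commute)

lemma inner_flip: "inner (flip f) (tensor u v) = inner f (tensor v u)"
proof (rule bounded_linear_tensor_ext[where x=f])
  show "bounded_linear (\<lambda>f. inner (flip f) (tensor u v))"
    by (intro bounded_linear_inner_left_comp flip.bounded_linear_axioms)
  show "bounded_linear (\<lambda>f. inner f (tensor v u))"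
    by (rule bounded_linear_inner_left)
qed (simp add: flip_tensor inner_tensor mult.commute)

lemma contr_symmetric:
  assumes "flip f = f"
  shows "inner (contr f u) v = inner (contr f v) u"
  using inner_flip[of f u v] assms by (simp add: inner_contr)

abbreviation squares :: "'k set" where
  "squares \<equiv> range (\<lambda>h. tensor h h)"

lemma flip_span_squares: "g \<in> span squares \<Longrightarrow> flip g = g"
  by (induction rule: span_induct_alt) (auto simp: flip.zero flip.add flip.scaleR flip_tensor)

lemma tensor_polarization:
  "tensor u v + tensor v u = (1/2) *\<^sub>R tensor (u + v) (u + v) + (-1/2) *\<^sub>R tensor (u - v) (u - v)"
proof -
  have "tensor (u + v) (u + v) - tensor (u - v) (u - v) = 2 *\<^sub>R (tensor u v + tensor v u)"
    by (simp add: tensor.add_left tensor.add_right tensor.diff_left tensor.diff_right scaleR_2)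
  then have "(1/2) *\<^sub>R (tensor (u + v) (u + v) - tensor (u - v) (u - v)) = (1/2) *\<^sub>R (2 *\<^sub>R (tensor u v + tensor v u))"
    by simp
  then show ?thesis by (simp add: scaleR_diff_right)
qed

text \<open>Symmetrization is continuous, fixes symmetric tensors and, by polarization, maps
  elementary tensors into the span of squares; so density of all elementary tensors carries over.
  Squares matter because the double integral is prescribed on them alone.\<close>

lemma symmetric_closure_squares:
  assumes "flip f = f"
  shows "f \<in> closure (span squares)"
proof -
  let ?s = "\<lambda>f. (1/2) *\<^sub>R (f + flip f)"
  have lin: "bounded_linear ?s"
    by (intro bounded_linear_intros flip.bounded_linear_axioms)
  interpret s: bounded_linear ?s by (rule lin)
  have "?s x \<in> span squares" if "x \<in> span {tensor u v | u v. True}" for x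
    using that
  proof (induction rule: span_induct_alt)
    case base
    then show ?case by (simp add: flip.zero span_zero)
  next
    case (step c x y)
    then obtain u v where x: "x = tensor u v" by auto
    have "?s x = (1/2) *\<^sub>R ((1/2) *\<^sub>R tensor (u + v) (u + v) + (-1/2) *\<^sub>R tensor (u - v) (u - v))"
      by (simp add: x flip_tensor tensor_polarization)
    also have "\<dots> \<in> span squares"
      by (intro span_scale span_add span_base) auto
    finally have "c *\<^sub>R ?s x + ?s y \<in> span squares"
      using step by (blast intro: span_add span_scale)
    then show ?case by (simp only: s.add s.scaleR)
  qed
  then have "?s ` span {tensor u v | u v. True} \<subseteq> closure (span squares)"
    using closure_subset by blast
  then have "?s ` closure (span {tensor u v | u v. True}) \<subseteq> closure (span squares)"
    by (intro image_closure_subset s.continuous_on continuous_on_id closed_closure)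
  then have "?s f \<in> closure (span squares)" unfolding closure_span_tensor by blast
  then show ?thesis using assms by (simp add: scaleR_add_right flip: scaleR_add_left)
qed

end

section \<open>Moments and the L^2 bound of the double integral\<close>

locale wiener_ito = isonormal_process M X + tensor_square tensor contr flip
  for M :: "'w measure" and X :: "'h::real_inner \<Rightarrow> 'w \<Rightarrow> real"
    and tensor :: "'h \<Rightarrow> 'h \<Rightarrow> 'k::{real_inner, complete_space}" and contr flip +
  fixes I2 :: "'k \<Rightarrow> 'w \<Rightarrow> real"
  assumes I2: "double_wiener_ito_integral M X tensor I2"
begin

lemma measurable_I2: "flip f = f \<Longrightarrow> I2 f \<in> borel_measurable M"
  and integrable_I2_square: "flip f = f \<Longrightarrow> integrable M (\<lambda>\<omega>. (I2 f \<omega>)\<^sup>2)"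
  and I2_linear: "flip f = f \<Longrightarrow> flip g = g \<Longrightarrow> AE \<omega> in M. I2 (a *\<^sub>R f + b *\<^sub>R g) \<omega> = a * I2 f \<omega> + b * I2 g \<omega>"
  using I2 unfolding double_wiener_ito_integral_def by (auto simp: symmetric_tensors_iff image_subset_iff)

lemma I2_continuous:
  "flip f = f \<Longrightarrow> (\<And>n. flip (g n) = g n) \<Longrightarrow> g \<longlonglongrightarrow> f \<Longrightarrow>
    (\<lambda>n. expectation (\<lambda>\<omega>. (I2 (g n) \<omega> - I2 f \<omega>)\<^sup>2)) \<longlonglongrightarrow> 0"
  using I2 unfolding double_wiener_ito_integral_def by (auto simp: symmetric_tensors_iff image_subset_iff)

lemma I2_scale: "flip f = f \<Longrightarrow> AE \<omega> in M. I2 (a *\<^sub>R f) \<omega> = a * I2 f \<omega>"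
  using I2_linear[of f f a 0] by simp

lemma I2_square: "AE \<omega> in M. I2 (tensor h h) \<omega> = (X h \<omega>)\<^sup>2 - (norm h)\<^sup>2"
proof (cases "h = 0")
  case True
  have "AE \<omega> in M. X 0 \<omega> = 0" using X_linear[of 0 0 0 0] by simp
  moreover have "AE \<omega> in M. I2 0 \<omega> = 0" using I2_scale[of 0 0] by (simp add: flip.zero)
  ultimately show ?thesis using True by (auto simp: tensor.zero_left elim: eventually_elim2)
next
  case False
  define e where "e = h /\<^sub>R norm h"
  have e: "norm e = 1" "h = norm h *\<^sub>R e" using False by (auto simp: e_def)
  have "tensor h h = (norm h)\<^sup>2 *\<^sub>R tensor e e"
    by (subst (1 2) e(2)) (simp add: tensor.scaleR_left tensor.scaleR_right power2_eq_square)
  then have "AE \<omega> in M. I2 (tensor h h) \<omega> = (norm h)\<^sup>2 * I2 (tensor e e) \<omega>"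
    using I2_scale[of "tensor e e" "(norm h)\<^sup>2"] by (simp add: flip_tensor)
  moreover have "AE \<omega> in M. I2 (tensor e e) \<omega> = (X e \<omega>)\<^sup>2 - 1"
    using I2 e(1) unfolding double_wiener_ito_integral_def by blast
  moreover have "AE \<omega> in M. X h \<omega> = norm h * X e \<omega>"
    using X_linear[of "norm h" e 0 0] e(2) by simp
  ultimately show ?thesis
    by eventually_elim (simp add: power_mult_distrib right_diff_distrib)
qed

lemma I2_sym_product: "AE \<omega> in M. I2 (tensor u v + tensor v u) \<omega> = 2 * X u \<omega> * X v \<omega> - 2 * inner u v"
proof -
  have "AE \<omega> in M. I2 (tensor u v + tensor v u) \<omega>
      = 1/2 * I2 (tensor (u + v) (u + v)) \<omega> + (-1/2) * I2 (tensor (u - v) (u - v)) \<omega>"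
    unfolding tensor_polarization by (intro I2_linear) (simp_all add: flip_tensor)
  moreover have "AE \<omega> in M. X (u + v) \<omega> = X u \<omega> + X v \<omega>" using X_linear[of 1 u 1 v] by simp
  moreover have "AE \<omega> in M. X (u - v) \<omega> = X u \<omega> - X v \<omega>" using X_linear[of 1 u "-1" v] by simp
  moreover note I2_square[of "u + v"] I2_square[of "u - v"]
  ultimately show ?thesis
  proof eventually_elim
    case (elim \<omega>)
    show ?case
      unfolding elim power2_norm_eq_inner
      by (simp add: inner_add_left inner_add_right inner_diff_left inner_diff_right
          inner_commute power2_eq_square field_simps)
  qed
qed

lemma integrable_X_square_mult: "integrable M (\<lambda>\<omega>. (X h \<omega>)\<^sup>2 * (X h' \<omega>)\<^sup>2)"
  by (rule integrable_mult_of_squares) (auto intro: integrable_X_power simp flip: power_mult)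

text \<open>Polarization: (x + y)^4 + (x - y)^4 = 2 x^4 + 2 y^4 + 12 x^2 y^2, and the fourth moment
  of \<open>X h\<close> is 3 |h|^4. No joint law is needed.\<close>

lemma expectation_X_square_mult:
  "expectation (\<lambda>\<omega>. (X h \<omega>)\<^sup>2 * (X h' \<omega>)\<^sup>2) = (norm h)\<^sup>2 * (norm h')\<^sup>2 + 2 * (inner h h')\<^sup>2"
proof -
  have "expectation (\<lambda>\<omega>. X (h + h') \<omega> ^ 4 + X (h - h') \<omega> ^ 4)
    = expectation (\<lambda>\<omega>. 2 * X h \<omega> ^ 4 + 2 * X h' \<omega> ^ 4 + 12 * ((X h \<omega>)\<^sup>2 * (X h' \<omega>)\<^sup>2))"
  proof (rule integral_cong_AE)
    have "AE \<omega> in M. X (h + h') \<omega> = X h \<omega> + X h' \<omega>" using X_linear[of 1 h 1 h'] by simp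
    moreover have "AE \<omega> in M. X (h - h') \<omega> = X h \<omega> - X h' \<omega>" using X_linear[of 1 h "-1" h'] by simp
    ultimately show "AE \<omega> in M. X (h + h') \<omega> ^ 4 + X (h - h') \<omega> ^ 4
       = 2 * X h \<omega> ^ 4 + 2 * X h' \<omega> ^ 4 + 12 * ((X h \<omega>)\<^sup>2 * (X h' \<omega>)\<^sup>2)"
    proof eventually_elim
      case (elim \<omega>)
      show ?case unfolding elim by (simp add: eval_nat_numeral algebra_simps)
    qed
  qed auto
  then have "3 * norm (h + h') ^ 4 + 3 * norm (h - h') ^ 4
    = 6 * norm h ^ 4 + 6 * norm h' ^ 4 + 12 * expectation (\<lambda>\<omega>. (X h \<omega>)\<^sup>2 * (X h' \<omega>)\<^sup>2)"
    using integrable_X_power integrable_X_square_mult by (simp add: expectation_X_power4)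
  moreover have "norm (h + h') ^ 4 = ((norm h)\<^sup>2 + (norm h')\<^sup>2 + 2 * inner h h')\<^sup>2"
  proof -
    have "norm (h + h') ^ 4 = ((norm (h + h'))\<^sup>2)\<^sup>2" by simp
    also have "(norm (h + h'))\<^sup>2 = (norm h)\<^sup>2 + (norm h')\<^sup>2 + 2 * inner h h'"
      by (simp add: power2_norm_eq_inner inner_add_left inner_add_right inner_commute)
    finally show ?thesis .
  qed
  moreover have "norm (h - h') ^ 4 = ((norm h)\<^sup>2 + (norm h')\<^sup>2 - 2 * inner h h')\<^sup>2"
  proof -
    have "norm (h - h') ^ 4 = ((norm (h - h'))\<^sup>2)\<^sup>2" by simp
    also have "(norm (h - h'))\<^sup>2 = (norm h)\<^sup>2 + (norm h')\<^sup>2 - 2 * inner h h'"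
      by (simp add: power2_norm_eq_inner inner_diff_left inner_diff_right inner_commute)
    finally show ?thesis .
  qed
  ultimately show ?thesis
    by (simp add: eval_nat_numeral algebra_simps)
qed

lemma isometry_squares:
  "expectation (\<lambda>\<omega>. I2 (tensor h h) \<omega> * I2 (tensor h' h') \<omega>) = 2 * inner (tensor h h) (tensor h' h')"
proof -
  have "expectation (\<lambda>\<omega>. I2 (tensor h h) \<omega> * I2 (tensor h' h') \<omega>)
    = expectation (\<lambda>\<omega>. (X h \<omega>)\<^sup>2 * (X h' \<omega>)\<^sup>2 - (norm h')\<^sup>2 * (X h \<omega>)\<^sup>2 - (norm h)\<^sup>2 * (X h' \<omega>)\<^sup>2 + (norm h)\<^sup>2 * (norm h')\<^sup>2)"
  proof (rule integral_cong_AE)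
    show "AE \<omega> in M. I2 (tensor h h) \<omega> * I2 (tensor h' h') \<omega> = (X h \<omega>)\<^sup>2 * (X h' \<omega>)\<^sup>2 - (norm h')\<^sup>2 * (X h \<omega>)\<^sup>2 - (norm h)\<^sup>2 * (X h' \<omega>)\<^sup>2 + (norm h)\<^sup>2 * (norm h')\<^sup>2"
      using I2_square[of h] I2_square[of h']
    proof eventually_elim
      case (elim \<omega>)
      show ?case unfolding elim by (simp add: algebra_simps)
    qed
  qed (auto intro!: borel_measurable_times measurable_I2 simp: flip_tensor)
  also have "\<dots> = 2 * inner (tensor h h) (tensor h' h')"
  proof -
    have "expectation (\<lambda>\<omega>. (X h \<omega>)\<^sup>2) = (norm h)\<^sup>2" for h
      using covariance[of h h] by (simp add: power2_eq_square[of "X h _"] power2_norm_eq_inner)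
    then show ?thesis
      using integrable_X_power integrable_X_square_mult
      by (simp add: expectation_X_square_mult inner_tensor power2_eq_square[of "inner h h'"] prob_space algebra_simps)
  qed
  finally show ?thesis .
qed

lemma integrable_I2_mult: "flip f = f \<Longrightarrow> flip g = g \<Longrightarrow> integrable M (\<lambda>\<omega>. I2 f \<omega> * I2 g \<omega>)"
  by (intro integrable_mult_of_squares measurable_I2 integrable_I2_square)

lemma isometry_span_step:
  assumes f: "flip f = f" and g: "flip g = g" and k: "flip k = k"
    and "expectation (\<lambda>\<omega>. I2 f \<omega> * I2 k \<omega>) = 2 * inner f k" "expectation (\<lambda>\<omega>. I2 g \<omega> * I2 k \<omega>) = 2 * inner g k"
  shows "expectation (\<lambda>\<omega>. I2 (c *\<^sub>R f + g) \<omega> * I2 k \<omega>) = 2 * inner (c *\<^sub>R f + g) k"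
proof -
  have "expectation (\<lambda>\<omega>. I2 (c *\<^sub>R f + g) \<omega> * I2 k \<omega>) = expectation (\<lambda>\<omega>. c * (I2 f \<omega> * I2 k \<omega>) + I2 g \<omega> * I2 k \<omega>)"
  proof (rule integral_cong_AE)
    show "AE \<omega> in M. I2 (c *\<^sub>R f + g) \<omega> * I2 k \<omega> = c * (I2 f \<omega> * I2 k \<omega>) + I2 g \<omega> * I2 k \<omega>"
      using I2_linear[OF f g, of c 1] by eventually_elim (simp add: algebra_simps)
  qed (use assms in \<open>auto intro!: borel_measurable_times borel_measurable_add measurable_I2 simp: flip.add flip.scaleR\<close>)
  then show ?thesis
    using integrable_I2_mult assms by (simp add: inner_add_left)
qed

text \<open>One span induction per argument, starting from squares. Invariance under
  \<open>flip\<close> is carried along because linearity of \<open>I2\<close> is available for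
  symmetric tensors, and only almost everywhere.\<close>

lemma isometry_span:
  assumes "f \<in> span squares" "g \<in> span squares"
  shows "expectation (\<lambda>\<omega>. I2 f \<omega> * I2 g \<omega>) = 2 * inner f g"
proof -
  have zero: "expectation (\<lambda>\<omega>. I2 0 \<omega> * I2 k \<omega>) = 2 * inner 0 k" if "flip k = k" for k
  proof -
    have "expectation (\<lambda>\<omega>. I2 0 \<omega> * I2 k \<omega>) = expectation (\<lambda>\<omega>. 0)"
    proof (rule integral_cong_AE)
      show "AE \<omega> in M. I2 0 \<omega> * I2 k \<omega> = 0"
        using I2_scale[of 0 0] by (auto simp: flip.zero)
    qed (use that in \<open>auto intro!: borel_measurable_times measurable_I2 simp: flip.zero\<close>)
    then show ?thesis by simp
  qed
  have 1: "flip k = k \<and> expectation (\<lambda>\<omega>. I2 k \<omega> * I2 (tensor h h) \<omega>) = 2 * inner k (tensor h h)"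
    if "k \<in> span squares" for k h
    using that
  proof (induction rule: span_induct_alt)
    case base
    then show ?case using zero[of "tensor h h"] by (simp add: flip_tensor flip.zero)
  next
    case (step c x y)
    then have "flip (c *\<^sub>R x + y) = c *\<^sub>R x + y" by (auto simp: flip.add flip.scaleR flip_tensor)
    with step show ?case
      by (intro conjI isometry_span_step) (auto simp: flip_tensor isometry_squares)
  qed
  have "flip f = f \<and> expectation (\<lambda>\<omega>. I2 f \<omega> * I2 g \<omega>) = 2 * inner f g"
    using assms(1)
  proof (induction rule: span_induct_alt)
    case base
    then show ?case using zero[of g] flip_span_squares[OF assms(2)] by (simp add: flip.zero)
  next
    case (step c x y)
    then obtain h where x: "x = tensor h h" by auto
    have "flip (c *\<^sub>R x + y) = c *\<^sub>R x + y" using step by (auto simp: flip.add flip.scaleR flip_tensor)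
    then show ?case
      using step 1[OF assms(2), of h]
      by (intro conjI isometry_span_step) (auto simp: flip_tensor x mult.commute inner_commute)
  qed
  then show ?thesis ..
qed

text \<open>The exact constant is \<open>2\<close>; the weaker one follows from \<open>(x + y)^2 \<le> 2 x^2 + 2 y^2\<close> without
  convergence of the \<open>L^2\<close> norms.\<close>

lemma I2_square_le:
  assumes f: "flip f = f"
  shows "expectation (\<lambda>\<omega>. (I2 f \<omega>)\<^sup>2) \<le> 4 * (norm f)\<^sup>2"
proof -
  obtain g where g: "\<And>n. g n \<in> span squares" "g \<longlonglongrightarrow> f"
    using symmetric_closure_squares[OF f] unfolding closure_sequential by blast
  have fg: "flip (g n) = g n" for n using flip_span_squares[OF g(1)] .
  have "expectation (\<lambda>\<omega>. (I2 f \<omega>)\<^sup>2) \<le> 2 * (2 * (norm (g n))\<^sup>2) + 2 * expectation (\<lambda>\<omega>. (I2 (g n) \<omega> - I2 f \<omega>)\<^sup>2)" for n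
  proof -
    have sq: "integrable M (\<lambda>\<omega>. (I2 (g n) \<omega> - I2 f \<omega>)\<^sup>2)"
    proof -
      have "integrable M (\<lambda>\<omega>. (I2 (g n) \<omega>)\<^sup>2 + (I2 f \<omega>)\<^sup>2 - 2 * (I2 (g n) \<omega> * I2 f \<omega>))"
        using integrable_I2_mult[OF fg[of n] f] integrable_I2_square f fg by simp
      then show ?thesis by (simp add: power2_diff mult.assoc)
    qed
    have "expectation (\<lambda>\<omega>. (I2 f \<omega>)\<^sup>2) \<le> expectation (\<lambda>\<omega>. 2 * (I2 (g n) \<omega>)\<^sup>2 + 2 * (I2 (g n) \<omega> - I2 f \<omega>)\<^sup>2)"
    proof (rule integral_mono)
      fix \<omega>
      show "(I2 f \<omega>)\<^sup>2 \<le> 2 * (I2 (g n) \<omega>)\<^sup>2 + 2 * (I2 (g n) \<omega> - I2 f \<omega>)\<^sup>2"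
        using zero_le_power2[of "2 * I2 (g n) \<omega> - I2 f \<omega>"] by (simp add: power2_diff power_mult_distrib)
    qed (use sq integrable_I2_square f fg in auto)
    also have "\<dots> = 2 * expectation (\<lambda>\<omega>. (I2 (g n) \<omega>)\<^sup>2) + 2 * expectation (\<lambda>\<omega>. (I2 (g n) \<omega> - I2 f \<omega>)\<^sup>2)"
      using sq integrable_I2_square f fg by simp
    also have "expectation (\<lambda>\<omega>. (I2 (g n) \<omega>)\<^sup>2) = 2 * (norm (g n))\<^sup>2"
      using isometry_span[OF g(1) g(1), of n n] by (simp add: power2_eq_square[of "I2 _ _"] power2_norm_eq_inner)
    finally show ?thesis .
  qed
  moreover have "(\<lambda>n. 2 * (2 * (norm (g n))\<^sup>2) + 2 * expectation (\<lambda>\<omega>. (I2 (g n) \<omega> - I2 f \<omega>)\<^sup>2)) \<longlonglongrightarrow> 2 * (2 * (norm f)\<^sup>2) + 2 * 0"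
    by (intro tendsto_intros g(2) I2_continuous f fg)
  ultimately show ?thesis
    using LIMSEQ_le_const[of _ "2 * (2 * (norm f)\<^sup>2) + 2 * 0"] by (simp add: eventually_sequentially) 
qed

end

context isonormal_process
begin

lemma process_sigma_measurable:
  assumes "p \<in> borel_measurable (process_sigma M X K)"
  shows "p \<in> borel_measurable M"
  using measurable_compose[OF measurable_process_sigma_id assms] .

lemma measurable_process_sigma_mono:
  assumes "p \<in> borel_measurable (process_sigma M X K)" "K \<subseteq> L"
  shows "p \<in> borel_measurable (process_sigma M X L)"
  using assms process_sigma_mono[OF assms(2), of M X] by (auto simp: measurable_def)

text \<open>\<open>X e1\<close> is frozen first: \<open>X e2\<close> and the coefficients are
  measurable for the complement of \<open>e1\<close>. After x has been integrated out only
  \<open>X e2\<close> and the coefficients remain, and \<open>X e2\<close> is frozen in the same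
  way.\<close>

lemma expectation_freeze_pair:
  fixes \<phi> :: "real \<Rightarrow> real" and p q r :: "'w \<Rightarrow> real"
  assumes e: "norm e1 = 1" "norm e2 = 1" "inner e1 e2 = 0"
    and [measurable]: "\<phi> \<in> borel_measurable borel" and \<phi>: "\<And>x. 0 \<le> \<phi> x" "\<And>x. \<phi> x \<le> 1"
    and pqr: "p \<in> borel_measurable (process_sigma M X {h. inner h e1 = 0 \<and> inner h e2 = 0})"
      "q \<in> borel_measurable (process_sigma M X {h. inner h e1 = 0 \<and> inner h e2 = 0})"
      "r \<in> borel_measurable (process_sigma M X {h. inner h e1 = 0 \<and> inner h e2 = 0})"
  shows "expectation (\<lambda>\<omega>. \<phi> (a * (X e1 \<omega>)\<^sup>2 + 2 * (b * X e2 \<omega> + p \<omega>) * X e1 \<omega> + (d * (X e2 \<omega>)\<^sup>2 + 2 * q \<omega> * X e2 \<omega> + r \<omega>)))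
    = expectation (\<lambda>\<omega>. \<integral>y. \<integral>x. \<phi> (a * x\<^sup>2 + 2 * (b * y + p \<omega>) * x + (d * y\<^sup>2 + 2 * q \<omega> * y + r \<omega>))
        \<partial>std_normal_distribution \<partial>std_normal_distribution)"
proof -
  let ?F1 = "process_sigma M X {h. inner h e1 = 0}"
  let ?F2 = "process_sigma M X {h. inner h e2 = 0}"
  have [measurable]: "p \<in> borel_measurable ?F1" "q \<in> borel_measurable ?F1" "r \<in> borel_measurable ?F1"
    "p \<in> borel_measurable ?F2" "q \<in> borel_measurable ?F2" "r \<in> borel_measurable ?F2"
    using pqr by (auto intro!: measurable_process_sigma_mono[where K="{h. inner h e1 = 0 \<and> inner h e2 = 0}"])
  have [measurable]: "X e2 \<in> borel_measurable ?F1"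
    using e by (intro measurable_process_sigma) (simp add: inner_commute)
  have "expectation (\<lambda>\<omega>. (\<lambda>(x, \<omega>). \<phi> (a * x\<^sup>2 + 2 * (b * X e2 \<omega> + p \<omega>) * x + (d * (X e2 \<omega>)\<^sup>2 + 2 * q \<omega> * X e2 \<omega> + r \<omega>))) (X e1 \<omega>, \<omega>))
    = expectation (\<lambda>\<omega>. \<integral>x. (\<lambda>(x, \<omega>). \<phi> (a * x\<^sup>2 + 2 * (b * X e2 \<omega> + p \<omega>) * x + (d * (X e2 \<omega>)\<^sup>2 + 2 * q \<omega> * X e2 \<omega> + r \<omega>))) (x, \<omega>) \<partial>std_normal_distribution)"
    by (rule expectation_freeze) (use e \<phi> in \<open>auto simp: case_prod_beta'\<close>)
  also have "\<dots> = expectation (\<lambda>\<omega>. (\<lambda>(y, \<omega>). \<integral>x. \<phi> (a * x\<^sup>2 + 2 * (b * y + p \<omega>) * x + (d * y\<^sup>2 + 2 * q \<omega> * y + r \<omega>)) \<partial>std_normal_distribution) (X e2 \<omega>, \<omega>))"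
    by simp
  also have "\<dots> = expectation (\<lambda>\<omega>. \<integral>y. (\<lambda>(y, \<omega>). \<integral>x. \<phi> (a * x\<^sup>2 + 2 * (b * y + p \<omega>) * x + (d * y\<^sup>2 + 2 * q \<omega> * y + r \<omega>)) \<partial>std_normal_distribution) (y, \<omega>) \<partial>std_normal_distribution)"
  proof (rule expectation_freeze)
    show "(\<lambda>(y, \<omega>). \<integral>x. \<phi> (a * x\<^sup>2 + 2 * (b * y + p \<omega>) * x + (d * y\<^sup>2 + 2 * q \<omega> * y + r \<omega>)) \<partial>std_normal_distribution)
      \<in> borel_measurable (borel \<Otimes>\<^sub>M ?F2)"
      unfolding case_prod_beta' by measurable
    show "0 \<le> (case z of (y, \<omega>) \<Rightarrow> \<integral>x. \<phi> (a * x\<^sup>2 + 2 * (b * y + p \<omega>) * x + (d * y\<^sup>2 + 2 * q \<omega> * y + r \<omega>)) \<partial>std_normal_distribution)" for z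
      using \<phi> by (auto split: prod.split)
    show "(case z of (y, \<omega>) \<Rightarrow> \<integral>x. \<phi> (a * x\<^sup>2 + 2 * (b * y + p \<omega>) * x + (d * y\<^sup>2 + 2 * q \<omega> * y + r \<omega>)) \<partial>std_normal_distribution) \<le> 1" for z
      using \<phi> by (auto split: prod.split intro!: std_normal_integral_bounds)
  qed (use e in auto)
  finally show ?thesis by simp
qed

end

section \<open>Splitting a symmetric tensor along two orthonormal vectors\<close>

locale orthonormal_pair = tensor_square tensor contr flip
  for tensor :: "'h::real_inner \<Rightarrow> 'h \<Rightarrow> 'k::{real_inner, complete_space}" and contr flip +
  fixes e1 e2 :: 'h
  assumes e: "norm e1 = 1" "norm e2 = 1" "inner e1 e2 = 0"
begin

lemma inner_e [simp]: "inner e1 e1 = 1" "inner e2 e2 = 1" "inner e1 e2 = 0" "inner e2 e1 = 0"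
  using e by (auto simp: norm_eq_1 inner_commute)

definition proj :: "'h \<Rightarrow> 'h" where
  "proj u = u - inner u e1 *\<^sub>R e1 - inner u e2 *\<^sub>R e2"

lemma inner_proj [simp]: "inner (proj u) e1 = 0" "inner (proj u) e2 = 0"
  by (simp_all add: proj_def inner_diff_left)

lemma proj_e [simp]: "proj (c *\<^sub>R e1) = 0" "proj (c *\<^sub>R e2) = 0"
  by (simp_all add: proj_def)

lemma proj_diff: "proj (u - v) = proj u - proj v"
  by (simp add: proj_def inner_diff_left algebra_simps)

text \<open>The factor 3 comes from the triangle inequality; the optimal bound has factor 1.\<close>

lemma norm_proj_le: "norm (proj u) \<le> 3 * norm u"
proof -
  have "norm (proj u) \<le> norm u + norm (inner u e1 *\<^sub>R e1) + norm (inner u e2 *\<^sub>R e2)"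
    unfolding proj_def by (intro norm_triangle_le_diff add_mono norm_triangle_ineq4 order_refl)
  moreover have "\<bar>inner u e1\<bar> \<le> norm u" "\<bar>inner u e2\<bar> \<le> norm u"
    using Cauchy_Schwarz_ineq2[of u] e by (metis mult.right_neutral)+
  ultimately show ?thesis using e by simp
qed

text \<open>\<open>cross1\<close> and \<open>cross2\<close> are chosen such that \<open>resid\<close> is the projection of a symmetric tensor to
  the tensor square of the orthogonal complement of \<open>e1\<close> and \<open>e2\<close>; the term for \<open>e1 \<otimes> e2\<close> is
  counted in \<open>cross1\<close> only.\<close>

definition cross1 :: "'k \<Rightarrow> 'h" where
  "cross1 f = contr f e1 - inner (contr f e1) ((1/2) *\<^sub>R e1) *\<^sub>R e1"

definition cross2 :: "'k \<Rightarrow> 'h" where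
  "cross2 f = contr f e2 - inner (contr f e1) e2 *\<^sub>R e1 - inner (contr f e2) ((1/2) *\<^sub>R e2) *\<^sub>R e2"

definition resid :: "'k \<Rightarrow> 'k" where
  "resid f = f - (tensor e1 (cross1 f) + tensor (cross1 f) e1) - (tensor e2 (cross2 f) + tensor (cross2 f) e2)"

lemma bounded_linear_resid: "bounded_linear resid"
proof -
  have ip: "bounded_linear (\<lambda>f. inner (contr f u) v *\<^sub>R w)" for u v w
    by (intro bounded_linear_compose[OF bounded_bilinear.bounded_linear_left[OF bounded_bilinear_scaleR]]
      bounded_linear_inner_left_comp contr.bounded_linear_left)
  have 1: "bounded_linear cross1" "bounded_linear cross2"
    unfolding cross1_def[abs_def] cross2_def[abs_def]
    by (intro bounded_linear_sub ip contr.bounded_linear_left)+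
  have "bounded_linear (\<lambda>f. tensor u (c f))" "bounded_linear (\<lambda>f. tensor (c f) u)" if "bounded_linear c" for u and c :: "'k \<Rightarrow> 'h"
    by (rule bounded_linear_compose[OF tensor.bounded_linear_right that] bounded_linear_compose[OF tensor.bounded_linear_left that])+
  with 1 show ?thesis
    unfolding resid_def[abs_def] by (intro bounded_linear_sub bounded_linear_add bounded_linear_ident) auto
qed

sublocale resid: bounded_linear resid by (rule bounded_linear_resid)

lemma flip_resid: "flip f = f \<Longrightarrow> flip (resid f) = resid f"
  by (simp add: resid_def flip.add flip.diff flip_tensor add.commute)

text \<open>This links the residual to the complement of \<open>e1\<close> and \<open>e2\<close>:
  its double integral on a square is a polynomial in \<open>X (proj u)\<close>, and density of
  squares extends the measurability to all symmetric tensors.\<close>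

lemma resid_square: "resid (tensor u u) = tensor (proj u) (proj u)"
proof -
  have half: "(x / 2) *\<^sub>R v + (x / 2) *\<^sub>R v = x *\<^sub>R v" "(x / 2) *\<^sub>R v + ((x / 2) *\<^sub>R v + w) = x *\<^sub>R v + w"
    for x and v w :: 'k
    by (simp_all flip: scaleR_add_left add.assoc)
  show ?thesis
    by (simp add: resid_def cross1_def cross2_def proj_def contr_tensor tensor.add_left tensor.add_right
      tensor.diff_left tensor.diff_right tensor.scaleR_left tensor.scaleR_right half algebra_simps)
qed

lemma cross1_eq: "cross1 f = (inner (contr f e1) e1 / 2) *\<^sub>R e1 + (inner (contr f e1) e2) *\<^sub>R e2 + proj (contr f e1)"
proof -
  have "inner (contr f e1) e1 *\<^sub>R e1 = (inner (contr f e1) e1 / 2) *\<^sub>R e1 + (inner (contr f e1) e1 / 2) *\<^sub>R e1"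
    by (simp flip: scaleR_add_left)
  then show ?thesis by (simp add: cross1_def proj_def)
qed

lemma cross2_eq:
  assumes "flip f = f"
  shows "cross2 f = (inner (contr f e2) e2 / 2) *\<^sub>R e2 + proj (contr f e2)"
proof -
  have "inner (contr f e2) e2 *\<^sub>R e2 = (inner (contr f e2) e2 / 2) *\<^sub>R e2 + (inner (contr f e2) e2 / 2) *\<^sub>R e2"
    by (simp flip: scaleR_add_left)
  then show ?thesis by (simp add: cross2_def proj_def contr_symmetric[OF assms, of e1 e2])
qed

end

locale wiener_ito_pair = wiener_ito M X tensor contr flip I2 + orthonormal_pair tensor contr flip e1 e2
  for M :: "'w measure" and X :: "'h::real_inner \<Rightarrow> 'w \<Rightarrow> real"
    and tensor :: "'h \<Rightarrow> 'h \<Rightarrow> 'k::{real_inner, complete_space}" and contr flip I2 e1 e2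
begin

abbreviation "orth \<equiv> process_sigma M X {h. inner h e1 = 0 \<and> inner h e2 = 0}"

lemma I2_resid_span_squares:
  assumes "g \<in> span squares"
  shows "flip g = g \<and> (\<exists>\<rho>\<in>borel_measurable orth. AE \<omega> in M. I2 (resid g) \<omega> = \<rho> \<omega>)"
  using assms
proof (induction rule: span_induct_alt)
  case base
  have "AE \<omega> in M. I2 (resid 0) \<omega> = 0" using I2_scale[of 0 0] by (simp add: flip.zero resid.zero)
  then show ?case by (auto simp: flip.zero intro!: bexI[where x="\<lambda>_. 0"])
next
  case (step c x y)
  then obtain h \<rho> where x: "x = tensor h h" and y: "flip y = y"
    and \<rho> [measurable]: "\<rho> \<in> borel_measurable orth" and "AE \<omega> in M. I2 (resid y) \<omega> = \<rho> \<omega>" by auto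
  moreover have "AE \<omega> in M. I2 (resid (c *\<^sub>R x + y)) \<omega> = c * I2 (resid x) \<omega> + I2 (resid y) \<omega>"
    using I2_linear[of "resid x" "resid y" c 1] x y by (simp add: resid.add resid.scaleR flip_resid flip_tensor)
  moreover have "AE \<omega> in M. I2 (resid x) \<omega> = (X (proj h) \<omega>)\<^sup>2 - (norm (proj h))\<^sup>2"
    unfolding x resid_square by (rule I2_square)
  ultimately have ae: "AE \<omega> in M. I2 (resid (c *\<^sub>R x + y)) \<omega> = c * ((X (proj h) \<omega>)\<^sup>2 - (norm (proj h))\<^sup>2) + \<rho> \<omega>"
    by (auto elim: eventually_elim2)
  have [measurable]: "X (proj h) \<in> borel_measurable orth"
    by (intro measurable_process_sigma) simp
  have "(\<lambda>\<omega>. c * ((X (proj h) \<omega>)\<^sup>2 - (norm (proj h))\<^sup>2) + \<rho> \<omega>) \<in> borel_measurable orth"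
    by measurable
  moreover have "flip (c *\<^sub>R x + y) = c *\<^sub>R x + y"
    using x y by (simp add: flip.add flip.scaleR flip_tensor)
  ultimately show ?case using ae by (intro conjI bexI[of _ "\<lambda>\<omega>. c * ((X (proj h) \<omega>)\<^sup>2 - (norm (proj h))\<^sup>2) + \<rho> \<omega>"])
qed

text \<open>\<open>I2\<close> chooses arbitrary representatives and \<open>orth\<close> is not
  completed, so a measurable version has to be constructed. Approximation by squares converges in
  L^2, and a subsequence converges almost everywhere.\<close>

lemma I2_resid_measurable:
  assumes f: "flip f = f"
  obtains \<rho> where "\<rho> \<in> borel_measurable orth" "AE \<omega> in M. I2 (resid f) \<omega> = \<rho> \<omega>"
proof -
  obtain g where g: "\<And>n. g n \<in> span squares" "g \<longlonglongrightarrow> f"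
    using symmetric_closure_squares[OF f] unfolding closure_sequential by blast
  have fg: "flip (g n) = g n" for n using flip_span_squares[OF g(1)] .
  have "\<forall>n. \<exists>\<rho>. \<rho> \<in> borel_measurable orth \<and> (AE \<omega> in M. I2 (resid (g n)) \<omega> = \<rho> \<omega>)"
    using I2_resid_span_squares[OF g(1)] by blast
  from choice[OF this] obtain \<rho> where \<rho>: "\<And>n. \<rho> n \<in> borel_measurable orth" "\<And>n. AE \<omega> in M. I2 (resid (g n)) \<omega> = \<rho> n \<omega>"
    by blast
  define u where "u n \<omega> = (I2 (resid (g n)) \<omega> - I2 (resid f) \<omega>)\<^sup>2" for n \<omega>
  have lim: "(\<lambda>n. expectation (u n)) \<longlonglongrightarrow> 0"
    unfolding u_def by (intro I2_continuous flip_resid f fg resid.tendsto g(2))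
  have int: "integrable M (u n)" for n
  proof -
    have "integrable M (\<lambda>\<omega>. (I2 (resid (g n)) \<omega>)\<^sup>2 + (I2 (resid f) \<omega>)\<^sup>2 - 2 * (I2 (resid (g n)) \<omega> * I2 (resid f) \<omega>))"
      using integrable_I2_mult[OF flip_resid[OF fg[of n]] flip_resid[OF f]]
        integrable_I2_square[OF flip_resid[OF f]] integrable_I2_square[OF flip_resid[OF fg[of n]]] by simp
    then show ?thesis by (simp add: u_def[abs_def] power2_diff mult.assoc)
  qed
  have "(\<lambda>n. \<integral>\<omega>. norm (u n \<omega>) \<partial>M) \<longlonglongrightarrow> 0"
    using lim by (simp add: u_def[abs_def])
  then obtain s :: "nat \<Rightarrow> nat" where s: "strict_mono s" "AE \<omega> in M. (\<lambda>n. u (s n) \<omega>) \<longlonglongrightarrow> 0"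
    using tendsto_L1_AE_subseq[of M u, OF int] by blast
  \<comment> \<open>\<open>lim\<close> is total, so this is an \<open>orth\<close>-measurable
    function even though convergence holds only almost everywhere.\<close>
  have "(\<lambda>\<omega>. lim (\<lambda>n. \<rho> (s n) \<omega>)) \<in> borel_measurable orth"
    by (intro borel_measurable_lim_metric \<rho>(1))
  moreover have "AE \<omega> in M. \<forall>n. I2 (resid (g n)) \<omega> = \<rho> n \<omega>"
    using \<rho>(2) by (simp add: AE_all_countable)
  with s(2) have "AE \<omega> in M. I2 (resid f) \<omega> = lim (\<lambda>n. \<rho> (s n) \<omega>)"
  proof eventually_elim
    case (elim \<omega>)
    have "(\<lambda>n. sqrt (u (s n) \<omega>)) \<longlonglongrightarrow> sqrt 0" using elim(1) by (intro tendsto_real_sqrt)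
    then have "(\<lambda>n. \<rho> (s n) \<omega> - I2 (resid f) \<omega>) \<longlonglongrightarrow> 0"
      using elim(2) by (simp add: u_def tendsto_rabs_zero_iff)
    then have "(\<lambda>n. \<rho> (s n) \<omega>) \<longlonglongrightarrow> I2 (resid f) \<omega>" by (simp add: LIM_zero_iff)
    then show ?case by (simp add: limI)
  qed
  ultimately show ?thesis using that by blast
qed

text \<open>\<open>f\<close> is the sum of two symmetric products and \<open>resid f\<close>, and
  the product formula applies to the first two. Its term \<open>- 2 * inner u v\<close> produces the
  constants subtracted at the end, because the coefficient of \<open>e1\<close> in
  \<open>cross1 f\<close> and that of \<open>e2\<close> in \<open>cross2 f\<close> are
  halved.\<close>

lemma I2_decomposition:
  assumes f: "flip f = f"
  shows "AE \<omega> in M. I2 f \<omega> = inner (contr f e1) e1 * (X e1 \<omega>)\<^sup>2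
      + 2 * (inner (contr f e1) e2 * X e2 \<omega> + X (proj (contr f e1)) \<omega>) * X e1 \<omega>
      + (inner (contr f e2) e2 * (X e2 \<omega>)\<^sup>2 + 2 * X (proj (contr f e2)) \<omega> * X e2 \<omega>
         + (I2 (resid f) \<omega> - inner (contr f e1) e1 - inner (contr f e2) e2))"
proof -
  let ?s1 = "tensor e1 (cross1 f) + tensor (cross1 f) e1"
  let ?s2 = "tensor e2 (cross2 f) + tensor (cross2 f) e2"
  have fl: "flip ?s1 = ?s1" "flip ?s2 = ?s2" "flip (?s1 + ?s2) = ?s1 + ?s2"
    by (simp_all add: flip.add flip_tensor add.commute)
  have inner_cross: "inner e1 (cross1 f) = inner (contr f e1) e1 / 2" "inner e2 (cross2 f) = inner (contr f e2) e2 / 2"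
    unfolding cross1_eq cross2_eq[OF f] by (simp_all add: inner_add_right inner_commute[of e1 "proj _"] inner_commute[of e2 "proj _"])
  have "1 *\<^sub>R (1 *\<^sub>R ?s1 + 1 *\<^sub>R ?s2) + 1 *\<^sub>R resid f = f"
    by (simp add: resid_def)
  then have "AE \<omega> in M. I2 f \<omega> = I2 (1 *\<^sub>R ?s1 + 1 *\<^sub>R ?s2) \<omega> + I2 (resid f) \<omega>"
    using I2_linear[of "1 *\<^sub>R ?s1 + 1 *\<^sub>R ?s2" "resid f" 1 1] fl(3) flip_resid[OF f] by simp
  moreover have "AE \<omega> in M. I2 (1 *\<^sub>R ?s1 + 1 *\<^sub>R ?s2) \<omega> = 1 * I2 ?s1 \<omega> + 1 * I2 ?s2 \<omega>"
    by (rule I2_linear[OF fl(1,2)])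
  moreover have "AE \<omega> in M. X (cross1 f) \<omega> = 1 * X ((inner (contr f e1) e1 / 2) *\<^sub>R e1 + (inner (contr f e1) e2) *\<^sub>R e2) \<omega> + 1 * X (proj (contr f e1)) \<omega>"
    using X_linear[of 1 "(inner (contr f e1) e1 / 2) *\<^sub>R e1 + (inner (contr f e1) e2) *\<^sub>R e2" 1 "proj (contr f e1)"]
    by (simp add: cross1_eq)
  moreover have "AE \<omega> in M. X ((inner (contr f e1) e1 / 2) *\<^sub>R e1 + (inner (contr f e1) e2) *\<^sub>R e2) \<omega>
      = inner (contr f e1) e1 / 2 * X e1 \<omega> + inner (contr f e1) e2 * X e2 \<omega>"
    by (rule X_linear)
  moreover have "AE \<omega> in M. X (cross2 f) \<omega> = inner (contr f e2) e2 / 2 * X e2 \<omega> + 1 * X (proj (contr f e2)) \<omega>"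
    using X_linear[of "inner (contr f e2) e2 / 2" e2 1 "proj (contr f e2)"]
    by (simp add: cross2_eq[OF f])
  moreover note I2_sym_product[of e1 "cross1 f"] I2_sym_product[of e2 "cross2 f"]
  ultimately show ?thesis
  proof eventually_elim
    case (elim \<omega>)
    show ?case unfolding elim inner_cross by (simp add: field_simps power2_eq_square)
  qed
qed

end

section \<open>Total variation distance\<close>

context wiener_ito_pair
begin

text \<open>The variance of |Y| is nonnegative.\<close>

lemma abs_moment_le:
  assumes [measurable]: "Y \<in> borel_measurable M" and int: "integrable M (\<lambda>\<omega>. (Y \<omega>)\<^sup>2 :: real)"
    and le: "expectation (\<lambda>\<omega>. (Y \<omega>)\<^sup>2) \<le> s\<^sup>2" and s: "0 \<le> s"
  shows "integrable M (\<lambda>\<omega>. \<bar>Y \<omega>\<bar>)" "expectation (\<lambda>\<omega>. \<bar>Y \<omega>\<bar>) \<le> s"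
proof -
  have "integrable M (\<lambda>\<omega>. Y \<omega> * 1)"
    using int by (intro integrable_mult_of_squares) auto
  then show absY: "integrable M (\<lambda>\<omega>. \<bar>Y \<omega>\<bar>)" by simp
  define m where "m = expectation (\<lambda>\<omega>. \<bar>Y \<omega>\<bar>)"
  have "0 \<le> expectation (\<lambda>\<omega>. (\<bar>Y \<omega>\<bar> - m)\<^sup>2)" by simp
  also have "\<dots> = expectation (\<lambda>\<omega>. (Y \<omega>)\<^sup>2 + m\<^sup>2 - 2 * m * \<bar>Y \<omega>\<bar>)"
    by (simp add: power2_diff mult.commute mult.left_commute)
  also have "\<dots> = expectation (\<lambda>\<omega>. (Y \<omega>)\<^sup>2) - m\<^sup>2"
    using int absY by (simp add: m_def[symmetric] prob_space power2_eq_square[of m])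
  finally have "m\<^sup>2 \<le> s\<^sup>2" using le by simp
  then have "m \<le> s" using s by (rule power2_le_imp_le)
  then show "expectation (\<lambda>\<omega>. \<bar>Y \<omega>\<bar>) \<le> s" by (simp add: m_def)
qed

lemma expectation_X_square: "expectation (\<lambda>\<omega>. (X h \<omega>)\<^sup>2) = (norm h)\<^sup>2"
  using covariance[of h h] by (simp add: power2_eq_square[of "X h _"] power2_norm_eq_inner)

text \<open>Both polynomials are averaged over (X e1, X e2) with the other variables frozen. The
  deterministic comparison then holds for almost every \<omega>, and the expectation of its error is
  of first order in the distance of the tensors.\<close>

lemma total_variation_le:
  fixes \<phi> :: "real \<Rightarrow> real" and l1 l2 c \<delta> K R :: real
  assumes finf: "flip finf = finf" "contr finf e1 = l1 *\<^sub>R e1" "contr finf e2 = l2 *\<^sub>R e2"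
    and f: "flip f = f"
    and pert: "quadratic_perturbation_bound l1 l2 \<delta> c"
    and c: "0 \<le> c"
    and K: "\<And>f g. norm (contr f g) \<le> norm f * norm g * K" "0 \<le> K"
    and R: "\<And>f. norm (resid f) \<le> norm f * R" "0 \<le> R"
    and small: "K * norm (f - finf) \<le> \<delta>" "norm (f - finf) \<le> 1"
    and [measurable]: "\<phi> \<in> borel_measurable borel" and \<phi>: "\<And>x. 0 \<le> \<phi> x" "\<And>x. \<phi> x \<le> 1"
  shows "\<bar>expectation (\<lambda>\<omega>. \<phi> (I2 f \<omega>)) - expectation (\<lambda>\<omega>. \<phi> (I2 finf \<omega>))\<bar>
    \<le> c * (11 * K + 18 * K\<^sup>2 + 2 * R) * norm (f - finf)"
proof -
  define \<epsilon> where "\<epsilon> = norm (f - finf)"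
  have \<epsilon>: "0 \<le> \<epsilon>" "\<epsilon> \<le> 1" "K * \<epsilon> \<le> \<delta>" using small by (auto simp: \<epsilon>_def)
  have contr_le: "norm (contr (f - finf) u) \<le> K * \<epsilon>" if "norm u = 1" for u
    using K(1)[of "f - finf" u] that by (simp add: \<epsilon>_def mult.commute)
  have inner_le: "\<bar>inner (contr (f - finf) u) v\<bar> \<le> K * \<epsilon>" if "norm u = 1" "norm v = 1" for u v
    using Cauchy_Schwarz_ineq2[of "contr (f - finf) u" v] contr_le[of u] that by simp
  define a b d where "a = inner (contr f e1) e1" and "b = inner (contr f e1) e2" and "d = inner (contr f e2) e2"
  have abd: "\<bar>a - l1\<bar> \<le> K * \<epsilon>" "\<bar>b\<bar> \<le> K * \<epsilon>" "\<bar>d - l2\<bar> \<le> K * \<epsilon>"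
    using inner_le[of e1 e1] inner_le[of e1 e2] inner_le[of e2 e2] e
    by (simp_all add: a_def b_def d_def contr.diff_left inner_diff_left finf)
  define h1 h2 where "h1 = proj (contr f e1)" and "h2 = proj (contr f e2)"
  \<comment> \<open>\<open>proj\<close> kills the multiples of \<open>e1\<close> and
    \<open>e2\<close> to which \<open>contr finf\<close> maps these eigenvectors, so the linear
    coefficients see only \<open>f - finf\<close>.\<close>
  have "h1 = proj (contr (f - finf) e1)" "h2 = proj (contr (f - finf) e2)"
    by (simp_all add: h1_def h2_def contr.diff_left proj_diff finf)
  then have h: "norm h1 \<le> 3 * (K * \<epsilon>)" "norm h2 \<le> 3 * (K * \<epsilon>)"
    using norm_proj_le[of "contr (f - finf) e1"] norm_proj_le[of "contr (f - finf) e2"] contr_le[OF e(1)] contr_le[OF e(2)] by auto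

  obtain \<rho> where \<rho> [measurable]: "\<rho> \<in> borel_measurable orth" and \<rho>_eq: "AE \<omega> in M. I2 (resid f) \<omega> = \<rho> \<omega>"
    by (rule I2_resid_measurable[OF f])
  obtain \<rho>' where \<rho>' [measurable]: "\<rho>' \<in> borel_measurable orth" and \<rho>'_eq: "AE \<omega> in M. I2 (resid finf) \<omega> = \<rho>' \<omega>"
    by (rule I2_resid_measurable[OF finf(1)])
  define r r' where "r \<omega> = \<rho> \<omega> - a - d" and "r' \<omega> = \<rho>' \<omega> - l1 - l2" for \<omega>
  have r_orth [measurable]: "r \<in> borel_measurable orth" "r' \<in> borel_measurable orth"
    unfolding r_def[abs_def] r'_def[abs_def] by measurable
  have h_orth: "X h1 \<in> borel_measurable orth" "X h2 \<in> borel_measurable orth"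
    unfolding h1_def h2_def by (intro measurable_process_sigma; simp)+
  have [measurable]: "r \<in> borel_measurable M" "r' \<in> borel_measurable M"
    by (rule process_sigma_measurable[OF r_orth(1)], rule process_sigma_measurable[OF r_orth(2)])
  have [measurable]: "I2 f \<in> borel_measurable M" "I2 finf \<in> borel_measurable M"
    using f finf by (auto intro: measurable_I2)

  let ?J = "\<lambda>\<omega>. \<integral>y. \<integral>x. \<phi> (a * x\<^sup>2 + 2 * (b * y + X h1 \<omega>) * x + (d * y\<^sup>2 + 2 * X h2 \<omega> * y + r \<omega>))
        \<partial>std_normal_distribution \<partial>std_normal_distribution"
  let ?J' = "\<lambda>\<omega>. \<integral>y. \<integral>x. \<phi> (l1 * x\<^sup>2 + (l2 * y\<^sup>2 + r' \<omega>)) \<partial>std_normal_distribution \<partial>std_normal_distribution"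
  have "expectation (\<lambda>\<omega>. \<phi> (I2 f \<omega>)) = expectation (\<lambda>\<omega>. \<phi> (a * (X e1 \<omega>)\<^sup>2 + 2 * (b * X e2 \<omega> + X h1 \<omega>) * X e1 \<omega> + (d * (X e2 \<omega>)\<^sup>2 + 2 * X h2 \<omega> * X e2 \<omega> + r \<omega>)))"
  proof (rule integral_cong_AE)
    show "AE \<omega> in M. \<phi> (I2 f \<omega>) = \<phi> (a * (X e1 \<omega>)\<^sup>2 + 2 * (b * X e2 \<omega> + X h1 \<omega>) * X e1 \<omega> + (d * (X e2 \<omega>)\<^sup>2 + 2 * X h2 \<omega> * X e2 \<omega> + r \<omega>))"
      using I2_decomposition[OF f] \<rho>_eq by eventually_elim (simp add: a_def b_def d_def h1_def h2_def r_def)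
  qed auto
  also have "\<dots> = expectation ?J"
    using e \<phi> h_orth r_orth by (intro expectation_freeze_pair) auto
  finally have Ef: "expectation (\<lambda>\<omega>. \<phi> (I2 f \<omega>)) = expectation ?J" .
  have "expectation (\<lambda>\<omega>. \<phi> (I2 finf \<omega>)) = expectation (\<lambda>\<omega>. \<phi> (l1 * (X e1 \<omega>)\<^sup>2 + 2 * (0 * X e2 \<omega> + 0) * X e1 \<omega> + (l2 * (X e2 \<omega>)\<^sup>2 + 2 * 0 * X e2 \<omega> + r' \<omega>)))"
  proof (rule integral_cong_AE)
    have X0: "AE \<omega> in M. X 0 \<omega> = 0" using X_linear[of 0 0 0 0] by simp
    show "AE \<omega> in M. \<phi> (I2 finf \<omega>) = \<phi> (l1 * (X e1 \<omega>)\<^sup>2 + 2 * (0 * X e2 \<omega> + 0) * X e1 \<omega> + (l2 * (X e2 \<omega>)\<^sup>2 + 2 * 0 * X e2 \<omega> + r' \<omega>))"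
      using I2_decomposition[OF finf(1)] \<rho>'_eq X0 by eventually_elim (simp add: finf r'_def)
  qed auto
  also have "\<dots> = expectation (\<lambda>\<omega>. \<integral>y. \<integral>x. \<phi> (l1 * x\<^sup>2 + 2 * (0 * y + 0) * x + (l2 * y\<^sup>2 + 2 * 0 * y + r' \<omega>)) \<partial>std_normal_distribution \<partial>std_normal_distribution)"
    using e \<phi> r_orth by (intro expectation_freeze_pair[where p="\<lambda>_. 0" and q="\<lambda>_. 0"]) auto
  also have "\<dots> = expectation ?J'" by simp
  finally have Einf: "expectation (\<lambda>\<omega>. \<phi> (I2 finf \<omega>)) = expectation ?J'" .

  have int_J: "integrable M ?J"
  proof (rule integrable_const_bound[where B=1])
    have inner: "(\<integral>x. \<phi> (a * x\<^sup>2 + 2 * (b * y + X h1 \<omega>) * x + (d * y\<^sup>2 + 2 * X h2 \<omega> * y + r \<omega>)) \<partial>std_normal_distribution) \<le> 1" for y \<omega>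
      using \<phi> by (intro std_normal_integral_bounds) auto
    then have "?J \<omega> \<le> 1" for \<omega>
      using \<phi> by (intro std_normal_integral_bounds) auto
    then show "AE \<omega> in M. norm (?J \<omega>) \<le> 1" using \<phi> by (auto intro!: AE_I2 simp: abs_le_iff intro: order_trans[of _ 0])
  qed measurable
  have int_J': "integrable M ?J'"
  proof (rule integrable_const_bound[where B=1])
    have inner: "(\<integral>x. \<phi> (l1 * x\<^sup>2 + (l2 * y\<^sup>2 + r' \<omega>)) \<partial>std_normal_distribution) \<le> 1" for y \<omega>
      using \<phi> by (intro std_normal_integral_bounds) auto
    then have "?J' \<omega> \<le> 1" for \<omega>
      using \<phi> by (intro std_normal_integral_bounds) auto
    then show "AE \<omega> in M. norm (?J' \<omega>) \<le> 1" using \<phi> by (auto intro!: AE_I2 simp: abs_le_iff intro: order_trans[of _ 0])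
  qed measurable

  let ?Z = "I2 (resid (f - finf))"
  have fd: "flip (resid (f - finf)) = resid (f - finf)"
    using f finf by (intro flip_resid) (simp add: flip.diff)
  have Zsq: "expectation (\<lambda>\<omega>. (?Z \<omega>)\<^sup>2) \<le> (2 * (R * \<epsilon>))\<^sup>2"
  proof -
    have "(norm (resid (f - finf)))\<^sup>2 \<le> (R * \<epsilon>)\<^sup>2"
      using R(1)[of "f - finf"] by (intro power_mono) (auto simp: \<epsilon>_def mult.commute)
    then show ?thesis using I2_square_le[OF fd] by (simp add: power_mult_distrib)
  qed
  have Z: "integrable M (\<lambda>\<omega>. \<bar>?Z \<omega>\<bar>)" "expectation (\<lambda>\<omega>. \<bar>?Z \<omega>\<bar>) \<le> 2 * (R * \<epsilon>)"
    using abs_moment_le[OF measurable_I2[OF fd] integrable_I2_square[OF fd] Zsq] R \<epsilon> by auto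
  have Xabs: "integrable M (\<lambda>\<omega>. \<bar>X h \<omega>\<bar>)" "expectation (\<lambda>\<omega>. \<bar>X h \<omega>\<bar>) \<le> norm h" for h
    using abs_moment_le[OF measurable_X integrable_X_power, of h "norm h"] by (auto simp: expectation_X_square)
  have Z_eq: "AE \<omega> in M. ?Z \<omega> = \<rho> \<omega> - \<rho>' \<omega>"
    using I2_linear[OF flip_resid[OF f] flip_resid[OF finf(1)], of 1 "-1"] \<rho>_eq \<rho>'_eq
    by eventually_elim (simp add: resid.diff)

  \<comment> \<open>The constant terms contain - a - d and - l1 - l2, so \<open>r - r'\<close>
    equals \<open>?Z\<close> up to (a - l1) + (d - l2). This doubles the coefficients of these two
    differences.\<close>
  let ?B = "\<lambda>\<omega>. c * ((2 * \<bar>a - l1\<bar> + \<bar>b\<bar> + 2 * \<bar>d - l2\<bar>) + \<bar>X h1 \<omega>\<bar> + \<bar>X h2 \<omega>\<bar> + (X h1 \<omega>)\<^sup>2 + (X h2 \<omega>)\<^sup>2 + \<bar>?Z \<omega>\<bar>)"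
  have "\<bar>expectation ?J - expectation ?J'\<bar> = \<bar>expectation (\<lambda>\<omega>. ?J \<omega> - ?J' \<omega>)\<bar>"
    using int_J int_J' by simp
  also have "\<dots> \<le> expectation (\<lambda>\<omega>. \<bar>?J \<omega> - ?J' \<omega>\<bar>)"
    by (rule integral_abs_bound)
  also have "\<dots> \<le> expectation ?B"
  proof (rule integral_mono_AE)
    show "integrable M (\<lambda>\<omega>. \<bar>?J \<omega> - ?J' \<omega>\<bar>)"
      using int_J int_J' by (intro integrable_abs Bochner_Integration.integrable_diff)
    show "integrable M ?B"
      by (intro integrable_mult_right Bochner_Integration.integrable_add Xabs Z integrable_X_power) auto
    show "AE \<omega> in M. \<bar>?J \<omega> - ?J' \<omega>\<bar> \<le> ?B \<omega>"
      using Z_eq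
    proof eventually_elim
      case (elim \<omega>)
      have "\<bar>?J \<omega> - ?J' \<omega>\<bar> \<le> c * (\<bar>a - l1\<bar> + \<bar>b\<bar> + \<bar>d - l2\<bar> + \<bar>X h1 \<omega>\<bar> + \<bar>X h2 \<omega>\<bar> + (X h1 \<omega>)\<^sup>2 + (X h2 \<omega>)\<^sup>2 + \<bar>r \<omega> - r' \<omega>\<bar>)"
        using abd \<epsilon> \<phi> by (intro pert[unfolded quadratic_perturbation_bound_def, rule_format]) auto
      also have "\<dots> \<le> ?B \<omega>"
      proof (rule mult_left_mono[OF _ c])
        have "\<bar>r \<omega> - r' \<omega>\<bar> \<le> \<bar>?Z \<omega>\<bar> + \<bar>a - l1\<bar> + \<bar>d - l2\<bar>"
          unfolding elim r_def r'_def by linarith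
        then show "\<bar>a - l1\<bar> + \<bar>b\<bar> + \<bar>d - l2\<bar> + \<bar>X h1 \<omega>\<bar> + \<bar>X h2 \<omega>\<bar> + (X h1 \<omega>)\<^sup>2 + (X h2 \<omega>)\<^sup>2 + \<bar>r \<omega> - r' \<omega>\<bar>
          \<le> (2 * \<bar>a - l1\<bar> + \<bar>b\<bar> + 2 * \<bar>d - l2\<bar>) + \<bar>X h1 \<omega>\<bar> + \<bar>X h2 \<omega>\<bar> + (X h1 \<omega>)\<^sup>2 + (X h2 \<omega>)\<^sup>2 + \<bar>?Z \<omega>\<bar>"
          by linarith
      qed
      finally show ?case .
    qed
  qed
  also have "expectation ?B = c * ((2 * \<bar>a - l1\<bar> + \<bar>b\<bar> + 2 * \<bar>d - l2\<bar>) + expectation (\<lambda>\<omega>. \<bar>X h1 \<omega>\<bar>) + expectation (\<lambda>\<omega>. \<bar>X h2 \<omega>\<bar>)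
      + (norm h1)\<^sup>2 + (norm h2)\<^sup>2 + expectation (\<lambda>\<omega>. \<bar>?Z \<omega>\<bar>))"
    using Xabs(1) Z(1) integrable_X_power by (simp add: expectation_X_square prob_space)
  \<comment> \<open>The quadratic coefficients contribute 2 + 1 + 2 and the means of |X h1| and |X
    h2| contribute 3 each, together 11 K. Each variance is at most 9 K^2 \<epsilon>^2, made linear
    by \<epsilon> <= 1.\<close>
  also have "\<dots> \<le> c * ((2 * (K * \<epsilon>) + K * \<epsilon> + 2 * (K * \<epsilon>)) + 3 * (K * \<epsilon>) + 3 * (K * \<epsilon>) + 9 * K\<^sup>2 * \<epsilon> + 9 * K\<^sup>2 * \<epsilon> + 2 * (R * \<epsilon>))"
  proof (intro mult_left_mono[OF _ c] add_mono Z(2))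
    have "x\<^sup>2 \<le> 9 * K\<^sup>2 * \<epsilon>" if "0 \<le> x" "x \<le> 3 * (K * \<epsilon>)" for x
    proof -
      have "x\<^sup>2 \<le> (3 * (K * \<epsilon>))\<^sup>2" using that by (intro power_mono) auto
      also have "\<dots> = 9 * K\<^sup>2 * (\<epsilon> * \<epsilon>)" by (simp add: power2_eq_square algebra_simps)
      also have "\<dots> \<le> 9 * K\<^sup>2 * (\<epsilon> * 1)" using \<epsilon> by (intro mult_left_mono) auto
      finally show ?thesis by simp
    qed
    then show "(norm h1)\<^sup>2 \<le> 9 * K\<^sup>2 * \<epsilon>" "(norm h2)\<^sup>2 \<le> 9 * K\<^sup>2 * \<epsilon>" using h by auto
    show "expectation (\<lambda>\<omega>. \<bar>X h1 \<omega>\<bar>) \<le> 3 * (K * \<epsilon>)" "expectation (\<lambda>\<omega>. \<bar>X h2 \<omega>\<bar>) \<le> 3 * (K * \<epsilon>)"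
      using Xabs(2)[of h1] Xabs(2)[of h2] h by linarith+
  qed (use abd in auto)
  also have "\<dots> = c * (11 * K + 18 * K\<^sup>2 + 2 * R) * \<epsilon>" by (simp add: algebra_simps)
  finally show ?thesis unfolding Ef Einf \<epsilon>_def .
qed

end

context tensor_square
begin

text \<open>Of three nonzero reals two have the same sign. Their eigenvectors are orthogonal by the
  choice of orthonormal bases if the eigenvalues coincide, and by symmetry of the operator
  otherwise.\<close>

lemma eigenvectors_same_sign:
  assumes f: "flip f = f" and eig: "eigenvalue_sequence (\<lambda>g. contr f g) lam"
    and many: "infinite {k. lam k \<noteq> 0} \<or> 3 \<le> card {k. lam k \<noteq> 0}"
  obtains e1 e2 l1 l2 where "norm e1 = 1" "norm e2 = 1" "inner e1 e2 = 0"
    "contr f e1 = l1 *\<^sub>R e1" "contr f e2 = l2 *\<^sub>R e2" "0 < l1 * l2"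
proof -
  have "\<exists>T. T \<subseteq> {k. lam k \<noteq> 0} \<and> card T = 3"
  proof (cases "finite {k. lam k \<noteq> 0}")
    case True
    then show ?thesis using many by (meson obtain_subset_with_card_n)
  next
    case False
    then show ?thesis using infinite_arbitrarily_large[OF False, of 3] by auto
  qed
  then obtain i j k where ijk: "lam i \<noteq> 0" "lam j \<noteq> 0" "lam k \<noteq> 0" "i \<noteq> j" "j \<noteq> k" "i \<noteq> k"
    by (auto simp: card_3_iff)
  have "\<exists>m n. m \<noteq> n \<and> 0 < lam m * lam n"
  proof (rule ccontr)
    assume "\<not> ?thesis"
    then have "lam i * lam j < 0" "lam j * lam k < 0" "lam i * lam k < 0"
      using ijk by (metis linorder_neqE_linordered_idom no_zero_divisors)+
    then show False by (auto simp: mult_less_0_iff)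
  qed
  then obtain m n where mn: "m \<noteq> n" "0 < lam m * lam n" by blast
  have "\<exists>B. orthonormal_set B \<and> closure (span B) = {g. contr f g = \<mu> *\<^sub>R g} \<and> {k. lam k = \<mu>} \<approx> B" for \<mu>
    using eig by (simp add: eigenvalue_sequence_def)
  then obtain B where B: "\<And>\<mu>. orthonormal_set (B \<mu>)" "\<And>\<mu>. closure (span (B \<mu>)) = {g. contr f g = \<mu> *\<^sub>R g}"
      "\<And>\<mu>. {k. lam k = \<mu>} \<approx> B \<mu>" by metis
  have "\<exists>g. bij_betw g {k. lam k = \<mu>} (B \<mu>)" for \<mu> using B(3)[of \<mu>] by (simp add: eqpoll_def)
  then obtain g where g: "\<And>\<mu>. bij_betw (g \<mu>) {k. lam k = \<mu>} (B \<mu>)" by metis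
  \<comment> \<open>The bijection between the indices of an eigenvalue and a basis of its eigenspace
    gives distinct vectors to distinct indices, also for a repeated eigenvalue.\<close>
  define v where "v k = g (lam k) k" for k
  have v: "v k \<in> B (lam k)" for k using g[of "lam k"] by (auto simp: v_def bij_betw_def)
  have norm_v: "norm (v k) = 1" for k using B(1)[of "lam k"] v by (auto simp: orthonormal_set_def)
  have eig_v: "contr f (v k) = lam k *\<^sub>R v k" for k
  proof -
    have "v k \<in> closure (span (B (lam k)))" using v span_base closure_subset by blast
    then show ?thesis using B(2)[of "lam k"] by simp
  qed
  have "inner (v m) (v n) = 0"
  proof (cases "lam m = lam n")
    case True
    have "v m \<noteq> v n"
      using bij_betw_imp_inj_on[OF g[of "lam n"]] mn(1) True by (auto simp: v_def inj_on_def)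
    then show ?thesis
      using B(1)[of "lam n"] v[of m] v[of n] True by (auto simp: orthonormal_set_def pairwise_def orthogonal_def)
  next
    case False
    have "lam m * inner (v m) (v n) = lam n * inner (v m) (v n)"
      using contr_symmetric[OF f, of "v m" "v n"] by (simp add: eig_v inner_commute)
    with False show ?thesis by simp
  qed
  with norm_v eig_v mn(2) show ?thesis using that by blast
qed

end

theorem theorem1p2:
  fixes tensor :: "'h::{real_inner, polish_space} \<Rightarrow> 'h \<Rightarrow> 'k::{real_inner, complete_space}"
    and contr :: "'k \<Rightarrow> 'h \<Rightarrow> 'h"
    and finf :: 'k
    and lam :: "nat \<Rightarrow> real"
  assumes "infinite_dimensional TYPE('h)"
    and "hilbert_tensor_square tensor"
    and "tensor_contraction tensor contr"
    and "finf \<in> symmetric_tensors tensor"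
    and "eigenvalue_sequence (\<lambda>g. contr finf g) lam"
    and "infinite {k. lam k \<noteq> 0} \<or> 5 \<le> card {k. lam k \<noteq> 0}"
  shows "\<exists>c>0.
    \<forall>(M :: 'w measure) (X :: 'h \<Rightarrow> 'w \<Rightarrow> real) (I2 :: 'k \<Rightarrow> 'w \<Rightarrow> real) (f :: nat \<Rightarrow> 'k).
      isonormal_gaussian_process M X \<longrightarrow>
      double_wiener_ito_integral M X tensor I2 \<longrightarrow>
      (\<forall>n. f n \<in> symmetric_tensors tensor) \<longrightarrow>
      f \<longlonglongrightarrow> finf \<longrightarrow>
      (\<forall>n. (SUP C\<in>sets (borel :: real measure).
              \<bar>measure M {\<omega>\<in>space M. I2 (f n) \<omega> \<in> C} - measure M {\<omega>\<in>space M. I2 finf \<omega> \<in> C}\<bar>)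
            \<le> c * norm (f n - finf))"
proof -
  obtain S where S: "tensor_flip tensor S" using assms(4) by (auto simp: symmetric_tensors_def)
  interpret tensor_square tensor contr S
    by standard (use assms S in auto)
  have finf: "S finf = finf" using assms(4) by (simp add: symmetric_tensors_iff)
  obtain e1 e2 l1 l2 where e: "norm e1 = 1" "norm e2 = 1" "inner e1 e2 = 0"
    and eig: "contr finf e1 = l1 *\<^sub>R e1" "contr finf e2 = l2 *\<^sub>R e2" and l: "0 < l1 * l2"
    by (rule eigenvectors_same_sign[OF finf assms(5)]) (use assms(6) in auto)
  interpret orthonormal_pair tensor contr S e1 e2
    by standard (use e in auto)
  obtain K where K: "0 \<le> K" "\<And>f g. norm (contr f g) \<le> norm f * norm g * K"
    using contr.nonneg_bounded by auto
  obtain R where R: "0 \<le> R" "\<And>f. norm (resid f) \<le> norm f * R"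
    using resid.nonneg_bounded by auto
  obtain \<delta> c where \<delta>: "0 < \<delta>" and c: "0 \<le> c"
    and pert: "quadratic_perturbation_bound l1 l2 \<delta> c"
    by (rule std_normal_quadratic_perturbation[OF l])
  \<comment> \<open>The denominator \<open>K + 1\<close> is positive even if \<open>K = 0\<close>,
    and a distance of at most \<open>\<eta>\<close> meets both smallness conditions of
    \<open>total_variation_le\<close>.\<close>
  define \<eta> where "\<eta> = min 1 (\<delta> / (K + 1))"
  have \<eta>: "0 < \<eta>" using \<delta> K by (simp add: \<eta>_def)
  define c1 where "c1 = c * (11 * K + 18 * K\<^sup>2 + 2 * R)"
  have c1: "0 \<le> c1" using c K R by (simp add: c1_def)
  show ?thesis
  \<comment> \<open>Everything in the constant has been chosen from \<open>finf\<close> before the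
    process and the sequence appear. \<open>c1\<close> serves tensors within distance
    \<open>\<eta>\<close>; beyond it, \<open>1 / \<eta>\<close> makes the right side at least 1,
    which bounds any difference of probabilities.\<close>
  proof (intro exI[of _ "1 / \<eta> + c1"] conjI allI impI)
    show "0 < 1 / \<eta> + c1" using \<eta> c1 by (simp add: add_pos_nonneg)
  next
    fix M :: "'w measure" and X :: "'h \<Rightarrow> 'w \<Rightarrow> real" and I2 :: "'k \<Rightarrow> 'w \<Rightarrow> real" and f :: "nat \<Rightarrow> 'k" and n
    assume M: "isonormal_gaussian_process M X" and I2: "double_wiener_ito_integral M X tensor I2"
      and f: "\<forall>n. f n \<in> symmetric_tensors tensor"
    interpret prob_space M using M by (simp add: isonormal_gaussian_process_def)
    interpret wiener_ito_pair M X tensor contr S I2 e1 e2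
      by standard (use M I2 in auto)
    have fn: "S (f n) = f n" using f by (simp add: symmetric_tensors_iff)
    have [measurable]: "I2 (f n) \<in> borel_measurable M" "I2 finf \<in> borel_measurable M"
      using fn finf by (auto intro: measurable_I2)
    show "(SUP C\<in>sets (borel :: real measure).
              \<bar>measure M {\<omega>\<in>space M. I2 (f n) \<omega> \<in> C} - measure M {\<omega>\<in>space M. I2 finf \<omega> \<in> C}\<bar>)
            \<le> (1 / \<eta> + c1) * norm (f n - finf)"
    proof (rule cSUP_least)
      fix C :: "real set" assume C [measurable]: "C \<in> sets borel"
      show "\<bar>measure M {\<omega>\<in>space M. I2 (f n) \<omega> \<in> C} - measure M {\<omega>\<in>space M. I2 finf \<omega> \<in> C}\<bar>
        \<le> (1 / \<eta> + c1) * norm (f n - finf)"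
      proof (cases "norm (f n - finf) \<le> \<eta>")
        case True
        have "K * norm (f n - finf) \<le> (K + 1) * (\<delta> / (K + 1))"
          using True K \<delta> by (intro mult_mono) (auto simp: \<eta>_def)
        then have small: "K * norm (f n - finf) \<le> \<delta>" "norm (f n - finf) \<le> 1"
          using True K by (auto simp: \<eta>_def)
        have prob_eq: "measure M {\<omega>\<in>space M. Y \<omega> \<in> C} = expectation (\<lambda>\<omega>. indicator C (Y \<omega>))"
          if [measurable]: "Y \<in> borel_measurable M" for Y :: "'w \<Rightarrow> real"
        proof -
          have "expectation (\<lambda>\<omega>. indicator C (Y \<omega>)) = expectation (indicator {\<omega>\<in>space M. Y \<omega> \<in> C})"
            by (intro Bochner_Integration.integral_cong) (auto split: split_indicator)
          also have "\<dots> = measure M {\<omega>\<in>space M. Y \<omega> \<in> C}" by (subst Bochner_Integration.integral_indicator) (auto intro!: arg_cong[where f=prob])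
          finally show ?thesis ..
        qed
        have "\<bar>expectation (\<lambda>\<omega>. indicator C (I2 (f n) \<omega>)) - expectation (\<lambda>\<omega>. indicator C (I2 finf \<omega>))\<bar>
            \<le> c1 * norm (f n - finf)"
          unfolding c1_def
          by (rule total_variation_le[OF finf eig fn pert c K(2,1) R(2,1) small]) auto
        also have "\<dots> \<le> (1 / \<eta> + c1) * norm (f n - finf)"
          using \<eta> by (intro mult_right_mono) auto
        finally show ?thesis by (simp add: prob_eq)
      next
        case False
        have "\<bar>measure M {\<omega>\<in>space M. I2 (f n) \<omega> \<in> C} - measure M {\<omega>\<in>space M. I2 finf \<omega> \<in> C}\<bar> \<le> 1"
        proof -
          have "\<bar>x - y\<bar> \<le> 1" if "0 \<le> x" "x \<le> 1" "0 \<le> y" "y \<le> 1" for x y :: real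
            using that by linarith
          then show ?thesis by (simp add: measure_nonneg prob_le_1)
        qed
        also have "1 \<le> 1 / \<eta> * norm (f n - finf)" using False \<eta> by (simp add: field_simps)
        also have "\<dots> \<le> (1 / \<eta> + c1) * norm (f n - finf)"
          using c1 by (intro mult_right_mono) auto
        finally show ?thesis .
      qed
    qed auto
  qed
qed

end
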